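(* Let $W$ be a simply laced Weyl group of finite type and let $\theta$ be the highest root of $W$. The highest 2-root in each $W$-orbit of 2-roots is given as follows. (i) If $W$ has type $A_n$ where $n>2$, then the highest 2-root is $\alpha_{1,n-1}\vee\alpha_{2,n}=(\varepsilon_1-\varepsilon_n)\vee(\varepsilon_2-\varepsilon_{n+1})$. (ii) If $W$ has type $D_4$, then the highest 2-roots in each of the three orbits are $$(\theta-\alpha_{2,4})\vee(\theta-\alpha_{2,3})=\alpha_{1,3}\vee\alpha_{1,4}=(\varepsilon_1-\varepsilon_4)\vee(\varepsilon_1+\varepsilon_4)=(\varepsilon_1\vee\varepsilon_1)-(\varepsilon_4\vee\varepsilon_4),$$ $$(\theta-\alpha_{2,4})\vee(\theta-\alpha_{1,2})=\alpha_{1,3}\vee\alpha_{3,4}=(\varepsilon_1-\varepsilon_4)\vee(\varepsilon_2+\varepsilon_3),$$ $$(\theta-\alpha_{2,3})\vee(\theta-\alpha_{1,2})=\alpha_{1,4}\vee\alpha_{3,4}=(\varepsilon_1+\varepsilon_4)\vee(\varepsilon_2+\varepsilon_3).$$ (iii) If $W$ has type $D_n$ for $n\ge5$, then the highest 2-root in the small orbit is $\alpha_{1,n-1}\vee\alpha_{1,n}=(\varepsilon_1-\varepsilon_n)\vee(\varepsilon_1+\varepsilon_n)=(\varepsilon_1\vee\varepsilon_1)-(\varepsilon_n\vee\varepsilon_n)$. (iv) If $W$ has type $D_n$ for $n\ge5$, then the highest 2-root in the large orbit is $(\theta-\alpha_{1,2})\vee(\theta-\alpha_{2,3})=(\theta-\alpha_1-\alpha_2)\vee(\theta-\alpha_2-\alpha_3)=(\varepsilon_2+\varepsilon_3)\vee(\varepsilon_1+\varepsilon_4)$.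 (v) If $W$ has type $E_6$, then the highest 2-root is $(\theta-\alpha_{2,x})\vee(\theta-\alpha_{4,x})=(\theta-\alpha_{2,y})\vee(\theta-\alpha_{4,y})$. (vi) If $W$ has type $E_7$, then the highest 2-root is $(\theta-\alpha_{x,1})\vee(\theta-\alpha_{4,1})=(\theta-\alpha_{x,y})\vee(\theta-\alpha_{4,y})$. (vii) If $W$ has type $E_8$, then the highest 2-root is $(\theta-\alpha_{2,7})\vee(\theta-\alpha_{x,7})=(\theta-\alpha_{2,y})\vee(\theta-\alpha_{x,y})$.
   Context: $W$ is the Weyl group of a Dynkin diagram $\Gamma$ of type $A_n$, $D_n$ ($n\ge4$), $E_6$, $E_7$ or $E_8$, with simple roots $\Pi=\{\alpha_i\}$, a basis of the real reflection representation $V$, and $W$-invariant form $B$ with $B(\alpha_i,\alpha_i)=2$, $B(\alpha_i,\alpha_j)=-1$ for adjacent $i,j$, and $0$ otherwise. Put $\alpha\vee\beta=\alpha\otimes\beta+\beta\otimes\alpha$; a 2-root is $\alpha\vee\beta$ with $\alpha,\beta$ orthogonal roots; $W$ acts diagonally. Labelling. Type $A_n$: $\alpha_i=\varepsilon_i-\varepsilon_{i+1}$ ($1\le i\le n$), with $\varepsilon_1,\dots,\varepsilon_{n+1}$ orthonormal. Type $D_n$: $\alpha_i=\varepsilon_i-\varepsilon_{i+1}$ ($1\le i<n$), $\alpha_n=\varepsilon_{n-1}+\varepsilon_n$, with $\varepsilon_1,\dots,\varepsilon_n$ orthonormal (the branch vertex is $n-2$, adjacent to $n-3,n-1,n$);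 positive roots are $\varepsilon_i\pm\varepsilon_j$ ($i<j$), highest root $\varepsilon_1+\varepsilon_2$. Type $E_n$: the branch vertex is $3$, $1$--$2$--$3$--$\cdots$--$(n-1)$ is a path, and the last vertex $x$ is adjacent to $3$. For vertices $b,c$ of the diagram, $\alpha_{b,c}$ is the sum of the simple roots $\alpha_i$ over all vertices $i$ on the unique path from $b$ to $c$, both endpoints included. $\alpha_y$ denotes the unique simple root not orthogonal to $\theta$ in types $D_n$, $E_6,E_7,E_8$: $y=2$ in type $D_n$, $y=x$ in $E_6$, $y=1$ in $E_7$, $y=7$ in $E_8$. Orbits. In type $D_n$ ($n\ge5$) there are two orbits of positive 2-roots (2-roots $\alpha\vee\beta$ with $\alpha,\beta$ both positive): the small orbit $\{(\varepsilon_i-\varepsilon_j)\vee(\varepsilon_i+\varepsilon_j):1\le i<j\le n\}$, and the large orbit consisting of all other positive 2-roots. In type $D_4$ there are three orbits; in types $A_n$ ($n>2$) and $E_6,E_7,E_8$ there is one. Canonical basis $\mathcal{B}$. The highest root of type $D_m$ ($m\ge4$) is the sum of the simple roots with coefficient $1$ at the endpoints of the diagram and $2$ at all other vertices. A positive root $\beta$ is elementary with respect to $\alpha_i$ if: (1) $\beta=\alpha_j$ is simple with $j\neq i$ not adjacent to $i$; or (2) $\beta=\alpha_h+\alpha_i+\alpha_j$ for a path $h$--$i$--$j$ in $\Gamma$; or (3) $\Gamma$ has a branch vertex, $i$ is not that vertex, and $\beta=\theta_i$ is the highest root of the standard parabolic subsystem of type $D_m$ ($m\ge4$) whose simple roots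 are those on the path from $i$ to the branch vertex together with all neighbours of the branch vertex. $\mathcal{B}$ is the set of all $\alpha_i\vee\beta$ with $\beta$ elementary with respect to $\alpha_i$; it is linearly independent and all 2-roots lie in $\mathbb{Z}\mathcal{B}$. Write $q_1\le_2q_2$ ($q_1,q_2\in\mathbb{Z}\mathcal{B}$) if $q_2-q_1$ is a linear combination of elements of $\mathcal{B}$ with nonnegative coefficients. The highest 2-root of an orbit is the maximum element of the orbit with respect to $\le_2$. *)

theory Defs
  imports Complex_Main "HOL-Library.Function_Algebras"
begin

section \<open>Simply laced Dynkin diagrams\<close>

datatype dynkin = DynkinA nat | DynkinD nat | DynkinE nat

fun vertices :: "dynkin \<Rightarrow> nat set" where
  "vertices (DynkinA n) = {1..n}"
| "vertices (DynkinD n) = {1..n}"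
| "vertices (DynkinE n) = {1..n}"

text \<open>In type \<open>E\<^sub>n\<close> the vertices \<open>1, \<dots>, n - 1\<close> form the long path and the vertex called
  \<open>x\<close> in the literature, attached to the branch vertex \<open>3\<close>, is the vertex \<open>n\<close>.\<close>

fun edge :: "dynkin \<Rightarrow> nat \<Rightarrow> nat \<Rightarrow> bool" where
  "edge (DynkinA n) i j \<longleftrightarrow> 1 \<le> i \<and> j = i + 1 \<and> j \<le> n"
| "edge (DynkinD n) i j \<longleftrightarrow> (1 \<le> i \<and> j = i + 1 \<and> j \<le> n - 1) \<or> (i = n - 2 \<and> j = n)"
| "edge (DynkinE n) i j \<longleftrightarrow> (1 \<le> i \<and> j = i + 1 \<and> j \<le> n - 1) \<or> (i = 3 \<and> j = n)"

definition adj :: "dynkin \<Rightarrow> nat \<Rightarrow> nat \<Rightarrow> bool" where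
  "adj \<Gamma> i j \<longleftrightarrow> edge \<Gamma> i j \<or> edge \<Gamma> j i"

fun simply_laced_finite :: "dynkin \<Rightarrow> bool" where
  "simply_laced_finite (DynkinA n) \<longleftrightarrow> n \<ge> 1"
| "simply_laced_finite (DynkinD n) \<longleftrightarrow> n \<ge> 4"
| "simply_laced_finite (DynkinE n) \<longleftrightarrow> n \<in> {6, 7, 8}"

definition neighbours :: "dynkin \<Rightarrow> nat \<Rightarrow> nat set" where
  "neighbours \<Gamma> i = {j \<in> vertices \<Gamma>. adj \<Gamma> i j}"

definition is_branch :: "dynkin \<Rightarrow> nat \<Rightarrow> bool" where
  "is_branch \<Gamma> b \<longleftrightarrow> b \<in> vertices \<Gamma> \<and> card (neighbours \<Gamma> b) \<ge> 3"

definition is_path :: "dynkin \<Rightarrow> nat \<Rightarrow> nat \<Rightarrow> nat list \<Rightarrow> bool" where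
  "is_path \<Gamma> b c p \<longleftrightarrow> p \<noteq> [] \<and> hd p = b \<and> last p = c \<and> distinct p \<and> set p \<subseteq> vertices \<Gamma> \<and>
     (\<forall>k. Suc k < length p \<longrightarrow> adj \<Gamma> (p ! k) (p ! Suc k))"

definition path_vertices :: "dynkin \<Rightarrow> nat \<Rightarrow> nat \<Rightarrow> nat set" where
  "path_vertices \<Gamma> b c = set (THE p. is_path \<Gamma> b c p)"

definition cartan :: "dynkin \<Rightarrow> nat \<Rightarrow> nat \<Rightarrow> real" where
  "cartan \<Gamma> i j = (if i = j then 2 else if adj \<Gamma> i j then - 1 else 0)"


section \<open>The reflection representation\<close>

text \<open>Vectors are coordinate functions supported on \<open>coords \<Gamma>\<close>.  In types \<open>A\<^sub>n\<close> and \<open>D\<^sub>n\<close> the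
  coordinates refer to the orthonormal vectors \<open>\<epsilon>\<^sub>i\<close> (so in type \<open>A\<^sub>n\<close> the reflection
  representation is the hyperplane of \<open>\<real>\<^sup>n\<^sup>+\<^sup>1\<close> spanned by the simple roots); in type \<open>E\<^sub>n\<close> they
  refer to the basis of simple roots itself.  The lemma \<open>form_simple_root\<close> shows that the
  form takes the prescribed values on simple roots in all types.\<close>

type_synonym vec = "nat \<Rightarrow> real"

fun coords :: "dynkin \<Rightarrow> nat set" where
  "coords (DynkinA n) = {1..n + 1}"
| "coords (DynkinD n) = {1..n}"
| "coords (DynkinE n) = {1..n}"

definition eps :: "nat \<Rightarrow> vec" where
  "eps i = (\<lambda>k. if k = i then 1 else 0)"

fun simple_root :: "dynkin \<Rightarrow> nat \<Rightarrow> vec" where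
  "simple_root (DynkinA n) i = eps i - eps (i + 1)"
| "simple_root (DynkinD n) i = (if i < n then eps i - eps (i + 1) else eps (n - 1) + eps n)"
| "simple_root (DynkinE n) i = eps i"

fun form :: "dynkin \<Rightarrow> vec \<Rightarrow> vec \<Rightarrow> real" where
  "form (DynkinA n) v w = (\<Sum>k\<in>coords (DynkinA n). v k * w k)"
| "form (DynkinD n) v w = (\<Sum>k\<in>coords (DynkinD n). v k * w k)"
| "form (DynkinE n) v w =
     (\<Sum>i\<in>coords (DynkinE n). \<Sum>j\<in>coords (DynkinE n). cartan (DynkinE n) i j * v i * w j)"

definition reflection :: "dynkin \<Rightarrow> nat \<Rightarrow> vec \<Rightarrow> vec" where
  "reflection \<Gamma> i v = (\<lambda>k. v k - form \<Gamma> (simple_root \<Gamma> i) v * simple_root \<Gamma> i k)"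

text \<open>Simple reflections are involutions, so the monoid they generate is the group \<open>W\<close>.\<close>

inductive_set weyl :: "dynkin \<Rightarrow> (vec \<Rightarrow> vec) set" for \<Gamma> where
  weyl_id: "id \<in> weyl \<Gamma>"
| weyl_step: "w \<in> weyl \<Gamma> \<Longrightarrow> i \<in> vertices \<Gamma> \<Longrightarrow> reflection \<Gamma> i \<circ> w \<in> weyl \<Gamma>"

definition roots :: "dynkin \<Rightarrow> vec set" where
  "roots \<Gamma> = {w (simple_root \<Gamma> i) | w i. w \<in> weyl \<Gamma> \<and> i \<in> vertices \<Gamma>}"

definition nonneg_comb_simple :: "dynkin \<Rightarrow> vec \<Rightarrow> bool" where
  "nonneg_comb_simple \<Gamma> v \<longleftrightarrow> (\<exists>c :: nat \<Rightarrow> real. (\<forall>i \<in> vertices \<Gamma>. c i \<ge> 0) \<and>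
     v = (\<lambda>k. \<Sum>i\<in>vertices \<Gamma>. c i * simple_root \<Gamma> i k))"

definition pos_roots :: "dynkin \<Rightarrow> vec set" where
  "pos_roots \<Gamma> = {\<beta> \<in> roots \<Gamma>. nonneg_comb_simple \<Gamma> \<beta>}"

definition highest_root :: "dynkin \<Rightarrow> vec" where
  "highest_root \<Gamma> = (THE \<theta>. \<theta> \<in> roots \<Gamma> \<and> (\<forall>\<beta> \<in> roots \<Gamma>. nonneg_comb_simple \<Gamma> (\<theta> - \<beta>)))"

text \<open>The index \<open>y\<close>; meaningful in types \<open>D\<close> and \<open>E\<close> only.\<close>

definition y_index :: "dynkin \<Rightarrow> nat" where
  "y_index \<Gamma> = (THE i. i \<in> vertices \<Gamma> \<and> form \<Gamma> (simple_root \<Gamma> i) (highest_root \<Gamma>) \<noteq> 0)"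

definition path_root :: "dynkin \<Rightarrow> nat \<Rightarrow> nat \<Rightarrow> vec" where
  "path_root \<Gamma> b c = (\<Sum>i\<in>path_vertices \<Gamma> b c. simple_root \<Gamma> i)"


section \<open>2-roots\<close>

text \<open>A tensor is given by its matrix of coefficients with respect to the tensors of coordinate
  vectors, \<open>eps i \<otimes> eps j\<close>.\<close>

type_synonym tensor = "nat \<Rightarrow> nat \<Rightarrow> real"

definition vee :: "vec \<Rightarrow> vec \<Rightarrow> tensor"  (infixl "\<or>\<^sub>2" 75) where
  "v \<or>\<^sub>2 w = (\<lambda>k l. v k * w l + w k * v l)"

text \<open>The diagonal action \<open>w \<otimes> w\<close>, extended linearly from \<open>eps i \<otimes> eps j\<close>.\<close>

definition act :: "dynkin \<Rightarrow> (vec \<Rightarrow> vec) \<Rightarrow> tensor \<Rightarrow> tensor" where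
  "act \<Gamma> w t = (\<lambda>k l. \<Sum>i\<in>coords \<Gamma>. \<Sum>j\<in>coords \<Gamma>. t i j * w (eps i) k * w (eps j) l)"

definition orbit :: "dynkin \<Rightarrow> tensor \<Rightarrow> tensor set" where
  "orbit \<Gamma> q = {act \<Gamma> w q | w. w \<in> weyl \<Gamma>}"

definition two_roots :: "dynkin \<Rightarrow> tensor set" where
  "two_roots \<Gamma> = {\<alpha> \<or>\<^sub>2 \<beta> | \<alpha> \<beta>. \<alpha> \<in> roots \<Gamma> \<and> \<beta> \<in> roots \<Gamma> \<and> form \<Gamma> \<alpha> \<beta> = 0}"

definition pos_two_roots :: "dynkin \<Rightarrow> tensor set" where
  "pos_two_roots \<Gamma> =
     {\<alpha> \<or>\<^sub>2 \<beta> | \<alpha> \<beta>. \<alpha> \<in> pos_roots \<Gamma> \<and> \<beta> \<in> pos_roots \<Gamma> \<and> form \<Gamma> \<alpha> \<beta> = 0}"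

definition two_root_orbits :: "dynkin \<Rightarrow> tensor set set" where
  "two_root_orbits \<Gamma> = orbit \<Gamma> ` two_roots \<Gamma>"

text \<open>A \<open>W\<close>-orbit of 2-roots is closed under negation, as \<open>s\<^sub>\<beta>\<close> sends \<open>\<alpha> \<or>\<^sub>2 \<beta>\<close> to its
  negative.  The next two sets are the positive parts of the two orbits in type \<open>D\<^sub>n\<close>, \<open>n \<ge> 5\<close>.\<close>

definition small_pos_two_roots :: "nat \<Rightarrow> tensor set" where
  "small_pos_two_roots n =
     {(eps i - eps j) \<or>\<^sub>2 (eps i + eps j) | i j. 1 \<le> i \<and> i < j \<and> j \<le> n}"

definition large_pos_two_roots :: "nat \<Rightarrow> tensor set" where
  "large_pos_two_roots n = pos_two_roots (DynkinD n) - small_pos_two_roots n"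


section \<open>The canonical basis and the associated order\<close>

text \<open>\<open>theta_sub \<Gamma> i b\<close> is the highest root of the parabolic subsystem of type \<open>D\<^sub>m\<close> on the
  vertices of the path from \<open>i\<close> to the branch vertex \<open>b\<close> and the neighbours of \<open>b\<close>:
  coefficient 1 at the endpoints of that subdiagram, and 2 elsewhere.\<close>

definition theta_support :: "dynkin \<Rightarrow> nat \<Rightarrow> nat \<Rightarrow> nat set" where
  "theta_support \<Gamma> i b = path_vertices \<Gamma> i b \<union> neighbours \<Gamma> b"

definition theta_sub :: "dynkin \<Rightarrow> nat \<Rightarrow> nat \<Rightarrow> vec" where
  "theta_sub \<Gamma> i b = (\<lambda>k. \<Sum>j\<in>theta_support \<Gamma> i b.
     (if card (neighbours \<Gamma> j \<inter> theta_support \<Gamma> i b) = 1 then 1 else 2) * simple_root \<Gamma> j k)"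

definition elementary :: "dynkin \<Rightarrow> nat \<Rightarrow> vec \<Rightarrow> bool" where
  "elementary \<Gamma> i \<beta> \<longleftrightarrow> \<beta> \<in> pos_roots \<Gamma> \<and>
     ((\<exists>j \<in> vertices \<Gamma>. j \<noteq> i \<and> \<not> adj \<Gamma> i j \<and> \<beta> = simple_root \<Gamma> j) \<or>
      (\<exists>h \<in> vertices \<Gamma>. \<exists>j \<in> vertices \<Gamma>. h \<noteq> j \<and> adj \<Gamma> h i \<and> adj \<Gamma> i j \<and>
         \<beta> = simple_root \<Gamma> h + simple_root \<Gamma> i + simple_root \<Gamma> j) \<or>
      (\<exists>b. is_branch \<Gamma> b \<and> i \<noteq> b \<and> \<beta> = theta_sub \<Gamma> i b))"

definition canonical_basis :: "dynkin \<Rightarrow> tensor set" where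
  "canonical_basis \<Gamma> = {simple_root \<Gamma> i \<or>\<^sub>2 \<beta> | i \<beta>. i \<in> vertices \<Gamma> \<and> elementary \<Gamma> i \<beta>}"

definition int_span :: "tensor set \<Rightarrow> tensor set" where
  "int_span S = {q. \<exists>F (c :: tensor \<Rightarrow> int). finite F \<and> F \<subseteq> S \<and>
     q = (\<lambda>k l. \<Sum>b\<in>F. of_int (c b) * b k l)}"

definition le2 :: "dynkin \<Rightarrow> tensor \<Rightarrow> tensor \<Rightarrow> bool" where
  "le2 \<Gamma> q\<^sub>1 q\<^sub>2 \<longleftrightarrow> q\<^sub>1 \<in> int_span (canonical_basis \<Gamma>) \<and> q\<^sub>2 \<in> int_span (canonical_basis \<Gamma>) \<and>
     (\<exists>F (c :: tensor \<Rightarrow> real). finite F \<and> F \<subseteq> canonical_basis \<Gamma> \<and> (\<forall>b \<in> F. c b \<ge> 0) \<and>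
       q\<^sub>2 - q\<^sub>1 = (\<lambda>k l. \<Sum>b\<in>F. c b * b k l))"

definition is_highest :: "dynkin \<Rightarrow> tensor set \<Rightarrow> tensor \<Rightarrow> bool" where
  "is_highest \<Gamma> Orb q \<longleftrightarrow> q \<in> Orb \<and> (\<forall>q' \<in> Orb. le2 \<Gamma> q' q)"


section \<open>Sanity checks\<close>

lemma sum_eps_mult:
  assumes "finite S"
  shows "(\<Sum>k\<in>S. eps i k * f k) = (if i \<in> S then f i else 0)"
    and "(\<Sum>k\<in>S. f k * eps i k) = (if i \<in> S then f i else 0)"
proof -
  have "(\<Sum>k\<in>S. eps i k * f k) = (\<Sum>k\<in>S. if k = i then f k else 0)"
    by (rule sum.cong) (auto simp: eps_def)
  then show 1: "(\<Sum>k\<in>S. eps i k * f k) = (if i \<in> S then f i else 0)"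
    using assms by simp
  then show "(\<Sum>k\<in>S. f k * eps i k) = (if i \<in> S then f i else 0)"
    by (simp add: mult.commute)
qed

lemma form_simple_root:
  assumes "simply_laced_finite \<Gamma>" and "i \<in> vertices \<Gamma>" and "j \<in> vertices \<Gamma>"
  shows "form \<Gamma> (simple_root \<Gamma> i) (simple_root \<Gamma> j) = cartan \<Gamma> i j"
proof (cases \<Gamma>)
  case (DynkinA n)
  have "form \<Gamma> (simple_root \<Gamma> i) (simple_root \<Gamma> j) =
        simple_root \<Gamma> j i - simple_root \<Gamma> j (i + 1)"
    using assms DynkinA
    by (simp add: left_diff_distrib sum_subtractf sum_eps_mult del: sum.cl_ivl_Suc)
  then show ?thesis using assms DynkinA by (auto simp: eps_def cartan_def adj_def)
next
  case (DynkinD n)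
  have "form \<Gamma> (simple_root \<Gamma> i) (simple_root \<Gamma> j) =
        (if i < n then simple_root \<Gamma> j i - simple_root \<Gamma> j (i + 1)
         else simple_root \<Gamma> j (n - 1) + simple_root \<Gamma> j n)"
    using assms DynkinD
    by (auto simp: left_diff_distrib distrib_right sum_subtractf sum.distrib sum_eps_mult)
  then show ?thesis using assms DynkinD
    by (auto simp: eps_def cartan_def adj_def)
next
  case (DynkinE n)
  have "form \<Gamma> (simple_root \<Gamma> i) (simple_root \<Gamma> j) = 
        (\<Sum>k=1..n. \<Sum>l=1..n. (eps i k * cartan \<Gamma> k l) * eps j l)"
    using DynkinE by (simp add: mult_ac)
  also have "\<dots> = (\<Sum>k=1..n. eps i k * cartan \<Gamma> k j)"
    using assms DynkinE by (subst sum_eps_mult) auto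
  also have "\<dots> = cartan \<Gamma> i j"
    using assms DynkinE by (subst sum_eps_mult) auto
  finally show ?thesis .
qed

lemma finite_coords: "finite (coords \<Gamma>)"
  by (cases \<Gamma>) auto

lemma form_linear:
  "form \<Gamma> a (\<lambda>k. \<Sum>i\<in>S. c i * f i k) = (\<Sum>i\<in>S. c i * form \<Gamma> a (f i))"
proof (cases \<Gamma>)
  case (DynkinA n)
  show ?thesis unfolding DynkinA form.simps sum_distrib_left
    by (subst sum.swap) (simp only: mult_ac)
next
  case (DynkinD n)
  show ?thesis unfolding DynkinD form.simps sum_distrib_left
    by (subst sum.swap) (simp only: mult_ac)
next
  case (DynkinE n)
  have "form \<Gamma> a (\<lambda>k. \<Sum>i\<in>S. c i * f i k) =
    (\<Sum>k\<in>coords \<Gamma>. \<Sum>i\<in>S. \<Sum>l\<in>coords \<Gamma>. c i * (cartan \<Gamma> k l * a k * f i l))"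
    unfolding DynkinE form.simps sum_distrib_left
    by (subst (2) sum.swap) (simp only: mult_ac)
  also have "\<dots> = (\<Sum>i\<in>S. c i * form \<Gamma> a (f i))"
    unfolding DynkinE form.simps sum_distrib_left
    by (subst sum.swap) (rule refl)
  finally show ?thesis .
qed

lemma weyl_linear:
  assumes "w \<in> weyl \<Gamma>"
  shows "w (\<lambda>k. \<Sum>i\<in>S. c i * f i k) = (\<lambda>k. \<Sum>i\<in>S. c i * w (f i) k)"
  using assms
proof (induction rule: weyl.induct)
  case weyl_id
  show ?case by simp
next
  case (weyl_step w i)
  show ?case
    unfolding comp_def weyl_step.IH reflection_def form_linear
    by (simp add: fun_eq_iff sum_subtractf sum_distrib_left sum_distrib_right algebra_simps)
qed

lemma weyl_eps_expand:
  assumes "w \<in> weyl \<Gamma>" and "\<forall>k. k \<notin> coords \<Gamma> \<longrightarrow> v k = 0"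
  shows "w v = (\<lambda>k. \<Sum>i\<in>coords \<Gamma>. v i * w (eps i) k)"
proof -
  have "v = (\<lambda>k. \<Sum>i\<in>coords \<Gamma>. v i * eps i k)"
  proof
    fix k
    have "(\<Sum>i\<in>coords \<Gamma>. v i * eps i k) = (\<Sum>i\<in>coords \<Gamma>. v i * eps k i)"
      by (rule sum.cong) (auto simp: eps_def)
    then show "v k = (\<Sum>i\<in>coords \<Gamma>. v i * eps i k)"
      using assms(2) finite_coords by (simp add: sum_eps_mult)
  qed
  then have "w v = w (\<lambda>k. \<Sum>i\<in>coords \<Gamma>. v i * eps i k)" by (rule arg_cong)
  then show ?thesis by (simp only: weyl_linear[OF assms(1)])
qed

lemma act_vee:
  assumes "w \<in> weyl \<Gamma>"
    and "\<forall>k. k \<notin> coords \<Gamma> \<longrightarrow> u k = 0" and "\<forall>k. k \<notin> coords \<Gamma> \<longrightarrow> v k = 0"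
  shows "act \<Gamma> w (u \<or>\<^sub>2 v) = w u \<or>\<^sub>2 w v"
proof (intro ext)
  fix k l
  have swap: "(\<Sum>i\<in>coords \<Gamma>. \<Sum>j\<in>coords \<Gamma>. v i * u j * w (eps i) k * w (eps j) l) = w v k * w u l"
    if "\<forall>k. k \<notin> coords \<Gamma> \<longrightarrow> u k = 0" and "\<forall>k. k \<notin> coords \<Gamma> \<longrightarrow> v k = 0" for u v
    unfolding weyl_eps_expand[OF assms(1) that(1)] weyl_eps_expand[OF assms(1) that(2)]
      sum_product by (simp only: mult_ac)
  have "act \<Gamma> w (u \<or>\<^sub>2 v) k l =
    (\<Sum>i\<in>coords \<Gamma>. \<Sum>j\<in>coords \<Gamma>. u i * v j * w (eps i) k * w (eps j) l) +
    (\<Sum>i\<in>coords \<Gamma>. \<Sum>j\<in>coords \<Gamma>. v i * u j * w (eps i) k * w (eps j) l)"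
    unfolding act_def vee_def sum.distrib[symmetric] distrib_right ..
  also have "\<dots> = (w u \<or>\<^sub>2 w v) k l"
    unfolding swap[OF assms(3,2)] swap[OF assms(2,3)] vee_def ..
  finally show "act \<Gamma> w (u \<or>\<^sub>2 v) k l = (w u \<or>\<^sub>2 w v) k l" .
qed

end

theory Submission
  imports Defs
begin

text \<open>
  Let \<open>h\<close> be the height function and let \<open>F\<close> be the linear functional on symmetric tensors with
  \<open>F (\<alpha> \<or>\<^sub>2 \<beta>) = h \<alpha> * h \<beta>\<close>.  A simple reflection \<open>s\<^sub>i\<close> changes a 2-root by \<open>\<alpha>\<^sub>i \<or>\<^sub>2 \<gamma>\<close>, where
  \<open>\<gamma>\<close> is orthogonal to \<open>\<alpha>\<^sub>i\<close> and is zero, a root or twice a root (\<open>reflection_vee\<close>, \<open>move_cases\<close>), and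
  it changes \<open>F\<close> by \<open>h \<gamma>\<close>.  The elementary roots for \<open>\<alpha>\<^sub>i\<close> are the simple roots of the positive system
  formed by the positive roots orthogonal to \<open>\<alpha>\<^sub>i\<close>; hence \<open>\<alpha>\<^sub>i \<or>\<^sub>2 \<gamma>\<close> is a sum of elements of the
  canonical basis whenever \<open>\<gamma>\<close> is a positive root orthogonal to \<open>\<alpha>\<^sub>i\<close>.  So a 2-root and its image
  under \<open>s\<^sub>i\<close> are always comparable, and \<open>F\<close> decides which of the two is larger.

  This gives two walks, both carried out in the locale \<open>two_root_system\<close>.  Downwards, an
  orthogonal pair of positive roots, neither of them simple, always has a simple reflection that
  lowers \<open>F\<close> (\<open>descent_exists\<close>).  The walk ends at a 2-root with a simple component, so
  every positive 2-root is a sum of elements of the canonical basis.  Upwards, since \<open>F\<close> is integral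
  and bounded on 2-roots, every positive 2-root climbs through larger and larger 2-roots of its orbit
  to a local maximum of \<open>F\<close>.  If a \<open>W\<close>-invariant class of 2-roots has only one local maximum
  among its positive members, then the class is a single orbit and this local maximum is its
  highest element (\<open>highest_in_orbit\<close>); a negative 2-root \<open>- p\<close> lies below because \<open>0\<close> lies between
  \<open>- p\<close> and the top.

  What is left is to find the positive local maxima.  If \<open>\<alpha> \<or>\<^sub>2 \<beta>\<close> is one, then \<open>\<alpha> + \<beta>\<close> is dominant
  (\<open>sum_dominant\<close>), which leaves few pairs.  In types A and D the roots are explicit in the
  coordinates \<open>\<epsilon>\<^sub>i\<close> and the local maxima are read off by hand.  The orbits in type D are told apart by
  the diagonal of the tensor, which is nonzero exactly on the small orbit, and in type \<open>D\<^sub>4\<close> moreover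
  by the sign of a hafnian.  In types \<open>E\<^sub>6\<close>, \<open>E\<^sub>7\<close>, \<open>E\<^sub>8\<close> the positive roots are enumerated by height
  as integer lists, and the finitely many pairs are checked by rewriting.
\<close>

section \<open>Bilinear algebra of the reflection representation\<close>

definition smul :: "real \<Rightarrow> vec \<Rightarrow> vec" where
  "smul c v = (\<lambda>k. c * v k)"

lemma smul_apply [simp]: "smul c v k = c * v k"
  by (simp add: smul_def)

lemma smul_simps [simp]:
  "smul 0 v = 0" "smul 1 v = v" "smul (- c) v = - smul c v"
  by (auto simp: fun_eq_iff)

lemma smul_smul: "smul c (smul d v) = smul (c * d) v"
  by (simp add: fun_eq_iff)

lemma adj_commute: "adj \<Gamma> i j \<longleftrightarrow> adj \<Gamma> j i"
  by (auto simp: adj_def)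

lemma cartan_commute: "cartan \<Gamma> i j = cartan \<Gamma> j i"
  by (simp add: cartan_def adj_commute)

lemma form_commute: "form \<Gamma> u v = form \<Gamma> v u"
proof (cases \<Gamma>)
  case (DynkinE n)
  show ?thesis
    unfolding DynkinE form.simps
    by (subst sum.swap, intro sum.cong refl) (simp add: cartan_commute mult_ac)
qed (simp_all add: mult.commute)

lemma form_add: "form \<Gamma> u (v + w) = form \<Gamma> u v + form \<Gamma> u w"
  by (cases \<Gamma>) (simp_all add: distrib_left sum.distrib del: sum.cl_ivl_Suc)

lemma form_smul: "form \<Gamma> u (smul c v) = c * form \<Gamma> u v"
  by (cases \<Gamma>) (simp_all add: sum_distrib_left mult_ac del: sum.cl_ivl_Suc)

lemma form_minus: "form \<Gamma> u (- v) = - form \<Gamma> u v"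
  using form_smul[of \<Gamma> u "- 1" v] by (simp add: fun_eq_iff)

lemma form_diff: "form \<Gamma> u (v - w) = form \<Gamma> u v - form \<Gamma> u w"
  using form_add[of \<Gamma> u v "- w"] by (simp add: form_minus)

lemma form_left:
  "form \<Gamma> (v + w) u = form \<Gamma> v u + form \<Gamma> w u"
  "form \<Gamma> (smul c v) u = c * form \<Gamma> v u"
  "form \<Gamma> (- v) u = - form \<Gamma> v u"
  "form \<Gamma> (v - w) u = form \<Gamma> v u - form \<Gamma> w u"
  by (simp_all add: form_commute[of \<Gamma> _ u] form_add form_smul form_minus form_diff)

lemmas form_linear_simps = form_add form_smul form_minus form_diff form_left

definition root_refl :: "dynkin \<Rightarrow> vec \<Rightarrow> vec \<Rightarrow> vec" where
  "root_refl \<Gamma> \<beta> v = v - smul (form \<Gamma> \<beta> v) \<beta>"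

lemma reflection_eq: "reflection \<Gamma> i = root_refl \<Gamma> (simple_root \<Gamma> i)"
  by (simp add: fun_eq_iff reflection_def root_refl_def)

lemma root_refl_isometry:
  assumes "form \<Gamma> \<beta> \<beta> = 2"
  shows "form \<Gamma> (root_refl \<Gamma> \<beta> u) (root_refl \<Gamma> \<beta> v) = form \<Gamma> u v"
  using assms form_commute[of \<Gamma> u \<beta>]
  by (simp add: root_refl_def form_linear_simps algebra_simps)

lemma root_refl_linear:
  "root_refl \<Gamma> \<beta> (u + v) = root_refl \<Gamma> \<beta> u + root_refl \<Gamma> \<beta> v"
  "root_refl \<Gamma> \<beta> (smul c v) = smul c (root_refl \<Gamma> \<beta> v)"
  "root_refl \<Gamma> \<beta> (- v) = - root_refl \<Gamma> \<beta> v"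
  "root_refl \<Gamma> \<beta> (u - v) = root_refl \<Gamma> \<beta> u - root_refl \<Gamma> \<beta> v"
  by (simp_all add: root_refl_def form_linear_simps fun_eq_iff algebra_simps)

lemma root_refl_root_refl:
  assumes "form \<Gamma> \<beta> \<beta> = 2"
  shows "root_refl \<Gamma> \<beta> (root_refl \<Gamma> \<beta> v) = v"
  using assms by (simp add: root_refl_def form_linear_simps fun_eq_iff algebra_simps)

text \<open>Conjugation by a reflection: \<open>s\<^bsub>s\<^sub>\<beta> \<gamma>\<^esub> = s\<^sub>\<beta> s\<^sub>\<gamma> s\<^sub>\<beta>\<close>.  This is what puts the reflections in all roots
into the Weyl group.\<close>

lemma root_refl_conj:
  assumes "form \<Gamma> \<beta> \<beta> = 2"
  shows "root_refl \<Gamma> (root_refl \<Gamma> \<beta> \<gamma>) v =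
         root_refl \<Gamma> \<beta> (root_refl \<Gamma> \<gamma> (root_refl \<Gamma> \<beta> v))"
proof -
  have "form \<Gamma> (root_refl \<Gamma> \<beta> \<gamma>) v = form \<Gamma> \<gamma> (root_refl \<Gamma> \<beta> v)"
    using root_refl_isometry[OF assms, of \<gamma> "root_refl \<Gamma> \<beta> v"] root_refl_root_refl[OF assms]
    by simp
  then show ?thesis
    unfolding root_refl_def[of \<Gamma> "root_refl \<Gamma> \<beta> \<gamma>"] root_refl_def[of \<Gamma> \<gamma>]
    by (simp add: root_refl_linear root_refl_root_refl[OF assms])
qed


section \<open>The Weyl group and its roots\<close>

lemma weyl_comp: "w \<in> weyl \<Gamma> \<Longrightarrow> w' \<in> weyl \<Gamma> \<Longrightarrow> w \<circ> w' \<in> weyl \<Gamma>"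
  by (induction rule: weyl.induct) (auto simp: comp_assoc intro: weyl.intros)

lemma weyl_reflection: "i \<in> vertices \<Gamma> \<Longrightarrow> reflection \<Gamma> i \<in> weyl \<Gamma>"
  using weyl_step[OF weyl_id] by simp

lemma simple_root_norm:
  "simply_laced_finite \<Gamma> \<Longrightarrow> i \<in> vertices \<Gamma> \<Longrightarrow> form \<Gamma> (simple_root \<Gamma> i) (simple_root \<Gamma> i) = 2"
  by (simp add: form_simple_root cartan_def)

lemma reflection_involution:
  assumes "simply_laced_finite \<Gamma>" "i \<in> vertices \<Gamma>"
  shows "reflection \<Gamma> i (reflection \<Gamma> i v) = v"
  unfolding reflection_eq by (intro root_refl_root_refl simple_root_norm assms)

lemma weyl_inverse:
  assumes "simply_laced_finite \<Gamma>" "w \<in> weyl \<Gamma>"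
  obtains w' where "w' \<in> weyl \<Gamma>" "w' \<circ> w = id"
proof -
  have "\<exists>w'\<in>weyl \<Gamma>. w' \<circ> w = id"
    using assms(2)
  proof (induction rule: weyl.induct)
    case weyl_id
    show ?case by (intro bexI[of _ id] weyl.weyl_id) simp
  next
    case (weyl_step w i)
    then obtain w' where w': "w' \<in> weyl \<Gamma>" "w' \<circ> w = id" by blast
    have "w' \<circ> reflection \<Gamma> i \<circ> (reflection \<Gamma> i \<circ> w) = id"
    proof
      fix v
      have "w' (w v) = v"
        using fun_cong[OF w'(2), of v] by (simp only: comp_apply id_apply)
      then show "(w' \<circ> reflection \<Gamma> i \<circ> (reflection \<Gamma> i \<circ> w)) v = id v"
        by (simp only: comp_apply id_apply reflection_involution[OF assms(1) weyl_step.hyps(2)])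
    qed
    then show ?case
      using weyl_comp[OF w'(1) weyl_reflection[OF weyl_step.hyps(2)]] by blast
  qed
  then show thesis using that by blast
qed

lemma weyl_isometry:
  assumes "simply_laced_finite \<Gamma>" "w \<in> weyl \<Gamma>"
  shows "form \<Gamma> (w u) (w v) = form \<Gamma> u v"
  using assms(2)
  by (induction rule: weyl.induct)
    (simp_all add: reflection_eq root_refl_isometry simple_root_norm assms(1))

lemma simple_root_support:
  assumes "simply_laced_finite \<Gamma>" "i \<in> vertices \<Gamma>" "k \<notin> coords \<Gamma>"
  shows "simple_root \<Gamma> i k = 0"
  using assms by (cases \<Gamma>) (auto simp: eps_def)

lemma simple_in_roots: "i \<in> vertices \<Gamma> \<Longrightarrow> simple_root \<Gamma> i \<in> roots \<Gamma>"
  unfolding roots_def by (intro CollectI exI[of _ id] exI[of _ i] conjI weyl_id) simp_all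

lemma weyl_roots:
  assumes "w \<in> weyl \<Gamma>" "\<alpha> \<in> roots \<Gamma>"
  shows "w \<alpha> \<in> roots \<Gamma>"
proof -
  obtain w' i where "\<alpha> = w' (simple_root \<Gamma> i)" "w' \<in> weyl \<Gamma>" "i \<in> vertices \<Gamma>"
    using assms(2) by (auto simp: roots_def)
  then show ?thesis
    using weyl_comp[OF assms(1)] unfolding roots_def by (auto intro!: exI[of _ "w \<circ> w'"])
qed

lemma reflection_roots:
  "i \<in> vertices \<Gamma> \<Longrightarrow> \<alpha> \<in> roots \<Gamma> \<Longrightarrow> reflection \<Gamma> i \<alpha> \<in> roots \<Gamma>"
  by (rule weyl_roots[OF weyl_reflection])

text \<open>Since the Weyl group is generated by simple reflections acting on the left, the roots are the
closure of the simple roots under simple reflections.\<close>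

lemma roots_induct [consumes 1, case_names simple reflect]:
  assumes "\<alpha> \<in> roots \<Gamma>"
    and "\<And>i. i \<in> vertices \<Gamma> \<Longrightarrow> P (simple_root \<Gamma> i)"
    and "\<And>i \<alpha>. i \<in> vertices \<Gamma> \<Longrightarrow> \<alpha> \<in> roots \<Gamma> \<Longrightarrow> P \<alpha> \<Longrightarrow> P (reflection \<Gamma> i \<alpha>)"
  shows "P \<alpha>"
proof -
  obtain w i where "\<alpha> = w (simple_root \<Gamma> i)" "w \<in> weyl \<Gamma>" and i: "i \<in> vertices \<Gamma>"
    using assms(1) by (auto simp: roots_def)
  from this(2) have "P (w (simple_root \<Gamma> i))"
  proof (induction rule: weyl.induct)
    case weyl_id
    show ?case using assms(2) i by simp
  next
    case (weyl_step w j)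
    then show ?case using assms(3) weyl_roots[OF _ simple_in_roots[OF i]] by simp
  qed
  then show ?thesis using \<open>\<alpha> = _\<close> by simp
qed

lemma root_norm:
  assumes "simply_laced_finite \<Gamma>" "\<alpha> \<in> roots \<Gamma>"
  shows "form \<Gamma> \<alpha> \<alpha> = 2"
  using assms(2)
  by (induction rule: roots_induct)
    (simp_all add: reflection_eq root_refl_isometry simple_root_norm assms(1))

lemma root_support:
  assumes "simply_laced_finite \<Gamma>" "\<alpha> \<in> roots \<Gamma>"
  shows "\<forall>k. k \<notin> coords \<Gamma> \<longrightarrow> \<alpha> k = 0"
  using assms(2)
  by (induction rule: roots_induct) (simp_all add: reflection_def simple_root_support assms(1))

lemma root_refl_in_weyl:
  assumes "simply_laced_finite \<Gamma>" "\<beta> \<in> roots \<Gamma>"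
  shows "root_refl \<Gamma> \<beta> \<in> weyl \<Gamma>"
  using assms(2)
proof (induction rule: roots_induct)
  case (simple i)
  then show ?case using weyl_reflection by (simp add: reflection_eq)
next
  case (reflect i \<beta>)
  have "root_refl \<Gamma> (reflection \<Gamma> i \<beta>) = reflection \<Gamma> i \<circ> root_refl \<Gamma> \<beta> \<circ> reflection \<Gamma> i"
    using reflect(1) assms(1) simple_root_norm
    by (intro ext) (simp only: comp_apply reflection_eq root_refl_conj)
  then show ?case
    using weyl_comp[OF weyl_comp[OF weyl_reflection[OF reflect(1)] reflect(3)]
        weyl_reflection[OF reflect(1)]] by (simp only:)
qed

lemma root_refl_roots:
  assumes "simply_laced_finite \<Gamma>" "\<beta> \<in> roots \<Gamma>" "\<alpha> \<in> roots \<Gamma>"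
  shows "root_refl \<Gamma> \<beta> \<alpha> \<in> roots \<Gamma>"
  by (rule weyl_roots[OF root_refl_in_weyl[OF assms(1,2)] assms(3)])

lemma root_minus:
  assumes "simply_laced_finite \<Gamma>" "\<alpha> \<in> roots \<Gamma>"
  shows "- \<alpha> \<in> roots \<Gamma>"
proof -
  have "root_refl \<Gamma> \<alpha> \<alpha> = - \<alpha>"
    by (simp add: root_refl_def root_norm[OF assms] fun_eq_iff)
  then show ?thesis using root_refl_roots[OF assms assms(2)] by simp
qed

text \<open>For roots with \<open>B(\<alpha>, \<beta>) = - 1\<close> the sum is \<open>s\<^sub>\<alpha> \<beta>\<close>.\<close>

lemma root_add:
  assumes "simply_laced_finite \<Gamma>" "\<alpha> \<in> roots \<Gamma>" "\<beta> \<in> roots \<Gamma>" "form \<Gamma> \<alpha> \<beta> = - 1"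
  shows "\<alpha> + \<beta> \<in> roots \<Gamma>"
  using root_refl_roots[OF assms(1,2,3)] assms(4)
  by (simp add: root_refl_def add.commute)

lemma root_diff:
  assumes "simply_laced_finite \<Gamma>" "\<alpha> \<in> roots \<Gamma>" "\<beta> \<in> roots \<Gamma>" "form \<Gamma> \<alpha> \<beta> = 1"
  shows "\<alpha> - \<beta> \<in> roots \<Gamma>"
  using root_add[OF assms(1,2) root_minus[OF assms(1,3)]] assms(4)
  by (simp add: form_minus)

lemma nonneg_comb_add:
  assumes "nonneg_comb_simple \<Gamma> u" "nonneg_comb_simple \<Gamma> v"
  shows "nonneg_comb_simple \<Gamma> (u + v)"
proof -
  obtain c d where "\<forall>i\<in>vertices \<Gamma>. c i \<ge> 0" "u = (\<lambda>k. \<Sum>i\<in>vertices \<Gamma>. c i * simple_root \<Gamma> i k)"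
    and "\<forall>i\<in>vertices \<Gamma>. d i \<ge> 0" "v = (\<lambda>k. \<Sum>i\<in>vertices \<Gamma>. d i * simple_root \<Gamma> i k)"
    using assms by (auto simp: nonneg_comb_simple_def)
  then show ?thesis
    unfolding nonneg_comb_simple_def
    by (intro exI[of _ "\<lambda>i. c i + d i"]) (auto simp: fun_eq_iff distrib_right sum.distrib)
qed

lemma finite_vertices: "finite (vertices \<Gamma>)"
  by (cases \<Gamma>) auto

lemma nonneg_comb_zero: "nonneg_comb_simple \<Gamma> 0"
  unfolding nonneg_comb_simple_def by (intro exI[of _ "\<lambda>_. 0"]) (auto simp: fun_eq_iff)

lemma nonneg_comb_simple_root:
  assumes "i \<in> vertices \<Gamma>"
  shows "nonneg_comb_simple \<Gamma> (simple_root \<Gamma> i)"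
  unfolding nonneg_comb_simple_def
proof (intro exI[of _ "\<lambda>j. if j = i then 1 else 0"] conjI ballI ext)
  fix k
  have "(\<Sum>j\<in>vertices \<Gamma>. (if j = i then 1 else 0) * simple_root \<Gamma> j k) =
        (\<Sum>j\<in>vertices \<Gamma>. if j = i then simple_root \<Gamma> j k else 0)"
    by (intro sum.cong) auto
  then show "simple_root \<Gamma> i k =
      (\<Sum>j\<in>vertices \<Gamma>. (if j = i then 1 else 0) * simple_root \<Gamma> j k)"
    using assms finite_vertices[of \<Gamma>] by simp
qed auto


section \<open>Tensors, the cone of the canonical basis and the order\<close>

lemma vee_commute: "u \<or>\<^sub>2 v = v \<or>\<^sub>2 u"
  by (simp add: vee_def fun_eq_iff)

lemma vee_linear:
  "(u + v) \<or>\<^sub>2 w = u \<or>\<^sub>2 w + v \<or>\<^sub>2 w" "(u - v) \<or>\<^sub>2 w = u \<or>\<^sub>2 w - v \<or>\<^sub>2 w"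
  "(- u) \<or>\<^sub>2 w = - (u \<or>\<^sub>2 w)"
  "w \<or>\<^sub>2 (u + v) = w \<or>\<^sub>2 u + w \<or>\<^sub>2 v" "w \<or>\<^sub>2 (u - v) = w \<or>\<^sub>2 u - w \<or>\<^sub>2 v"
  "w \<or>\<^sub>2 (- u) = - (w \<or>\<^sub>2 u)"
  by (simp_all add: vee_def fun_eq_iff algebra_simps)

text \<open>Sums of elements of the canonical basis.  Natural number coefficients are used because they give
the order and the membership in the lattice spanned by the basis at the same time.\<close>

inductive_set ncone :: "dynkin \<Rightarrow> tensor set" for \<Gamma> where
  ncone_zero: "0 \<in> ncone \<Gamma>"
| ncone_step: "t \<in> ncone \<Gamma> \<Longrightarrow> b \<in> canonical_basis \<Gamma> \<Longrightarrow> t + b \<in> ncone \<Gamma>"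

lemma ncone_basis: "b \<in> canonical_basis \<Gamma> \<Longrightarrow> b \<in> ncone \<Gamma>"
  using ncone_step[OF ncone_zero] by simp

lemma ncone_add:
  assumes "s \<in> ncone \<Gamma>" "t \<in> ncone \<Gamma>"
  shows "s + t \<in> ncone \<Gamma>"
  using assms(2)
proof (induction rule: ncone.induct)
  case ncone_zero
  show ?case using assms(1) by (simp only: add_0_right)
next
  case (ncone_step t b)
  then show ?case using ncone.ncone_step by (simp only: add.assoc[symmetric])
qed

text \<open>The induction carries a coefficient function that vanishes outside the finite set, so that the set
can be enlarged without changing the sum.\<close>

lemma ncone_coefficients:
  assumes "t \<in> ncone \<Gamma>"
  obtains F and c :: "tensor \<Rightarrow> int" where "finite F" "F \<subseteq> canonical_basis \<Gamma>" "\<forall>b\<in>F. c b \<ge> 0"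
    "t = (\<lambda>k l. \<Sum>b\<in>F. of_int (c b) * b k l)"
proof -
  have "\<exists>F (c :: tensor \<Rightarrow> int). finite F \<and> F \<subseteq> canonical_basis \<Gamma> \<and> (\<forall>b. c b \<ge> 0) \<and>
    (\<forall>b. b \<notin> F \<longrightarrow> c b = 0) \<and> t = (\<lambda>k l. \<Sum>b\<in>F. of_int (c b) * b k l)"
    using assms
  proof (induction rule: ncone.induct)
    case ncone_zero
    show ?case by (intro exI[of _ "{}"] exI[of _ "\<lambda>_. 0"]) (auto simp: fun_eq_iff)
  next
    case (ncone_step t b)
    then obtain F and c :: "tensor \<Rightarrow> int" where F: "finite F" "F \<subseteq> canonical_basis \<Gamma>"
      and c: "\<forall>b. c b \<ge> 0" "\<forall>b. b \<notin> F \<longrightarrow> c b = 0"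
      and t: "t = (\<lambda>k l. \<Sum>b\<in>F. of_int (c b) * b k l)"
      by blast
    have t': "t = (\<lambda>k l. \<Sum>b\<in>insert b F. of_int (c b) * b k l)"
      unfolding t using c(2) F(1) by (cases "b \<in> F") (auto simp: insert_absorb)
    have "(\<Sum>b'\<in>insert b F. real_of_int ((c(b := c b + 1)) b') * b' k l) =
        (\<Sum>b'\<in>insert b F. of_int (c b') * b' k l) + b k l" for k l
    proof -
      have "(\<Sum>b'\<in>insert b F. real_of_int ((c(b := c b + 1)) b') * b' k l) =
        (\<Sum>b'\<in>insert b F. of_int (c b') * b' k l + (if b' = b then b k l else 0))"
        by (intro sum.cong) (auto simp: distrib_right)
      then show ?thesis using F(1) by (simp add: sum.distrib)
    qed
    then have "t + b = (\<lambda>k l. \<Sum>b'\<in>insert b F. of_int ((c(b := c b + 1)) b') * b' k l)"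
      unfolding t' by (intro ext) (simp only: plus_fun_apply)
    moreover have "0 \<le> (c(b := c b + 1)) b'" for b'
      using c(1) by (simp add: add_nonneg_nonneg)
    moreover have "(c(b := c b + 1)) b' = 0" if "b' \<notin> insert b F" for b'
      using c(2) that by simp
    moreover have "finite (insert b F)" "insert b F \<subseteq> canonical_basis \<Gamma>"
      using F ncone_step.hyps(2) by simp_all
    ultimately show ?case
      by (intro exI[of _ "insert b F"] exI[of _ "c(b := c b + 1)"] conjI allI impI)
  qed
  then show thesis by (elim exE conjE) (rule that; simp)
qed

lemma ncone_int_span: "t \<in> ncone \<Gamma> \<Longrightarrow> t \<in> int_span (canonical_basis \<Gamma>)"
  unfolding int_span_def by (elim ncone_coefficients) (intro CollectI exI conjI)

lemma int_span_minus:
  assumes "t \<in> int_span S"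
  shows "- t \<in> int_span S"
proof -
  obtain F and c :: "tensor \<Rightarrow> int" where "finite F" "F \<subseteq> S"
    "t = (\<lambda>k l. \<Sum>b\<in>F. of_int (c b) * b k l)"
    using assms by (auto simp: int_span_def)
  moreover from this(3) have "- t = (\<lambda>k l. \<Sum>b\<in>F. of_int (- c b) * b k l)"
    by (simp add: fun_eq_iff sum_negf)
  ultimately show ?thesis
    unfolding int_span_def by (intro CollectI exI conjI)
qed

lemma le2I:
  assumes "p \<in> int_span (canonical_basis \<Gamma>)" "q \<in> int_span (canonical_basis \<Gamma>)"
    and "q - p \<in> ncone \<Gamma>"
  shows "le2 \<Gamma> p q"
proof -
  obtain F and c :: "tensor \<Rightarrow> int" where F: "finite F" "F \<subseteq> canonical_basis \<Gamma>"
    and c: "\<forall>b\<in>F. c b \<ge> 0" and d: "q - p = (\<lambda>k l. \<Sum>b\<in>F. of_int (c b) * b k l)"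
    using assms(3) by (rule ncone_coefficients)
  have "\<forall>b\<in>F. real_of_int (c b) \<ge> 0" using c by simp
  with F d show ?thesis
    unfolding le2_def using assms(1,2)
    by (intro conjI exI[of _ F] exI[of _ "\<lambda>b. of_int (c b)"])
qed


section \<open>Heights and coordinates\<close>

text \<open>The height is linear, so it is given by its values on the coordinate vectors.  In type A it is
only determined up to a multiple of the coordinate sum, which vanishes on the roots.\<close>

fun height_weight :: "dynkin \<Rightarrow> nat \<Rightarrow> real" where
  "height_weight (DynkinA n) k = - real k"
| "height_weight (DynkinD n) k = real n - real k"
| "height_weight (DynkinE n) k = 1"

definition height :: "dynkin \<Rightarrow> vec \<Rightarrow> real" where
  "height \<Gamma> v = (\<Sum>k\<in>coords \<Gamma>. height_weight \<Gamma> k * v k)"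

lemma height_add: "height \<Gamma> (u + v) = height \<Gamma> u + height \<Gamma> v"
  by (simp add: height_def distrib_left sum.distrib)

lemma height_smul: "height \<Gamma> (smul c v) = c * height \<Gamma> v"
  by (simp add: height_def sum_distrib_left mult_ac)

lemma height_diff: "height \<Gamma> (u - v) = height \<Gamma> u - height \<Gamma> v"
  by (simp add: height_def right_diff_distrib sum_subtractf)

lemma height_eps: "k \<in> coords \<Gamma> \<Longrightarrow> height \<Gamma> (eps k) = height_weight \<Gamma> k"
  unfolding height_def by (simp add: sum_eps_mult finite_coords)

lemma height_simple:
  assumes "simply_laced_finite \<Gamma>" "i \<in> vertices \<Gamma>"
  shows "height \<Gamma> (simple_root \<Gamma> i) = 1"
  using assms by (cases \<Gamma>) (auto simp: height_diff height_add height_eps)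

lemma height_minus: "height \<Gamma> (- v) = - height \<Gamma> v"
  using height_smul[of \<Gamma> "- 1" v] by simp

lemma height_zero: "height \<Gamma> 0 = 0"
  using height_smul[of \<Gamma> 0 0] by simp

lemma height_sum: "height \<Gamma> (\<lambda>k. \<Sum>i\<in>S. c i * f i k) = (\<Sum>i\<in>S. c i * height \<Gamma> (f i))"
  unfolding height_def sum_distrib_left by (subst sum.swap) (simp only: mult_ac)

lemma nonneg_comb_height:
  assumes "simply_laced_finite \<Gamma>" "nonneg_comb_simple \<Gamma> v"
  shows "height \<Gamma> v \<ge> 0" and "height \<Gamma> v = 0 \<Longrightarrow> v = 0"
proof -
  obtain c where c: "\<forall>i\<in>vertices \<Gamma>. c i \<ge> 0"
    and v: "v = (\<lambda>k. \<Sum>i\<in>vertices \<Gamma>. c i * simple_root \<Gamma> i k)"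
    using assms(2) by (auto simp: nonneg_comb_simple_def)
  have hv: "height \<Gamma> v = (\<Sum>i\<in>vertices \<Gamma>. c i)"
    unfolding v height_sum by (intro sum.cong) (simp_all add: height_simple assms(1))
  show "height \<Gamma> v \<ge> 0" unfolding hv using c by (simp add: sum_nonneg)
  assume "height \<Gamma> v = 0"
  then have "\<forall>i\<in>vertices \<Gamma>. c i = 0"
    unfolding hv using c finite_vertices sum_nonneg_eq_0_iff[of "vertices \<Gamma>" c] by blast
  then show "v = 0" by (simp add: v fun_eq_iff)
qed


section \<open>Descending and climbing along simple reflections\<close>

text \<open>If \<open>\<alpha>\<close> is the sum of the \<open>c\<^sub>i \<alpha>\<^sub>i\<close>, then \<open>2 = B(\<alpha>, \<alpha>)\<close> is the sum of the \<open>c\<^sub>i B(\<alpha>, \<alpha>\<^sub>i)\<close>.\<close>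

lemma root_pos_cartan:
  assumes "simply_laced_finite \<Gamma>" "\<alpha> \<in> roots \<Gamma>" "nonneg_comb_simple \<Gamma> \<alpha>"
  obtains i where "i \<in> vertices \<Gamma>" "form \<Gamma> (simple_root \<Gamma> i) \<alpha> > 0"
proof -
  obtain c where c: "\<forall>i\<in>vertices \<Gamma>. c i \<ge> 0"
    and \<alpha>: "\<alpha> = (\<lambda>k. \<Sum>i\<in>vertices \<Gamma>. c i * simple_root \<Gamma> i k)"
    using assms(3) by (auto simp: nonneg_comb_simple_def)
  have "2 = (\<Sum>i\<in>vertices \<Gamma>. c i * form \<Gamma> \<alpha> (simple_root \<Gamma> i))"
    using form_linear[of \<Gamma> \<alpha> c "simple_root \<Gamma>" "vertices \<Gamma>"] root_norm[OF assms(1,2)]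
    by (simp only: \<alpha>[symmetric])
  then have "\<exists>i\<in>vertices \<Gamma>. form \<Gamma> \<alpha> (simple_root \<Gamma> i) > 0"
    using c sum_nonpos[of "vertices \<Gamma>" "\<lambda>i. c i * form \<Gamma> \<alpha> (simple_root \<Gamma> i)"]
    by (smt (verit) mult_nonneg_nonpos)
  then show thesis using that by (auto simp: form_commute)
qed

text \<open>The facts about a root system on which both walks rest.  Those on heights, signs and Cartan
integers of roots are standard; the last one is the only place where the canonical basis enters.\<close>

locale two_root_system =
  fixes \<Gamma> :: dynkin
  assumes finite_type: "simply_laced_finite \<Gamma>"
    and h_bounded: "\<exists>M. \<forall>\<alpha>\<in>roots \<Gamma>. height \<Gamma> \<alpha> \<le> M"
    and root_pos_or_neg:
      "\<alpha> \<in> roots \<Gamma> \<Longrightarrow> nonneg_comb_simple \<Gamma> \<alpha> \<or> nonneg_comb_simple \<Gamma> (- \<alpha>)"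
    and root_cartan: "\<alpha> \<in> roots \<Gamma> \<Longrightarrow> i \<in> vertices \<Gamma> \<Longrightarrow>
      form \<Gamma> (simple_root \<Gamma> i) \<alpha> \<in> {- 1, 0, 1} \<or> \<alpha> = simple_root \<Gamma> i \<or> \<alpha> = - simple_root \<Gamma> i"
    and simple_vee_in_ncone: "\<alpha> \<in> roots \<Gamma> \<Longrightarrow> height \<Gamma> \<alpha> > 0 \<Longrightarrow> i \<in> vertices \<Gamma> \<Longrightarrow>
      form \<Gamma> (simple_root \<Gamma> i) \<alpha> = 0 \<Longrightarrow> simple_root \<Gamma> i \<or>\<^sub>2 \<alpha> \<in> ncone \<Gamma>"
begin

abbreviation (input) B where "B \<equiv> form \<Gamma>"
abbreviation (input) h where "h \<equiv> height \<Gamma>"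
abbreviation (input) sr where "sr \<equiv> simple_root \<Gamma>"

lemmas h_simple = height_simple[OF finite_type]
lemmas nonneg_comb_h = nonneg_comb_height[OF finite_type]

lemma h_reflection: "i \<in> vertices \<Gamma> \<Longrightarrow> h (reflection \<Gamma> i v) = h v - B (sr i) v"
  by (simp only: reflection_eq root_refl_def height_diff height_smul h_simple mult_1_right)

lemma root_nonzero: "\<alpha> \<in> roots \<Gamma> \<Longrightarrow> \<alpha> \<noteq> 0"
  using root_norm[OF finite_type, of \<alpha>] form_smul[of \<Gamma> \<alpha> 0 0] by auto

lemma root_pos_iff: "\<alpha> \<in> roots \<Gamma> \<Longrightarrow> nonneg_comb_simple \<Gamma> \<alpha> \<longleftrightarrow> h \<alpha> > 0"
  using root_pos_or_neg[of \<alpha>] nonneg_comb_h[of \<alpha>] nonneg_comb_h[of "- \<alpha>"] root_nonzero[of \<alpha>]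
  by (smt (verit) height_minus neg_equal_0_iff_equal)

lemma pos_roots_iff: "\<alpha> \<in> pos_roots \<Gamma> \<longleftrightarrow> \<alpha> \<in> roots \<Gamma> \<and> h \<alpha> > 0"
  using root_pos_iff by (auto simp: pos_roots_def)

lemma root_h_nonzero: "\<alpha> \<in> roots \<Gamma> \<Longrightarrow> h \<alpha> \<noteq> 0"
  using root_pos_or_neg[of \<alpha>] nonneg_comb_h[of \<alpha>] nonneg_comb_h[of "- \<alpha>"] root_nonzero[of \<alpha>]
  by (smt (verit) height_minus neg_equal_0_iff_equal)

lemma highest_rootI:
  assumes "\<theta> \<in> roots \<Gamma>" "\<And>\<beta>. \<beta> \<in> roots \<Gamma> \<Longrightarrow> nonneg_comb_simple \<Gamma> (\<theta> - \<beta>)"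
  shows "highest_root \<Gamma> = \<theta>"
  unfolding highest_root_def
proof (rule the_equality)
  fix \<theta>' assume \<theta>': "\<theta>' \<in> roots \<Gamma> \<and> (\<forall>\<beta>\<in>roots \<Gamma>. nonneg_comb_simple \<Gamma> (\<theta>' - \<beta>))"
  then have "h (\<theta>' - \<theta>) \<ge> 0" "h (\<theta> - \<theta>') \<ge> 0" and *: "nonneg_comb_simple \<Gamma> (\<theta>' - \<theta>)"
    using nonneg_comb_h(1) assms by blast+
  then have "h (\<theta>' - \<theta>) = 0" by (simp only: height_diff)
  then show "\<theta>' = \<theta>" using nonneg_comb_h(2)[OF *] by (simp only: right_minus_eq)
qed (use assms in blast)

lemma root_cartan_Ints: "\<alpha> \<in> roots \<Gamma> \<Longrightarrow> i \<in> vertices \<Gamma> \<Longrightarrow> B (sr i) \<alpha> \<in> \<int>"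
  using root_cartan[of \<alpha> i] simple_root_norm[OF finite_type, of i]
  by (auto simp: form_minus)

lemma root_h_Ints: "\<alpha> \<in> roots \<Gamma> \<Longrightarrow> h \<alpha> \<in> \<int>"
  by (induction rule: roots_induct) (auto simp: h_simple h_reflection root_cartan_Ints)

lemma root_h_ge1:
  assumes "\<alpha> \<in> roots \<Gamma>" "h \<alpha> > 0"
  shows "h \<alpha> \<ge> 1"
  using root_h_Ints[OF assms(1)] assms(2) by (auto elim!: Ints_cases)

lemma pos_cartan:
  assumes "\<alpha> \<in> roots \<Gamma>" "h \<alpha> > 0" "i \<in> vertices \<Gamma>" "\<alpha> \<noteq> sr i"
  shows "B (sr i) \<alpha> \<in> {- 1, 0, 1}"
proof -
  have "\<alpha> \<noteq> - sr i"
    using assms(2) h_simple[OF assms(3)] by (auto simp only: height_minus)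
  then show ?thesis using root_cartan[OF assms(1,3)] assms(4) by blast
qed

text \<open>A simple reflection keeps every positive root positive except its own simple root: the height drops
by at most 1 and cannot become 0.\<close>

lemma pos_reflection:
  assumes "\<alpha> \<in> roots \<Gamma>" "h \<alpha> > 0" "i \<in> vertices \<Gamma>" "\<alpha> \<noteq> sr i"
  shows "h (reflection \<Gamma> i \<alpha>) > 0"
proof -
  have "h (reflection \<Gamma> i \<alpha>) \<ge> 0"
    using pos_cartan[OF assms] root_h_ge1[OF assms(1,2)] by (auto simp: h_reflection[OF assms(3)])
  then show ?thesis
    using root_h_nonzero[OF reflection_roots[OF assms(3,1)]] by simp
qed

text \<open>The vector \<open>\<gamma>\<close> with \<open>s\<^sub>i(\<alpha> \<or>\<^sub>2 \<beta>) = \<alpha> \<or>\<^sub>2 \<beta> + \<alpha>\<^sub>i \<or>\<^sub>2 \<gamma>\<close>, found by expanding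
\<open>(\<alpha> - c \<alpha>\<^sub>i) \<or>\<^sub>2 (\<beta> - d \<alpha>\<^sub>i)\<close>.\<close>

definition move :: "nat \<Rightarrow> vec \<Rightarrow> vec \<Rightarrow> vec" where
  "move i \<alpha> \<beta> = smul (B (sr i) \<alpha> * B (sr i) \<beta>) (sr i) - smul (B (sr i) \<alpha>) \<beta> - smul (B (sr i) \<beta>) \<alpha>"

lemma reflection_vee:
  "reflection \<Gamma> i \<alpha> \<or>\<^sub>2 reflection \<Gamma> i \<beta> = \<alpha> \<or>\<^sub>2 \<beta> + sr i \<or>\<^sub>2 move i \<alpha> \<beta>"
  by (simp add: fun_eq_iff vee_def reflection_def move_def algebra_simps)

lemma h_move:
  assumes "i \<in> vertices \<Gamma>"
  shows "h (move i \<alpha> \<beta>) = h (reflection \<Gamma> i \<alpha>) * h (reflection \<Gamma> i \<beta>) - h \<alpha> * h \<beta>"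
  unfolding move_def height_diff height_smul h_simple[OF assms] h_reflection[OF assms]
  by (simp add: algebra_simps)

lemma move_orthogonal: "i \<in> vertices \<Gamma> \<Longrightarrow> B (sr i) (move i \<alpha> \<beta>) = 0"
  unfolding move_def form_diff form_smul by (simp add: simple_root_norm[OF finite_type])

text \<open>Let \<open>c\<close> and \<open>d\<close> be the pairings of \<open>\<alpha>\<^sub>i\<close> with \<open>\<alpha>\<close> and \<open>\<beta>\<close>.  If one of the two roots is \<open>\<plusminus> \<alpha>\<^sub>i\<close>, the
other one is orthogonal to \<open>\<alpha>\<^sub>i\<close> and the move is \<open>\<plusminus>\<close> twice the other one.  Otherwise \<open>c\<close> and \<open>d\<close> are at most 1
in absolute value.  If one of them is 0, the move is 0 or \<open>\<plusminus>\<close> one of the two roots.  If both are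
nonzero, then \<open>B(\<beta>, s\<^sub>i \<alpha>) = - c d = \<plusminus> 1\<close>, and the move is \<open>\<plusminus>\<close> the sum or difference of \<open>\<beta>\<close> and
\<open>s\<^sub>i \<alpha>\<close> that is a root for this reason.\<close>

lemma move_cases:
  assumes \<alpha>: "\<alpha> \<in> roots \<Gamma>" and \<beta>: "\<beta> \<in> roots \<Gamma>" and o: "B \<alpha> \<beta> = 0" and i: "i \<in> vertices \<Gamma>"
  obtains "move i \<alpha> \<beta> = 0" | "move i \<alpha> \<beta> \<in> roots \<Gamma>"
    | \<rho> where "\<rho> \<in> roots \<Gamma>" "move i \<alpha> \<beta> = \<rho> + \<rho>"
proof -
  let ?a = "sr i"
  note neg = root_minus[OF finite_type] and add = root_add[OF finite_type]
    and refl = reflection_roots[OF i]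
  have aa: "B ?a ?a = 2" using i by (rule simple_root_norm[OF finite_type])
  have a: "?a \<in> roots \<Gamma>" using i by (rule simple_in_roots)
  have o': "B \<beta> \<alpha> = 0" using o by (simp add: form_commute)
  have "move i \<alpha> \<beta> = 0 \<or> move i \<alpha> \<beta> \<in> roots \<Gamma> \<or> (\<exists>\<rho>\<in>roots \<Gamma>. move i \<alpha> \<beta> = \<rho> + \<rho>)"
  proof (cases "\<alpha> = ?a \<or> \<alpha> = - ?a \<or> \<beta> = ?a \<or> \<beta> = - ?a")
    case True
    consider "\<alpha> = ?a" "B ?a \<beta> = 0" | "\<alpha> = - ?a" "B ?a \<beta> = 0"
      | "\<beta> = ?a" "B ?a \<alpha> = 0" | "\<beta> = - ?a" "B ?a \<alpha> = 0"
      using True o o' by (auto simp: form_left)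
    then have "\<exists>\<rho>\<in>{\<alpha>, \<beta>, - \<alpha>, - \<beta>}. move i \<alpha> \<beta> = \<rho> + \<rho>"
    proof cases
      case 1
      have "move i \<alpha> \<beta> = (- \<beta>) + (- \<beta>)"
        by (simp add: move_def 1 aa fun_eq_iff)
      then show ?thesis by blast
    next
      case 2
      have "move i \<alpha> \<beta> = \<beta> + \<beta>"
        by (simp add: move_def 2 form_minus aa fun_eq_iff)
      then show ?thesis by blast
    next
      case 3
      have "move i \<alpha> \<beta> = (- \<alpha>) + (- \<alpha>)"
        by (simp add: move_def 3 aa fun_eq_iff)
      then show ?thesis by blast
    next
      case 4
      have "move i \<alpha> \<beta> = \<alpha> + \<alpha>"
        by (simp add: move_def 4 form_minus aa fun_eq_iff)
      then show ?thesis by blast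
    qed
    moreover have "\<rho> \<in> roots \<Gamma>" if "\<rho> \<in> {\<alpha>, \<beta>, - \<alpha>, - \<beta>}" for \<rho>
      using that \<alpha> \<beta> neg[OF \<alpha>] neg[OF \<beta>] by (elim insertE emptyE) (simp_all only:)
    ultimately show ?thesis by blast
  next
    case False
    then have c: "B ?a \<alpha> \<in> {- 1, 0, 1}" "B ?a \<beta> \<in> {- 1, 0, 1}"
      using root_cartan[OF \<alpha> i] root_cartan[OF \<beta> i] by blast+
    have r1: "\<beta> + reflection \<Gamma> i \<alpha> \<in> roots \<Gamma>" if "B ?a \<alpha> = B ?a \<beta>" "B ?a \<alpha> \<noteq> 0"
      using c that o o'
      by (intro add[OF \<beta> refl[OF \<alpha>]])
        (auto simp: reflection_eq root_refl_def form_add form_diff form_smul form_commute[of _ \<beta> ?a])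
    have r2: "\<beta> - reflection \<Gamma> i \<alpha> \<in> roots \<Gamma>" if "B ?a \<alpha> = - B ?a \<beta>" "B ?a \<alpha> \<noteq> 0"
      using c that o o'
      by (intro root_diff[OF finite_type \<beta> refl[OF \<alpha>]])
        (auto simp: reflection_eq root_refl_def form_add form_diff form_smul form_commute[of _ \<beta> ?a])
    consider "B ?a \<alpha> = 0" "B ?a \<beta> = 0"
      | "B ?a \<alpha> = 0" "B ?a \<beta> = 1" | "B ?a \<alpha> = 0" "B ?a \<beta> = - 1"
      | "B ?a \<alpha> = 1" "B ?a \<beta> = 0" | "B ?a \<alpha> = - 1" "B ?a \<beta> = 0"
      | "B ?a \<alpha> = 1" "B ?a \<beta> = 1" | "B ?a \<alpha> = - 1" "B ?a \<beta> = - 1"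
      | "B ?a \<alpha> = 1" "B ?a \<beta> = - 1" | "B ?a \<alpha> = - 1" "B ?a \<beta> = 1"
      using c by auto
    then have "move i \<alpha> \<beta> = 0 \<or> move i \<alpha> \<beta> \<in> {\<alpha>, \<beta>, - \<alpha>, - \<beta>} \<or>
      (B ?a \<alpha> = B ?a \<beta> \<and> B ?a \<alpha> \<noteq> 0 \<and>
        move i \<alpha> \<beta> \<in> {\<beta> + reflection \<Gamma> i \<alpha>, - (\<beta> + reflection \<Gamma> i \<alpha>)}) \<or>
      (B ?a \<alpha> = - B ?a \<beta> \<and> B ?a \<alpha> \<noteq> 0 \<and>
        move i \<alpha> \<beta> \<in> {\<beta> - reflection \<Gamma> i \<alpha>, - (\<beta> - reflection \<Gamma> i \<alpha>)})"
      by cases (auto simp: move_def reflection_def fun_eq_iff)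
    moreover have "\<rho> \<in> roots \<Gamma>" if "\<rho> \<in> {\<alpha>, \<beta>, - \<alpha>, - \<beta>}" for \<rho>
      using that \<alpha> \<beta> neg[OF \<alpha>] neg[OF \<beta>] by (elim insertE emptyE) (simp_all only:)
    moreover have "\<rho> \<in> roots \<Gamma>" if "B ?a \<alpha> = B ?a \<beta>" "B ?a \<alpha> \<noteq> 0"
      "\<rho> \<in> {\<beta> + reflection \<Gamma> i \<alpha>, - (\<beta> + reflection \<Gamma> i \<alpha>)}" for \<rho>
      using that(3) r1[OF that(1,2)] neg[OF r1[OF that(1,2)]]
      by (elim insertE emptyE) (simp_all only:)
    moreover have "\<rho> \<in> roots \<Gamma>" if "B ?a \<alpha> = - B ?a \<beta>" "B ?a \<alpha> \<noteq> 0"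
      "\<rho> \<in> {\<beta> - reflection \<Gamma> i \<alpha>, - (\<beta> - reflection \<Gamma> i \<alpha>)}" for \<rho>
      using that(3) r2[OF that(1,2)] neg[OF r2[OF that(1,2)]]
      by (elim insertE emptyE) (simp_all only:)
    ultimately show ?thesis by blast
  qed
  then show thesis using that by blast
qed

lemma move_up_in_ncone:
  assumes "\<alpha> \<in> roots \<Gamma>" "\<beta> \<in> roots \<Gamma>" "B \<alpha> \<beta> = 0" and i: "i \<in> vertices \<Gamma>"
    and up: "h (move i \<alpha> \<beta>) > 0"
  shows "sr i \<or>\<^sub>2 move i \<alpha> \<beta> \<in> ncone \<Gamma>"
  using assms(1-4)
proof (cases rule: move_cases)
  case 1
  then show ?thesis using up by (simp only: height_zero)
next
  case 2
  then show ?thesis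
    using up root_pos_iff i simple_vee_in_ncone move_orthogonal[OF i] by blast
next
  case (3 \<rho>)
  then have "h \<rho> > 0" "B (sr i) \<rho> = 0"
    using up move_orthogonal[OF i, of \<alpha> \<beta>] by (simp_all only: height_add form_add)
  then have "sr i \<or>\<^sub>2 \<rho> \<in> ncone \<Gamma>"
    using 3(1) root_pos_iff i simple_vee_in_ncone by blast
  then show ?thesis using ncone_add by (simp only: 3(2) vee_linear)
qed

lemma move_reflection:
  assumes "i \<in> vertices \<Gamma>"
  shows "move i (reflection \<Gamma> i \<alpha>) (reflection \<Gamma> i \<beta>) = - move i \<alpha> \<beta>"
proof -
  have "B (sr i) (reflection \<Gamma> i v) = - B (sr i) v" for v
    by (simp add: reflection_eq root_refl_def form_diff form_smul
        simple_root_norm[OF finite_type assms])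
  then show ?thesis
    by (simp add: move_def fun_eq_iff reflection_def algebra_simps)
qed

lemma move_down_in_ncone:
  assumes "\<alpha> \<in> roots \<Gamma>" "\<beta> \<in> roots \<Gamma>" "B \<alpha> \<beta> = 0" "i \<in> vertices \<Gamma>" "h (move i \<alpha> \<beta>) < 0"
  shows "\<alpha> \<or>\<^sub>2 \<beta> - reflection \<Gamma> i \<alpha> \<or>\<^sub>2 reflection \<Gamma> i \<beta> \<in> ncone \<Gamma>"
proof -
  let ?a = "reflection \<Gamma> i \<alpha>" and ?b = "reflection \<Gamma> i \<beta>"
  have "sr i \<or>\<^sub>2 move i ?a ?b \<in> ncone \<Gamma>"
  proof (rule move_up_in_ncone)
    show "B ?a ?b = 0"
      using assms(3) weyl_isometry[OF finite_type weyl_reflection[OF assms(4)]] by simp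
    show "h (move i ?a ?b) > 0"
      using assms(5) by (simp only: move_reflection[OF assms(4)] height_minus)
  qed (use assms reflection_roots in auto)
  moreover have "\<alpha> \<or>\<^sub>2 \<beta> = ?a \<or>\<^sub>2 ?b + sr i \<or>\<^sub>2 move i ?a ?b"
    using reflection_vee[of i ?a ?b] by (simp only: reflection_involution[OF finite_type assms(4)])
  ultimately show ?thesis by (simp only: add_diff_cancel_left')
qed

text \<open>Some \<open>i\<close> has \<open>B(\<alpha>\<^sub>i, \<alpha>) = 1\<close>.  The reflection \<open>s\<^sub>i\<close> lowers the product of the heights unless
\<open>B(\<alpha>\<^sub>i, \<beta>) = - 1\<close> and \<open>h \<alpha> \<ge> h \<beta> + 1\<close>.  In the same way some \<open>j\<close> with \<open>B(\<alpha>\<^sub>j, \<beta>) = 1\<close> works unless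
\<open>h \<beta> \<ge> h \<alpha> + 1\<close>, and the two exceptions exclude each other.\<close>

lemma descent_exists:
  assumes \<alpha>: "\<alpha> \<in> roots \<Gamma>" "h \<alpha> > 0" and \<beta>: "\<beta> \<in> roots \<Gamma>" "h \<beta> > 0"
    and simple: "\<alpha> \<notin> sr ` vertices \<Gamma>" "\<beta> \<notin> sr ` vertices \<Gamma>"
  obtains i where "i \<in> vertices \<Gamma>" "h (move i \<alpha> \<beta>) < 0"
proof -
  have move: "h (move i \<alpha> \<beta>) = B (sr i) \<alpha> * B (sr i) \<beta> - B (sr i) \<alpha> * h \<beta> - B (sr i) \<beta> * h \<alpha>"
    if "i \<in> vertices \<Gamma>" for i
    using that by (simp only: move_def height_diff height_smul h_simple mult_1_right)
  have c: "B (sr i) \<alpha> \<in> {- 1, 0, 1}" "B (sr i) \<beta> \<in> {- 1, 0, 1}" if "i \<in> vertices \<Gamma>" for i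
  proof -
    have "\<alpha> \<noteq> sr i" "\<beta> \<noteq> sr i" using that simple by blast+
    then show "B (sr i) \<alpha> \<in> {- 1, 0, 1}" "B (sr i) \<beta> \<in> {- 1, 0, 1}"
      using pos_cartan \<alpha> \<beta> that by blast+
  qed
  obtain i where i: "i \<in> vertices \<Gamma>" "B (sr i) \<alpha> > 0"
    using root_pos_cartan[OF finite_type \<alpha>(1)] root_pos_iff \<alpha> by blast
  obtain j where j: "j \<in> vertices \<Gamma>" "B (sr j) \<beta> > 0"
    using root_pos_cartan[OF finite_type \<beta>(1)] root_pos_iff \<beta> by blast
  have "h \<alpha> \<ge> 1" "h \<beta> \<ge> 1" using root_h_ge1 \<alpha> \<beta> by auto
  then have "h (move i \<alpha> \<beta>) < 0 \<or> h \<alpha> \<ge> h \<beta> + 1" "h (move j \<alpha> \<beta>) < 0 \<or> h \<beta> \<ge> h \<alpha> + 1"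
    using c[OF i(1)] c[OF j(1)] i j by (auto simp: move)
  then show thesis using that i j by fastforce
qed

text \<open>Walk down until one of the two roots is simple; neither root leaves the positive roots before that,
and every step adds an element of the cone.\<close>

lemma pos_two_root_in_ncone:
  assumes "\<alpha> \<in> roots \<Gamma>" "h \<alpha> > 0" "\<beta> \<in> roots \<Gamma>" "h \<beta> > 0" "B \<alpha> \<beta> = 0"
  shows "\<alpha> \<or>\<^sub>2 \<beta> \<in> ncone \<Gamma>"
  using assms
proof (induction "nat \<lfloor>h \<alpha> * h \<beta>\<rfloor>" arbitrary: \<alpha> \<beta> rule: less_induct)
  case less
  show ?case
  proof (cases "\<alpha> \<in> sr ` vertices \<Gamma> \<or> \<beta> \<in> sr ` vertices \<Gamma>")
    case True
    then show ?thesis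
    proof
      assume "\<alpha> \<in> sr ` vertices \<Gamma>"
      then obtain i where "i \<in> vertices \<Gamma>" "\<alpha> = sr i" by blast
      then show ?thesis
        using simple_vee_in_ncone[OF less(4), of i] less root_pos_iff by blast
    next
      assume "\<beta> \<in> sr ` vertices \<Gamma>"
      then obtain i where "i \<in> vertices \<Gamma>" "\<beta> = sr i" by blast
      then show ?thesis
        using simple_vee_in_ncone[OF less(2), of i] less root_pos_iff vee_commute
        by (simp only: form_commute[of _ \<alpha>])
    qed
  next
    case False
    then obtain i where i: "i \<in> vertices \<Gamma>" "h (move i \<alpha> \<beta>) < 0"
      using descent_exists less by blast
    let ?a = "reflection \<Gamma> i \<alpha>" and ?b = "reflection \<Gamma> i \<beta>"
    have roots: "?a \<in> roots \<Gamma>" "?b \<in> roots \<Gamma>"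
      using less i reflection_roots by blast+
    have pos: "h ?a > 0" "h ?b > 0"
      using False less i by (auto intro!: pos_reflection)
    have "h ?a * h ?b < h \<alpha> * h \<beta>" "0 < h ?a * h ?b" "h ?a * h ?b \<in> \<int>" "h \<alpha> * h \<beta> \<in> \<int>"
      using i h_move pos roots less(2,4) root_h_Ints by (simp_all add: Ints_mult)
    then have "nat \<lfloor>h ?a * h ?b\<rfloor> < nat \<lfloor>h \<alpha> * h \<beta>\<rfloor>"
      by (auto elim!: Ints_cases)
    moreover have "B ?a ?b = 0"
      using less(6) weyl_isometry[OF finite_type weyl_reflection[OF i(1)]] by simp
    ultimately have "?a \<or>\<^sub>2 ?b \<in> ncone \<Gamma>"
      using less(1)[of ?a ?b] pos roots by blast
    then show ?thesis
      using ncone_add[OF move_down_in_ncone[OF less(2,4,6) i]] diff_add_cancel by metis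
  qed
qed

text \<open>If \<open>\<alpha> + \<beta>\<close> pairs negatively with \<open>\<alpha>\<^sub>i\<close>, then one of \<open>\<alpha>\<close>, \<open>\<beta>\<close> does and the other one does not pair
positively, so \<open>s\<^sub>i\<close> raises one height and does not lower the other.\<close>

lemma sum_dominant:
  assumes "\<alpha> \<in> roots \<Gamma>" "\<beta> \<in> roots \<Gamma>" "B \<alpha> \<beta> = 0" "h \<alpha> > 0" "h \<beta> > 0" "i \<in> vertices \<Gamma>"
    and max: "h (reflection \<Gamma> i \<alpha>) * h (reflection \<Gamma> i \<beta>) \<le> h \<alpha> * h \<beta>"
  shows "B (sr i) (\<alpha> + \<beta>) \<ge> 0"
proof (cases "\<alpha> = sr i \<or> \<beta> = sr i")
  case True
  then have "B (sr i) \<alpha> = 2 \<and> B (sr i) \<beta> = 0 \<or> B (sr i) \<alpha> = 0 \<and> B (sr i) \<beta> = 2"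
    using assms(3,6) simple_root_norm[OF finite_type assms(6)] form_commute[of \<Gamma> \<alpha> \<beta>] by auto
  then show ?thesis by (auto simp: form_add)
next
  case False
  then have "B (sr i) \<alpha> \<in> {- 1, 0, 1}" "B (sr i) \<beta> \<in> {- 1, 0, 1}"
    using pos_cartan assms by blast+
  then show ?thesis
    using max assms(4,5)
    by (auto simp: h_reflection[OF assms(6)] form_add algebra_simps)
qed

lemma act_root_vee:
  assumes "w \<in> weyl \<Gamma>" "\<alpha> \<in> roots \<Gamma>" "\<beta> \<in> roots \<Gamma>"
  shows "act \<Gamma> w (\<alpha> \<or>\<^sub>2 \<beta>) = w \<alpha> \<or>\<^sub>2 w \<beta>"
  by (rule act_vee[OF assms(1) root_support[OF finite_type assms(2)]
        root_support[OF finite_type assms(3)]])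

lemma orbit_eq:
  assumes "\<alpha> \<in> roots \<Gamma>" "\<beta> \<in> roots \<Gamma>"
  shows "orbit \<Gamma> (\<alpha> \<or>\<^sub>2 \<beta>) = {w \<alpha> \<or>\<^sub>2 w \<beta> | w. w \<in> weyl \<Gamma>}"
proof -
  have "t = act \<Gamma> w (\<alpha> \<or>\<^sub>2 \<beta>) \<and> w \<in> weyl \<Gamma> \<longleftrightarrow> t = w \<alpha> \<or>\<^sub>2 w \<beta> \<and> w \<in> weyl \<Gamma>" for t w
    using act_root_vee[OF _ assms, of w] by (cases "w \<in> weyl \<Gamma>") (simp_all only: simp_thms)
  then show ?thesis unfolding orbit_def by (simp only:)
qed

lemma orbit_act:
  assumes "\<alpha> \<in> roots \<Gamma>" "\<beta> \<in> roots \<Gamma>" "\<gamma> \<in> roots \<Gamma>" "\<delta> \<in> roots \<Gamma>" "w \<in> weyl \<Gamma>"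
    and "\<gamma> \<or>\<^sub>2 \<delta> \<in> orbit \<Gamma> (\<alpha> \<or>\<^sub>2 \<beta>)"
  shows "w \<gamma> \<or>\<^sub>2 w \<delta> \<in> orbit \<Gamma> (\<alpha> \<or>\<^sub>2 \<beta>)"
proof -
  obtain w' where w': "w' \<in> weyl \<Gamma>" "\<gamma> \<or>\<^sub>2 \<delta> = w' \<alpha> \<or>\<^sub>2 w' \<beta>"
    using assms(6) unfolding orbit_eq[OF assms(1,2)] by blast
  have "w \<gamma> \<or>\<^sub>2 w \<delta> = act \<Gamma> w (w' \<alpha> \<or>\<^sub>2 w' \<beta>)"
    using act_root_vee[OF assms(5,3,4)] by (simp only: w'(2))
  also have "\<dots> = (w \<circ> w') \<alpha> \<or>\<^sub>2 (w \<circ> w') \<beta>"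
    using act_root_vee[OF assms(5) weyl_roots[OF w'(1) assms(1)] weyl_roots[OF w'(1) assms(2)]]
    by (simp only: comp_apply)
  finally show ?thesis
    unfolding orbit_eq[OF assms(1,2)] using weyl_comp[OF assms(5) w'(1)] by blast
qed

lemma orbit_eqI:
  assumes "\<alpha> \<in> roots \<Gamma>" "\<beta> \<in> roots \<Gamma>" "p \<in> orbit \<Gamma> (\<alpha> \<or>\<^sub>2 \<beta>)"
  shows "orbit \<Gamma> p = orbit \<Gamma> (\<alpha> \<or>\<^sub>2 \<beta>)"
proof -
  obtain w where w: "w \<in> weyl \<Gamma>" and p: "p = w \<alpha> \<or>\<^sub>2 w \<beta>"
    using assms(3) unfolding orbit_eq[OF assms(1,2)] by blast
  have r: "w \<alpha> \<in> roots \<Gamma>" "w \<beta> \<in> roots \<Gamma>" using weyl_roots w assms by blast+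
  obtain w' where w': "w' \<in> weyl \<Gamma>" "w' \<circ> w = id"
    using weyl_inverse[OF finite_type w] .
  have id: "w' (w v) = v" for v using fun_cong[OF w'(2), of v] by (simp only: comp_apply id_apply)
  show ?thesis
  proof
    show "orbit \<Gamma> p \<subseteq> orbit \<Gamma> (\<alpha> \<or>\<^sub>2 \<beta>)"
      unfolding p orbit_eq[OF r] using orbit_act[OF assms(1,2) r] assms(3) unfolding p by blast
    have "id (w' (w \<alpha>)) \<or>\<^sub>2 id (w' (w \<beta>)) \<in> orbit \<Gamma> p"
      unfolding p orbit_eq[OF r] id_apply using w' by blast
    then have *: "\<alpha> \<or>\<^sub>2 \<beta> \<in> orbit \<Gamma> p" by (simp only: id id_apply)
    show "orbit \<Gamma> (\<alpha> \<or>\<^sub>2 \<beta>) \<subseteq> orbit \<Gamma> p"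
      using orbit_act[OF r assms(1,2)] * unfolding p orbit_eq[OF assms(1,2)] by blast
  qed
qed

lemma orbit_refl:
  assumes "\<alpha> \<in> roots \<Gamma>" "\<beta> \<in> roots \<Gamma>"
  shows "\<alpha> \<or>\<^sub>2 \<beta> \<in> orbit \<Gamma> (\<alpha> \<or>\<^sub>2 \<beta>)"
proof -
  have "id \<alpha> \<or>\<^sub>2 id \<beta> \<in> orbit \<Gamma> (\<alpha> \<or>\<^sub>2 \<beta>)"
    unfolding orbit_eq[OF assms] using weyl_id by blast
  then show ?thesis by (simp only: id_apply)
qed

text \<open>Changing the signs of both roots does not change the 2-root, so every 2-root is plus or minus a
positive one.\<close>

lemma two_root_sign_cases:
  assumes "\<alpha> \<in> roots \<Gamma>" "\<beta> \<in> roots \<Gamma>" "B \<alpha> \<beta> = 0"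
  obtains \<gamma> \<delta> where "\<gamma> \<in> roots \<Gamma>" "\<delta> \<in> roots \<Gamma>" "h \<gamma> > 0" "h \<delta> > 0" "B \<gamma> \<delta> = 0"
    "\<alpha> \<or>\<^sub>2 \<beta> = \<gamma> \<or>\<^sub>2 \<delta> \<or> \<alpha> \<or>\<^sub>2 \<beta> = \<gamma> \<or>\<^sub>2 (- \<delta>)"
proof -
  have *: "\<exists>\<gamma>\<in>{\<alpha>, - \<alpha>}. \<gamma> \<in> roots \<Gamma> \<and> h \<gamma> > 0" if "\<alpha> \<in> roots \<Gamma>" for \<alpha>
  proof (cases "h \<alpha> > 0")
    case False
    then have "h (- \<alpha>) > 0" using root_h_nonzero[OF that] by (simp only: height_minus)
    then show ?thesis using root_minus[OF finite_type that] by blast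
  qed (use that in blast)
  obtain \<gamma> \<delta> where g: "\<gamma> \<in> {\<alpha>, - \<alpha>}" "\<delta> \<in> {\<beta>, - \<beta>}" and
    *: "\<gamma> \<in> roots \<Gamma>" "\<delta> \<in> roots \<Gamma>" "h \<gamma> > 0" "h \<delta> > 0"
    using *[OF assms(1)] *[OF assms(2)] by blast
  have "B \<gamma> \<delta> = 0" using g assms(3) by (auto simp only: insert_iff empty_iff form_linear_simps)
  moreover have "\<alpha> \<or>\<^sub>2 \<beta> = \<gamma> \<or>\<^sub>2 \<delta> \<or> \<alpha> \<or>\<^sub>2 \<beta> = \<gamma> \<or>\<^sub>2 (- \<delta>)"
    using g by (auto simp only: insert_iff empty_iff vee_linear minus_minus)
  ultimately show thesis using that * by blast
qed

lemma minus_vee_reflection: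
  assumes "\<beta> \<in> roots \<Gamma>" "B \<alpha> \<beta> = 0"
  shows "root_refl \<Gamma> \<beta> \<alpha> = \<alpha>" "root_refl \<Gamma> \<beta> \<beta> = - \<beta>" "root_refl \<Gamma> \<beta> (- \<beta>) = \<beta>"
  using assms(2) root_norm[OF finite_type assms(1)] form_commute[of \<Gamma> \<alpha> \<beta>]
  by (simp_all add: root_refl_def form_minus fun_eq_iff)

text \<open>\<open>Q\<close> is a \<open>W\<close>-invariant class of 2-roots in which \<open>\<mu> \<or>\<^sub>2 \<nu>\<close> is the only positive local maximum of
the product of the heights.\<close>

context
  fixes Q :: "tensor \<Rightarrow> bool" and \<mu> \<nu> :: vec
  assumes top: "\<mu> \<in> roots \<Gamma>" "\<nu> \<in> roots \<Gamma>" "h \<mu> > 0" "h \<nu> > 0" "B \<mu> \<nu> = 0" "Q (\<mu> \<or>\<^sub>2 \<nu>)"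
    and Q_reflection: "\<And>i \<alpha> \<beta>. i \<in> vertices \<Gamma> \<Longrightarrow> \<alpha> \<in> roots \<Gamma> \<Longrightarrow> \<beta> \<in> roots \<Gamma> \<Longrightarrow> B \<alpha> \<beta> = 0 \<Longrightarrow>
      Q (\<alpha> \<or>\<^sub>2 \<beta>) \<Longrightarrow> Q (reflection \<Gamma> i \<alpha> \<or>\<^sub>2 reflection \<Gamma> i \<beta>)"
    and local_max: "\<And>\<alpha> \<beta>. \<alpha> \<in> roots \<Gamma> \<Longrightarrow> \<beta> \<in> roots \<Gamma> \<Longrightarrow> B \<alpha> \<beta> = 0 \<Longrightarrow> h \<alpha> > 0 \<Longrightarrow> h \<beta> > 0 \<Longrightarrow>
      Q (\<alpha> \<or>\<^sub>2 \<beta>) \<Longrightarrow>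
      (\<And>i. i \<in> vertices \<Gamma> \<Longrightarrow> h (reflection \<Gamma> i \<alpha>) * h (reflection \<Gamma> i \<beta>) \<le> h \<alpha> * h \<beta>) \<Longrightarrow>
      \<alpha> \<or>\<^sub>2 \<beta> = \<mu> \<or>\<^sub>2 \<nu>"
begin

lemma Q_weyl:
  assumes "w \<in> weyl \<Gamma>" "\<alpha> \<in> roots \<Gamma>" "\<beta> \<in> roots \<Gamma>" "B \<alpha> \<beta> = 0" "Q (\<alpha> \<or>\<^sub>2 \<beta>)"
  shows "Q (w \<alpha> \<or>\<^sub>2 w \<beta>)"
  using assms(1)
proof (induction rule: weyl.induct)
  case weyl_id
  show ?case using assms(5) by (simp only: id_apply)
next
  case (weyl_step w i)
  have "B (w \<alpha>) (w \<beta>) = 0"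
    using weyl_isometry[OF finite_type weyl_step.hyps(1)] assms(4) by (simp only:)
  then show ?case
    unfolding comp_apply
    by (intro Q_reflection weyl_step weyl_roots[OF weyl_step.hyps(1)] assms(2,3))
qed

text \<open>Apply simple reflections that raise the product of the heights.  They stay positive, because
reflecting \<open>\<alpha>\<^sub>i \<or>\<^sub>2 \<beta>\<close> in \<open>\<alpha>\<^sub>i\<close> makes the product negative.  The product is an integer and bounded by
\<open>M\<^sup>2\<close>, which gives the termination measure.\<close>

lemma climb_to_top:
  assumes "\<alpha> \<in> roots \<Gamma>" "\<beta> \<in> roots \<Gamma>" "h \<alpha> > 0" "h \<beta> > 0" "B \<alpha> \<beta> = 0" "Q (\<alpha> \<or>\<^sub>2 \<beta>)"
  shows "\<mu> \<or>\<^sub>2 \<nu> - \<alpha> \<or>\<^sub>2 \<beta> \<in> ncone \<Gamma> \<and> \<alpha> \<or>\<^sub>2 \<beta> \<in> orbit \<Gamma> (\<mu> \<or>\<^sub>2 \<nu>)"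
proof -
  obtain M where M: "\<And>\<alpha>. \<alpha> \<in> roots \<Gamma> \<Longrightarrow> h \<alpha> \<le> M" using h_bounded by blast
  show ?thesis
    using assms
  proof (induction "nat \<lfloor>M * M - h \<alpha> * h \<beta>\<rfloor>" arbitrary: \<alpha> \<beta> rule: less_induct)
    case less
    show ?case
    proof (cases "\<exists>i\<in>vertices \<Gamma>. h (move i \<alpha> \<beta>) > 0")
      case False
      then have "\<alpha> \<or>\<^sub>2 \<beta> = \<mu> \<or>\<^sub>2 \<nu>"
        using less h_move[of _ \<alpha> \<beta>] by (intro local_max) (auto simp add: not_less)
      then show ?thesis
        using ncone_zero orbit_refl[OF top(1,2)] by (simp only: diff_self)
    next
      case True
      then obtain i where i: "i \<in> vertices \<Gamma>" "h (move i \<alpha> \<beta>) > 0" by blast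
      let ?a = "reflection \<Gamma> i \<alpha>" and ?b = "reflection \<Gamma> i \<beta>"
      have aa: "B (sr i) (sr i) = 2" using i(1) by (rule simple_root_norm[OF finite_type])
      have "\<alpha> \<noteq> sr i"
      proof
        assume "\<alpha> = sr i"
        then have "h (move i \<alpha> \<beta>) = - (2 * h \<beta>)"
          unfolding move_def height_diff height_smul using less(6) aa by simp
        then show False using i(2) less(5) by simp
      qed
      moreover have "\<beta> \<noteq> sr i"
      proof
        assume "\<beta> = sr i"
        then have "h (move i \<alpha> \<beta>) = - (2 * h \<alpha>)"
          unfolding move_def height_diff height_smul using less(6) aa by (simp add: form_commute[of _ \<alpha>])
        then show False using i(2) less(4) by simp
      qed
      ultimately have pos: "h ?a > 0" "h ?b > 0"
        using less i by (auto intro!: pos_reflection)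
      have roots: "?a \<in> roots \<Gamma>" "?b \<in> roots \<Gamma>"
        using less i reflection_roots by blast+
      have o: "B ?a ?b = 0"
        using less(6) weyl_isometry[OF finite_type weyl_reflection[OF i(1)]] by simp
      have Q: "Q (?a \<or>\<^sub>2 ?b)" using less i by (intro Q_reflection)
      have "h \<alpha> * h \<beta> < h ?a * h ?b" "h ?a * h ?b \<in> \<int>" "h \<alpha> * h \<beta> \<in> \<int>"
        using i h_move roots less(2,3) root_h_Ints by (simp_all add: Ints_mult)
      then have "h \<alpha> * h \<beta> + 1 \<le> h ?a * h ?b"
        by (auto elim!: Ints_cases)
      moreover have "h ?a * h ?b \<le> M * M"
        using M[OF roots(1)] M[OF roots(2)] pos by (intro mult_mono) auto
      ultimately have "nat \<lfloor>M * M - h ?a * h ?b\<rfloor> < nat \<lfloor>M * M - h \<alpha> * h \<beta>\<rfloor>"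
        by linarith
      then have IH: "\<mu> \<or>\<^sub>2 \<nu> - ?a \<or>\<^sub>2 ?b \<in> ncone \<Gamma>" "?a \<or>\<^sub>2 ?b \<in> orbit \<Gamma> (\<mu> \<or>\<^sub>2 \<nu>)"
        using less(1)[of ?a ?b] pos roots o Q by blast+
      have "\<mu> \<or>\<^sub>2 \<nu> - \<alpha> \<or>\<^sub>2 \<beta> = (\<mu> \<or>\<^sub>2 \<nu> - ?a \<or>\<^sub>2 ?b) + sr i \<or>\<^sub>2 move i \<alpha> \<beta>"
        unfolding reflection_vee by (simp add: fun_eq_iff)
      then have "\<mu> \<or>\<^sub>2 \<nu> - \<alpha> \<or>\<^sub>2 \<beta> \<in> ncone \<Gamma>"
        using ncone_add[OF IH(1) move_up_in_ncone[OF less(2,3,6) i]] by (simp only:)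
      moreover have "reflection \<Gamma> i ?a \<or>\<^sub>2 reflection \<Gamma> i ?b \<in> orbit \<Gamma> (\<mu> \<or>\<^sub>2 \<nu>)"
        by (rule orbit_act[OF top(1,2) roots weyl_reflection[OF i(1)] IH(2)])
      ultimately show ?thesis
        by (simp only: reflection_involution[OF finite_type i(1)])
    qed
  qed
qed

text \<open>For a positive \<open>p\<close> in the class this is the climb.  A negative one has the form \<open>\<gamma> \<or>\<^sub>2 (- \<delta>)\<close>; it is
the image of the positive 2-root \<open>\<gamma> \<or>\<^sub>2 \<delta>\<close> under \<open>s\<^sub>\<delta>\<close>, and it lies below the top \<open>q\<close> because
\<open>q + \<gamma> \<or>\<^sub>2 \<delta>\<close> is a sum of two elements of the cone.\<close>

theorem highest_in_orbit:
  shows "is_highest \<Gamma> (orbit \<Gamma> (\<mu> \<or>\<^sub>2 \<nu>)) (\<mu> \<or>\<^sub>2 \<nu>)"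
    and "\<And>p. p \<in> two_roots \<Gamma> \<Longrightarrow> p \<in> orbit \<Gamma> (\<mu> \<or>\<^sub>2 \<nu>) \<longleftrightarrow> Q p"
    and "\<And>p. p \<in> two_roots \<Gamma> \<Longrightarrow> Q p \<Longrightarrow> orbit \<Gamma> p = orbit \<Gamma> (\<mu> \<or>\<^sub>2 \<nu>)"
    and "\<mu> \<or>\<^sub>2 \<nu> \<in> two_roots \<Gamma>"
proof -
  let ?q = "\<mu> \<or>\<^sub>2 \<nu>"
  show q: "?q \<in> two_roots \<Gamma>" unfolding two_roots_def using top by blast
  show iff: "p \<in> orbit \<Gamma> ?q \<longleftrightarrow> Q p" if p: "p \<in> two_roots \<Gamma>" for p
  proof
    assume "p \<in> orbit \<Gamma> ?q"
    then show "Q p" unfolding orbit_eq[OF top(1,2)] using Q_weyl top by blast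
  next
    assume "Q p"
    obtain \<alpha> \<beta> where \<alpha>\<beta>: "\<alpha> \<in> roots \<Gamma>" "\<beta> \<in> roots \<Gamma>" "B \<alpha> \<beta> = 0" "p = \<alpha> \<or>\<^sub>2 \<beta>"
      using p unfolding two_roots_def by blast
    obtain \<gamma> \<delta> where *: "\<gamma> \<in> roots \<Gamma>" "\<delta> \<in> roots \<Gamma>" "h \<gamma> > 0" "h \<delta> > 0" "B \<gamma> \<delta> = 0"
      and "\<alpha> \<or>\<^sub>2 \<beta> = \<gamma> \<or>\<^sub>2 \<delta> \<or> \<alpha> \<or>\<^sub>2 \<beta> = \<gamma> \<or>\<^sub>2 (- \<delta>)"
      by (rule two_root_sign_cases[OF \<alpha>\<beta>(1-3)])
    from this(6) consider "p = \<gamma> \<or>\<^sub>2 \<delta>" | "p = \<gamma> \<or>\<^sub>2 (- \<delta>)" using \<alpha>\<beta>(4) by blast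
    then show "p \<in> orbit \<Gamma> ?q"
    proof cases
      case 1
      then show ?thesis using climb_to_top * \<open>Q p\<close> by blast
    next
      case 2
      note w = root_refl_in_weyl[OF finite_type *(2)]
      note eq = minus_vee_reflection[OF *(2,5)]
      have neg: "- \<delta> \<in> roots \<Gamma>" "B \<gamma> (- \<delta>) = 0"
        using root_minus[OF finite_type *(2)] *(5) by (simp_all add: form_minus)
      have "Q (\<gamma> \<or>\<^sub>2 \<delta>)"
        using Q_weyl[OF w *(1) neg] \<open>Q p\<close> by (simp only: 2 eq)
      then have "\<gamma> \<or>\<^sub>2 \<delta> \<in> orbit \<Gamma> ?q" using climb_to_top * by blast
      then have "root_refl \<Gamma> \<delta> \<gamma> \<or>\<^sub>2 root_refl \<Gamma> \<delta> \<delta> \<in> orbit \<Gamma> ?q"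
        by (rule orbit_act[OF top(1,2) *(1,2) w])
      then show ?thesis by (simp only: 2 eq)
    qed
  qed
  show "orbit \<Gamma> p = orbit \<Gamma> ?q" if "p \<in> two_roots \<Gamma>" "Q p" for p
    using that iff orbit_eqI[OF top(1,2)] by blast
  have cone: "?q \<in> ncone \<Gamma>" using pos_two_root_in_ncone top by blast
  show "is_highest \<Gamma> (orbit \<Gamma> ?q) ?q"
    unfolding is_highest_def
  proof (intro conjI ballI orbit_refl top)
    fix p
    assume p: "p \<in> orbit \<Gamma> ?q"
    then obtain w where w: "w \<in> weyl \<Gamma>" "p = w \<mu> \<or>\<^sub>2 w \<nu>"
      unfolding orbit_eq[OF top(1,2)] by blast
    have r: "w \<mu> \<in> roots \<Gamma>" "w \<nu> \<in> roots \<Gamma>" "B (w \<mu>) (w \<nu>) = 0"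
      using weyl_roots[OF w(1)] top weyl_isometry[OF finite_type w(1)] by simp_all
    obtain \<gamma> \<delta> where *: "\<gamma> \<in> roots \<Gamma>" "\<delta> \<in> roots \<Gamma>" "h \<gamma> > 0" "h \<delta> > 0" "B \<gamma> \<delta> = 0"
      and "w \<mu> \<or>\<^sub>2 w \<nu> = \<gamma> \<or>\<^sub>2 \<delta> \<or> w \<mu> \<or>\<^sub>2 w \<nu> = \<gamma> \<or>\<^sub>2 (- \<delta>)"
      by (rule two_root_sign_cases[OF r])
    from this(6) consider "p = \<gamma> \<or>\<^sub>2 \<delta>" | "p = \<gamma> \<or>\<^sub>2 (- \<delta>)" using w(2) by blast
    moreover have c: "\<gamma> \<or>\<^sub>2 \<delta> \<in> ncone \<Gamma>" using pos_two_root_in_ncone * by blast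
    moreover have "Q p" unfolding w(2) using Q_weyl[OF w(1)] top by blast
    ultimately have "p \<in> int_span (canonical_basis \<Gamma>) \<and> ?q - p \<in> ncone \<Gamma>"
    proof cases
      case 1
      then show ?thesis using climb_to_top * \<open>Q p\<close> ncone_int_span c by blast
    next
      case 2
      then have p: "p = - (\<gamma> \<or>\<^sub>2 \<delta>)" by (simp only: vee_linear)
      have "?q + \<gamma> \<or>\<^sub>2 \<delta> \<in> ncone \<Gamma>" using ncone_add[OF cone c] .
      then show ?thesis
        using int_span_minus[OF ncone_int_span[OF c]] by (simp only: p diff_minus_eq_add)
    qed
    then show "le2 \<Gamma> p ?q" using le2I ncone_int_span[OF cone] by blast
  qed
qed

end

end


section \<open>Paths in trees\<close>

text \<open>The Dynkin diagram as a tree rooted at \<open>c\<close>: every edge joins a vertex to its parent, and the depth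
decreases towards the root.  The parent function makes the unique path to \<open>c\<close> computable.\<close>

definition rooted_tree :: "dynkin \<Rightarrow> nat \<Rightarrow> (nat \<Rightarrow> nat) \<Rightarrow> (nat \<Rightarrow> nat) \<Rightarrow> bool" where
  "rooted_tree \<Gamma> c parent depth \<longleftrightarrow> c \<in> vertices \<Gamma> \<and>
     (\<forall>u\<in>vertices \<Gamma>. u \<noteq> c \<longrightarrow>
        parent u \<in> vertices \<Gamma> \<and> adj \<Gamma> u (parent u) \<and> depth (parent u) < depth u) \<and>
     (\<forall>u\<in>vertices \<Gamma>. \<forall>v\<in>vertices \<Gamma>. adj \<Gamma> u v \<longrightarrow> (u \<noteq> c \<and> v = parent u) \<or> (v \<noteq> c \<and> u = parent v))"

lemma is_path_alt:
  "is_path \<Gamma> b c p \<longleftrightarrow> p \<noteq> [] \<and> hd p = b \<and> last p = c \<and> distinct p \<and> set p \<subseteq> vertices \<Gamma> \<and>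
     successively (adj \<Gamma>) p"
  unfolding is_path_def successively_conv_nth by blast

text \<open>A path without repetitions that has once stepped from a parent to its child can never turn back, so
it does not reach the root.\<close>

lemma path_away_from_root:
  assumes "rooted_tree \<Gamma> c parent depth"
  shows "successively (adj \<Gamma>) (u # v # p) \<Longrightarrow> distinct (u # v # p) \<Longrightarrow>
    set (u # v # p) \<subseteq> vertices \<Gamma> \<Longrightarrow> u = parent v \<Longrightarrow> v \<noteq> c \<Longrightarrow> last (v # p) \<noteq> c"
proof (induction p arbitrary: u v)
  case (Cons w p)
  have "v \<in> vertices \<Gamma>" "w \<in> vertices \<Gamma>" "adj \<Gamma> v w" "w \<noteq> parent v"
    using Cons.prems by auto
  then have "w \<noteq> c" "v = parent w"
    using assms unfolding rooted_tree_def by blast+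
  then show ?case using Cons.IH[of v w] Cons.prems by simp
qed simp

text \<open>Every step of a path to the root goes to the parent, by the preceding lemma.\<close>

lemma path_to_root_step:
  assumes tree: "rooted_tree \<Gamma> c parent depth" and "is_path \<Gamma> b c p" "b \<noteq> c"
  obtains p' where "p = b # p'" "is_path \<Gamma> (parent b) c p'"
proof -
  obtain p' where p: "p = b # p'" using assms(2) by (cases p) (auto simp: is_path_alt)
  have "p' \<noteq> []" using assms(2,3) p by (auto simp: is_path_alt)
  then obtain v p'' where p': "p' = v # p''" by (cases p') auto
  have path: "successively (adj \<Gamma>) (b # v # p'')" "distinct (b # v # p'')"
    "set (b # v # p'') \<subseteq> vertices \<Gamma>" "last (v # p'') = c"
    using assms(2) by (auto simp: is_path_alt p p')
  then have "b \<in> vertices \<Gamma>" "v \<in> vertices \<Gamma>" "adj \<Gamma> b v" by auto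
  then have "v = parent b"
    using path_away_from_root[OF tree path(1-3)] path(4) tree unfolding rooted_tree_def by blast
  then have "is_path \<Gamma> (parent b) c p'"
    using path by (auto simp: is_path_alt p')
  then show thesis using that p by blast
qed

lemma path_to_root_unique:
  assumes tree: "rooted_tree \<Gamma> c parent depth"
  shows "is_path \<Gamma> b c p \<Longrightarrow> is_path \<Gamma> b c p' \<Longrightarrow> p = p'"
proof (induction p arbitrary: b p')
  case Nil
  then show ?case by (simp add: is_path_alt)
next
  case (Cons a p)
  show ?case
  proof (cases "b = c")
    case True
    have "q = [c]" if "is_path \<Gamma> c c q" for q
      using that by (cases q) (auto simp: is_path_alt split: if_splits)
    then show ?thesis using Cons.prems True by blast
  next
    case False
    then show ?thesis
      using path_to_root_step[OF tree] Cons by (metis list.inject)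
  qed
qed

lemma path_to_root_exists:
  assumes tree: "rooted_tree \<Gamma> c parent depth"
  shows "b \<in> vertices \<Gamma> \<Longrightarrow> \<exists>p. is_path \<Gamma> b c p \<and> (\<forall>x\<in>set p. depth x \<le> depth b)"
proof (induction "depth b" arbitrary: b rule: less_induct)
  case less
  show ?case
  proof (cases "b = c")
    case True
    then show ?thesis using less by (intro exI[of _ "[c]"]) (simp add: is_path_alt)
  next
    case False
    then have par: "parent b \<in> vertices \<Gamma>" "adj \<Gamma> b (parent b)" "depth (parent b) < depth b"
      using tree less(2) unfolding rooted_tree_def by blast+
    obtain p where p: "is_path \<Gamma> (parent b) c p" "\<forall>x\<in>set p. depth x \<le> depth (parent b)"
      using less(1)[OF par(3,1)] by blast
    then have "is_path \<Gamma> b c (b # p)"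
      using par less(2) by (cases p) (auto simp: is_path_alt)
    then show ?thesis using p par by (intro exI[of _ "b # p"]) auto
  qed
qed

lemma path_vertices_eq:
  assumes "rooted_tree \<Gamma> c parent depth" "is_path \<Gamma> b c p"
  shows "path_vertices \<Gamma> b c = set p"
proof -
  have "(THE p. is_path \<Gamma> b c p) = p"
    using path_to_root_unique[OF assms(1)] assms(2) by (intro the_equality)
  then show ?thesis by (simp add: path_vertices_def)
qed

lemma path_vertices_rec:
  assumes tree: "rooted_tree \<Gamma> c parent depth"
  shows "path_vertices \<Gamma> c c = {c}"
    and "b \<in> vertices \<Gamma> \<Longrightarrow> b \<noteq> c \<Longrightarrow> path_vertices \<Gamma> b c = insert b (path_vertices \<Gamma> (parent b) c)"
proof -
  have "is_path \<Gamma> c c [c]" using tree by (simp add: is_path_alt rooted_tree_def)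
  then show "path_vertices \<Gamma> c c = {c}" using path_vertices_eq[OF tree] by fastforce
  assume b: "b \<in> vertices \<Gamma>" "b \<noteq> c"
  obtain p where p: "is_path \<Gamma> b c p" using path_to_root_exists[OF tree b(1)] by blast
  obtain p' where "p = b # p'" "is_path \<Gamma> (parent b) c p'"
    using path_to_root_step[OF tree p b(2)] .
  then show "path_vertices \<Gamma> b c = insert b (path_vertices \<Gamma> (parent b) c)"
    using path_vertices_eq[OF tree] p by simp
qed

lemma path_vertices_ascending:
  assumes tree: "rooted_tree \<Gamma> c parent depth"
    and parent: "\<And>v. b \<le> v \<Longrightarrow> v < m \<Longrightarrow> v \<in> vertices \<Gamma> \<and> v \<noteq> c \<and> parent v = Suc v"
    and "b \<le> m"
  shows "path_vertices \<Gamma> b c = {b..<m} \<union> path_vertices \<Gamma> m c"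
  using assms(3) parent
proof (induction b rule: inc_induct)
  case base
  then show ?case by simp
next
  case (step b)
  then have "path_vertices \<Gamma> b c = insert b ({Suc b..<m} \<union> path_vertices \<Gamma> m c)"
    using path_vertices_rec(2)[OF tree, of b] by simp
  moreover have "insert b {Suc b..<m} = {b..<m}" using step.hyps by auto
  ultimately show ?case by (simp only: Un_insert_left[symmetric])
qed

lemma path_vertices_descending:
  assumes tree: "rooted_tree \<Gamma> c parent depth"
    and parent: "\<And>v. c < v \<Longrightarrow> v \<le> b \<Longrightarrow> v \<in> vertices \<Gamma> \<and> parent v = v - 1"
    and "c \<le> b"
  shows "path_vertices \<Gamma> b c = {c..b}"
  using assms(3) parent
proof (induction b rule: dec_induct)
  case base
  then show ?case using path_vertices_rec(1)[OF tree] by simp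
next
  case (step b)
  then have "path_vertices \<Gamma> (Suc b) c = insert (Suc b) {c..b}"
    using path_vertices_rec(2)[OF tree, of "Suc b"] by simp
  then show ?case using step.hyps by (simp only: atLeastAtMostSuc_conv le_SucI)
qed


section \<open>Elements of the canonical basis\<close>

lemma eps_apply: "eps a k = (if k = a then 1 else 0)"
  by (simp add: eps_def)

lemma elementary_vee_ncone:
  "i \<in> vertices \<Gamma> \<Longrightarrow> elementary \<Gamma> i \<beta> \<Longrightarrow> simple_root \<Gamma> i \<or>\<^sub>2 \<beta> \<in> ncone \<Gamma>"
  by (rule ncone_basis) (auto simp: canonical_basis_def)

lemma vee_simple_orthogonal:
  assumes "i \<in> vertices \<Gamma>" "j \<in> vertices \<Gamma>" "j \<noteq> i" "\<not> adj \<Gamma> i j"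
  shows "simple_root \<Gamma> i \<or>\<^sub>2 simple_root \<Gamma> j \<in> ncone \<Gamma>"
proof -
  have "elementary \<Gamma> i (simple_root \<Gamma> j)"
    unfolding elementary_def pos_roots_def
    using assms simple_in_roots nonneg_comb_simple_root by blast
  then show ?thesis by (rule elementary_vee_ncone[OF assms(1)])
qed

lemma vee_path_sum:
  assumes "i \<in> vertices \<Gamma>" "h \<in> vertices \<Gamma>" "j \<in> vertices \<Gamma>" "h \<noteq> j" "adj \<Gamma> h i" "adj \<Gamma> i j"
    and "simple_root \<Gamma> h + simple_root \<Gamma> i + simple_root \<Gamma> j \<in> roots \<Gamma>"
  shows "simple_root \<Gamma> i \<or>\<^sub>2 (simple_root \<Gamma> h + simple_root \<Gamma> i + simple_root \<Gamma> j) \<in> ncone \<Gamma>"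
proof -
  have "nonneg_comb_simple \<Gamma> (simple_root \<Gamma> h + simple_root \<Gamma> i + simple_root \<Gamma> j)"
    by (intro nonneg_comb_add nonneg_comb_simple_root assms)
  then have "elementary \<Gamma> i (simple_root \<Gamma> h + simple_root \<Gamma> i + simple_root \<Gamma> j)"
    unfolding elementary_def pos_roots_def using assms by blast
  then show ?thesis by (rule elementary_vee_ncone[OF assms(1)])
qed

lemma vee_theta_sub:
  assumes "i \<in> vertices \<Gamma>" "is_branch \<Gamma> b" "i \<noteq> b"
    and "theta_sub \<Gamma> i b \<in> roots \<Gamma>" "nonneg_comb_simple \<Gamma> (theta_sub \<Gamma> i b)"
  shows "simple_root \<Gamma> i \<or>\<^sub>2 theta_sub \<Gamma> i b \<in> ncone \<Gamma>"
proof -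
  have "elementary \<Gamma> i (theta_sub \<Gamma> i b)"
    unfolding elementary_def pos_roots_def using assms by blast
  then show ?thesis by (rule elementary_vee_ncone[OF assms(1)])
qed


section \<open>The chain of type A inside types A and D\<close>

text \<open>Types \<open>A\<^sub>m\<close> and \<open>D\<^bsub>m+1\<^esub>\<close> share the chain of simple roots \<open>\<epsilon>\<^sub>i - \<epsilon>\<^bsub>i+1\<^esub>\<close> for \<open>1 \<le> i \<le> m\<close> and the
coordinates \<open>1, \<dots>, m + 1\<close>.\<close>

definition eps_chain :: "dynkin \<Rightarrow> nat \<Rightarrow> bool" where
  "eps_chain \<Gamma> m \<longleftrightarrow> simply_laced_finite \<Gamma> \<and> (\<Gamma> = DynkinA m \<or> \<Gamma> = DynkinD (Suc m))"

definition swap :: "nat \<Rightarrow> nat \<Rightarrow> nat" where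
  "swap i a = (if a = i then i + 1 else if a = i + 1 then i else a)"

context
  fixes \<Gamma> :: dynkin and m :: nat
  assumes chain: "eps_chain \<Gamma> m"
begin

lemma chain_finite_type: "simply_laced_finite \<Gamma>"
  using chain by (simp add: eps_chain_def)

lemma chain_vertex: "1 \<le> i \<Longrightarrow> i \<le> m \<Longrightarrow> i \<in> vertices \<Gamma>"
  using chain by (auto simp: eps_chain_def)

lemma chain_simple: "1 \<le> i \<Longrightarrow> i \<le> m \<Longrightarrow> simple_root \<Gamma> i = eps i - eps (i + 1)"
  using chain by (auto simp: eps_chain_def)

lemma chain_adj: "1 \<le> i \<Longrightarrow> i \<le> m \<Longrightarrow> 1 \<le> j \<Longrightarrow> j \<le> m \<Longrightarrow> adj \<Gamma> i j \<longleftrightarrow> j = i + 1 \<or> i = j + 1"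
  using chain by (auto simp: eps_chain_def adj_def)

lemma chain_form: "form \<Gamma> u v = (\<Sum>k\<in>{1..m + 1}. u k * v k)"
  using chain by (auto simp: eps_chain_def simp del: sum.cl_ivl_Suc)

lemma form_eps: "1 \<le> a \<Longrightarrow> a \<le> m + 1 \<Longrightarrow> form \<Gamma> (eps a) v = v a"
  unfolding chain_form by (subst sum_eps_mult) auto

lemma chain_form_simple:
  "1 \<le> i \<Longrightarrow> i \<le> m \<Longrightarrow> form \<Gamma> (simple_root \<Gamma> i) v = v i - v (i + 1)"
  by (simp only: chain_simple form_left) (simp add: form_eps)

lemma chain_reflection_eps:
  "1 \<le> i \<Longrightarrow> i \<le> m \<Longrightarrow> reflection \<Gamma> i (eps a) = eps (swap i a)"
  unfolding reflection_def chain_form_simple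
  by (auto simp: chain_simple fun_eq_iff eps_apply swap_def)

lemma chain_root:
  assumes ab: "1 \<le> a" "a < b" "b \<le> m + 1"
  shows "eps a - eps b \<in> roots \<Gamma>" and "nonneg_comb_simple \<Gamma> (eps a - eps b)"
proof -
  have "eps a - eps b \<in> roots \<Gamma> \<and> nonneg_comb_simple \<Gamma> (eps a - eps b)"
    using Suc_leI[OF ab(2)] ab(3)
  proof (induction b rule: dec_induct)
    case base
    then have a: "a \<le> m" by simp
    then show ?case
      using simple_in_roots nonneg_comb_simple_root chain_vertex[OF ab(1) a]
      by (metis chain_simple[OF ab(1) a] Suc_eq_plus1)
  next
    case (step b)
    have b: "1 \<le> b" "b \<le> m" using step by auto
    have "form \<Gamma> (eps a - eps b) (simple_root \<Gamma> b) = - 1"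
      using step b by (simp add: form_commute[of \<Gamma> _ "simple_root \<Gamma> b"] chain_form_simple eps_apply)
    then have "eps a - eps b + simple_root \<Gamma> b \<in> roots \<Gamma>"
      "nonneg_comb_simple \<Gamma> (eps a - eps b + simple_root \<Gamma> b)"
      using root_add[OF chain_finite_type _ simple_in_roots] nonneg_comb_add
        nonneg_comb_simple_root chain_vertex[OF b] step.IH[OF Suc_leD[OF step.prems]] by blast+
    moreover have "eps a - eps b + simple_root \<Gamma> b = eps a - eps (Suc b)"
      using b by (simp add: chain_simple fun_eq_iff)
    ultimately show ?case by (simp only: simp_thms)
  qed
  then show "eps a - eps b \<in> roots \<Gamma>" "nonneg_comb_simple \<Gamma> (eps a - eps b)" by blast+
qed

text \<open>Telescope \<open>\<epsilon>\<^sub>a - \<epsilon>\<^sub>b\<close> along the indices other than \<open>i\<close> and \<open>i + 1\<close>.  Consecutive ones differ by a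
simple root not adjacent to \<open>i\<close>, except for the jump from \<open>i - 1\<close> to \<open>i + 2\<close>, which is the sum of
the simple roots on the path \<open>i - 1\<close>, \<open>i\<close>, \<open>i + 1\<close>.\<close>

lemma chain_vee_ncone:
  assumes i: "1 \<le> i" "i \<le> m"
    and ab: "1 \<le> a" "a < b" "b \<le> m + 1" "a \<notin> {i, i + 1}" "b \<notin> {i, i + 1}"
  shows "simple_root \<Gamma> i \<or>\<^sub>2 (eps a - eps b) \<in> ncone \<Gamma>"
  using ab
proof (induction b rule: less_induct)
  case (less b)
  have glue: "simple_root \<Gamma> i \<or>\<^sub>2 (eps a - eps b) \<in> ncone \<Gamma>"
    if "a < k" "k < b" "k \<notin> {i, i + 1}" "simple_root \<Gamma> i \<or>\<^sub>2 (eps k - eps b) \<in> ncone \<Gamma>" for k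
  proof -
    have "simple_root \<Gamma> i \<or>\<^sub>2 (eps a - eps k) \<in> ncone \<Gamma>"
      by (rule less.IH[OF that(2)]) (use less.prems that in auto)
    moreover have "(eps a - eps k) + (eps k - eps b) = eps a - eps b" by (simp add: fun_eq_iff)
    ultimately show ?thesis using ncone_add[OF _ that(4)] by (metis vee_linear(4))
  qed
  have step: "simple_root \<Gamma> i \<or>\<^sub>2 (eps k - eps (k + 1)) \<in> ncone \<Gamma>"
    if "1 \<le> k" "k \<le> m" "k \<notin> {i, i + 1}" "k + 1 \<noteq> i" for k
  proof -
    have "simple_root \<Gamma> i \<or>\<^sub>2 simple_root \<Gamma> k \<in> ncone \<Gamma>"
      using i that by (intro vee_simple_orthogonal chain_vertex) (auto simp: chain_adj)
    then show ?thesis using that by (simp only: chain_simple)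
  qed
  have jump: "simple_root \<Gamma> i \<or>\<^sub>2 (eps (i - 1) - eps (i + 2)) \<in> ncone \<Gamma>" if "2 \<le> i" "i + 1 \<le> m"
  proof -
    have "simple_root \<Gamma> (i - 1) = eps (i - 1) - eps i"
      using chain_simple[of "i - 1"] that by simp
    moreover have "simple_root \<Gamma> (i + 1) = eps (i + 1) - eps (i + 2)"
      using chain_simple[of "i + 1"] that by simp
    ultimately have sum: "simple_root \<Gamma> (i - 1) + simple_root \<Gamma> i + simple_root \<Gamma> (i + 1) =
        eps (i - 1) - eps (i + 2)"
      using that by (simp add: fun_eq_iff chain_simple)
    have "eps (i - 1) - eps (i + 2) \<in> roots \<Gamma>" using that by (intro chain_root) auto
    then have "simple_root \<Gamma> i \<or>\<^sub>2
        (simple_root \<Gamma> (i - 1) + simple_root \<Gamma> i + simple_root \<Gamma> (i + 1)) \<in> ncone \<Gamma>"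
      using that by (intro vee_path_sum chain_vertex) (auto simp: chain_adj sum simp del: One_nat_def)
    then show ?thesis by (simp only: sum)
  qed
  show ?case
  proof (cases "b = i + 2 \<and> 2 \<le> i")
    case True
    then have *: "simple_root \<Gamma> i \<or>\<^sub>2 (eps (i - 1) - eps b) \<in> ncone \<Gamma>"
      using jump less.prems by simp
    show ?thesis
    proof (cases "a = i - 1")
      case False
      show ?thesis by (rule glue[OF _ _ _ *]) (use False True less.prems in auto)
    qed (use * in \<open>simp only:\<close>)
  next
    case False
    then have "b - 1 \<notin> {i, i + 1}" using less.prems i by auto
    then have *: "simple_root \<Gamma> i \<or>\<^sub>2 (eps (b - 1) - eps b) \<in> ncone \<Gamma>"
      using step[of "b - 1"] less.prems by auto
    show ?thesis
    proof (cases "a = b - 1")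
      case False
      show ?thesis
        by (rule glue[OF _ _ _ *]) (use False less.prems \<open>b - 1 \<notin> {i, i + 1}\<close> in auto)
    qed (use * in \<open>simp only:\<close>)
  qed
qed

end


section \<open>Type A\<close>

lemma chain_A: "1 \<le> n \<Longrightarrow> eps_chain (DynkinA n) n"
  by (simp add: eps_chain_def)

lemma roots_A_cases:
  assumes "1 \<le> n" "\<alpha> \<in> roots (DynkinA n)"
  obtains a b where "a \<in> {1..n + 1}" "b \<in> {1..n + 1}" "a \<noteq> b" "\<alpha> = eps a - eps b"
proof -
  have "\<exists>a b. a \<in> {1..n + 1} \<and> b \<in> {1..n + 1} \<and> a \<noteq> b \<and> \<alpha> = eps a - eps b"
    using assms(2)
  proof (induction rule: roots_induct)
    case (simple i)
    then show ?case by (intro exI[of _ i] exI[of _ "i + 1"]) auto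
  next
    case (reflect i \<alpha>)
    then obtain a b where ab: "a \<in> {1..n + 1}" "b \<in> {1..n + 1}" "a \<noteq> b" "\<alpha> = eps a - eps b"
      by blast
    have i: "1 \<le> i" "i \<le> n" using reflect by auto
    have "reflection (DynkinA n) i \<alpha> = eps (swap i a) - eps (swap i b)"
      using chain_reflection_eps[OF chain_A[OF assms(1)] i]
      unfolding ab(4) reflection_eq root_refl_linear by (simp only:)
    moreover have "swap i a \<in> {1..n + 1}" "swap i b \<in> {1..n + 1}" "swap i a \<noteq> swap i b"
      using ab i by (auto simp: swap_def)
    ultimately show ?case by blast
  qed
  then show thesis using that by blast
qed

lemma two_root_system_A:
  assumes n: "1 \<le> n"
  shows "two_root_system (DynkinA n)"
proof
  let ?\<Gamma> = "DynkinA n"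
  note chain = chain_A[OF n]
  show fin: "simply_laced_finite ?\<Gamma>" using n by simp
  have coords: "height ?\<Gamma> (eps k) = - real k" if "k \<in> {1..n + 1}" for k
    using height_eps[of k ?\<Gamma>] that by simp
  show "\<exists>M. \<forall>\<alpha>\<in>roots ?\<Gamma>. height ?\<Gamma> \<alpha> \<le> M"
  proof (intro exI ballI)
    fix \<alpha> assume "\<alpha> \<in> roots ?\<Gamma>"
    then show "height ?\<Gamma> \<alpha> \<le> real n + 1"
      by (elim roots_A_cases[OF n]) (auto simp: height_diff coords simp del: coords.simps)
  qed
  show "nonneg_comb_simple ?\<Gamma> \<alpha> \<or> nonneg_comb_simple ?\<Gamma> (- \<alpha>)" if "\<alpha> \<in> roots ?\<Gamma>" for \<alpha>
    using n that
  proof (rule roots_A_cases)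
    fix a b assume ab: "a \<in> {1..n + 1}" "b \<in> {1..n + 1}" "a \<noteq> b" "\<alpha> = eps a - eps b"
    then have "nonneg_comb_simple ?\<Gamma> (eps a - eps b) \<or> nonneg_comb_simple ?\<Gamma> (eps b - eps a)"
      using chain_root(2)[OF chain, of a b] chain_root(2)[OF chain, of b a]
      by (cases "a < b") auto
    then show ?thesis by (simp only: ab(4) minus_diff_eq)
  qed
  have form: "form ?\<Gamma> (simple_root ?\<Gamma> i) v = v i - v (i + 1)" if "i \<in> vertices ?\<Gamma>" for i v
    using chain_form_simple[OF chain] that by simp
  show "form ?\<Gamma> (simple_root ?\<Gamma> i) \<alpha> \<in> {- 1, 0, 1} \<or> \<alpha> = simple_root ?\<Gamma> i \<or> \<alpha> = - simple_root ?\<Gamma> i"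
    if "\<alpha> \<in> roots ?\<Gamma>" "i \<in> vertices ?\<Gamma>" for \<alpha> i
    using n that(1)
  proof (rule roots_A_cases)
    fix a b assume ab: "a \<in> {1..n + 1}" "b \<in> {1..n + 1}" "a \<noteq> b" "\<alpha> = eps a - eps b"
    show ?thesis
    proof (cases "a \<in> {i, i + 1} \<and> b \<in> {i, i + 1}")
      case True
      then show ?thesis using ab by (auto simp: fun_eq_iff)
    next
      case False
      then show ?thesis unfolding form[OF that(2)] ab(4) by (auto simp: eps_apply)
    qed
  qed
  show "simple_root ?\<Gamma> i \<or>\<^sub>2 \<alpha> \<in> ncone ?\<Gamma>"
    if "\<alpha> \<in> roots ?\<Gamma>" "height ?\<Gamma> \<alpha> > 0" "i \<in> vertices ?\<Gamma>"
      "form ?\<Gamma> (simple_root ?\<Gamma> i) \<alpha> = 0" for \<alpha> i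
    using n that(1)
  proof (rule roots_A_cases)
    fix a b assume ab: "a \<in> {1..n + 1}" "b \<in> {1..n + 1}" "a \<noteq> b" "\<alpha> = eps a - eps b"
    have i: "1 \<le> i" "i \<le> n" using that(3) by auto
    have "a < b" using that(2) ab coords by (auto simp: height_diff simp del: coords.simps)
    moreover have "a \<notin> {i, i + 1}" "b \<notin> {i, i + 1}"
      using that(4) \<open>a < b\<close> unfolding form[OF that(3)] ab(4)
      by (auto simp: eps_apply split: if_splits)
    ultimately show ?thesis
      unfolding ab(4) using chain_vee_ncone[OF chain i] ab by auto
  qed
qed


lemma chain_path_sum:
  assumes "eps_chain \<Gamma> m" "1 \<le> b" "b \<le> c" "c \<le> m"
  shows "(\<Sum>i=b..c. simple_root \<Gamma> i) = eps b - eps (c + 1)"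
  using assms(3,4)
proof (induction c rule: dec_induct)
  case base
  then show ?case using chain_simple[OF assms(1,2)] by simp
next
  case (step c)
  have "(\<Sum>i=b..Suc c. simple_root \<Gamma> i) = (eps b - eps (c + 1)) + simple_root \<Gamma> (Suc c)"
    using step by (simp only: sum.cl_ivl_Suc) simp
  also have "\<dots> = eps b - eps (Suc c + 1)"
    using chain_simple[OF assms(1), of "Suc c"] step assms(2) by simp
  finally show ?case .
qed

lemma rooted_tree_A:
  assumes "1 \<le> c" "c \<le> n"
  shows "rooted_tree (DynkinA n) c (\<lambda>v. if v < c then Suc v else v - 1) (\<lambda>v. (c - v) + (v - c))"
  using assms by (auto simp: rooted_tree_def adj_def)

lemma path_root_A:
  assumes "1 \<le> b" "b \<le> c" "c \<le> n"
  shows "path_root (DynkinA n) b c = eps b - eps (c + 1)"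
proof -
  have c: "1 \<le> c" using assms by simp
  have "path_vertices (DynkinA n) b c = {b..<c} \<union> path_vertices (DynkinA n) c c"
    by (rule path_vertices_ascending[OF rooted_tree_A[OF c assms(3)]]) (use assms in auto)
  also have "\<dots> = {b..c}"
    unfolding path_vertices_rec(1)[OF rooted_tree_A[OF c assms(3)]] using assms(2) by auto
  finally have "path_vertices (DynkinA n) b c = {b..c}" .
  then show ?thesis
    unfolding path_root_def using chain_path_sum[OF chain_A assms] assms by simp
qed

text \<open>The left indices \<open>a < c\<close> must be 1 and 2 and the right indices must be \<open>n\<close> and \<open>n + 1\<close>, since otherwise
one of them can be moved outwards.  Of the two ways to pair them, the nested one
\<open>(\<epsilon>\<^sub>1 - \<epsilon>\<^bsub>n+1\<^esub>) \<or>\<^sub>2 (\<epsilon>\<^sub>2 - \<epsilon>\<^sub>n)\<close> is improved by the first simple reflection, as \<open>(n - 1)\<^sup>2 > n (n - 2)\<close>.\<close>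

lemma local_max_A_aux:
  fixes a b c d n :: nat
  assumes "1 \<le> a" "a < b" "b \<le> n + 1" "c < d" "d \<le> n + 1" "a < c" "b \<noteq> c" "b \<noteq> d"
    and max: "\<And>i. 1 \<le> i \<Longrightarrow> i \<le> n \<Longrightarrow>
      (real b - real a - ((eps a - eps b) i - (eps a - eps b) (i + 1))) *
      (real d - real c - ((eps c - eps d) i - (eps c - eps d) (i + 1))) \<le>
      (real b - real a) * (real d - real c)"
  shows "a = 1 \<and> c = 2 \<and> b = n \<and> d = n + 1"
proof -
  have a: "a = 1"
  proof (rule ccontr)
    assume "a \<noteq> 1"
    then have "1 < a" using assms(1) by linarith
    then obtain i where i: "a = i + 1" "1 \<le> i"
      by (intro that[of "a - 1"]) auto
    then have "i \<noteq> b" "i \<noteq> c" "i \<noteq> d" "a \<noteq> b" "a \<noteq> d" "i \<le> n" using assms(1-8) by auto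
    then show False
      using max[of i] assms(1-8) i by (simp add: eps_apply algebra_simps)
  qed
  have c: "c = 2"
  proof (rule ccontr)
    assume "c \<noteq> 2"
    then have "1 < c - 1" using assms(6) a by linarith
    then obtain i where i: "c = i + 1" "1 < i"
      by (intro that[of "c - 1"]) auto
    then have "i \<noteq> a" "i \<noteq> d" "a \<noteq> d" "a \<noteq> b" "i \<le> n" "1 \<le> i" using assms(1-8) a by auto
    then show False
      using max[of i] assms(1-8) i by (cases "i = b") (simp_all add: eps_apply algebra_simps)
  qed
  have "b = n + 1 \<or> d = n + 1"
  proof (rule ccontr)
    assume "\<not> ?thesis"
    then have le: "b \<le> n" "d \<le> n" using assms(3,5) by auto
    show False
    proof (cases "b < d")
      case True
      then have "1 \<le> d" "d \<noteq> a" "d \<noteq> b" "d \<noteq> c" "d + 1 \<noteq> a" "d + 1 \<noteq> b" "d + 1 \<noteq> c"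
        using assms(1-8) by auto
      then show False using max[of d] le assms(2) by (simp add: eps_apply algebra_simps)
    next
      case False
      then have "1 \<le> b" "b \<noteq> a" "b \<noteq> c" "b \<noteq> d" "b + 1 \<noteq> a" "b + 1 \<noteq> c" "b + 1 \<noteq> d"
        using assms(1-8) by auto
      then show False using max[of b] le assms(4) by (simp add: eps_apply algebra_simps)
    qed
  qed
  then show ?thesis
  proof
    assume b: "b = n + 1"
    have "d = n"
    proof (rule ccontr)
      assume "d \<noteq> n"
      then have "d < n" "d \<noteq> a" "d \<noteq> c" "d + 1 \<noteq> a" "d + 1 \<noteq> c" "1 \<le> d" using assms(1-8) b by auto
      then show False
        using max[of d] assms(1-8) b by (simp add: eps_apply algebra_simps)
    qed
    then show ?thesis
      using max[of 1] assms(1-8) a b c by (simp add: eps_apply algebra_simps)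
  next
    assume d: "d = n + 1"
    have "b = n"
    proof (rule ccontr)
      assume "b \<noteq> n"
      then have "b < n" "b \<noteq> a" "b \<noteq> c" "b + 1 \<noteq> a" "1 \<le> b" "2 < b" using assms(1-8) a c d by auto
      then show False
        using max[of b] assms(1-8) c d by (simp add: eps_apply algebra_simps)
    qed
    then show ?thesis using a c d by simp
  qed
qed

lemma highest_two_root_A:
  assumes n: "n > 2"
  defines "q \<equiv> (eps 1 - eps n) \<or>\<^sub>2 (eps 2 - eps (n + 1))"
  shows "two_root_orbits (DynkinA n) = {orbit (DynkinA n) q}"
    and "is_highest (DynkinA n) (orbit (DynkinA n) q) q"
proof -
  let ?\<Gamma> = "DynkinA n"
  have n1: "1 \<le> n" using n by simp
  note chain = chain_A[OF n1]
  interpret two_root_system ?\<Gamma> by (rule two_root_system_A[OF n1])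
  have ht: "height ?\<Gamma> (eps a - eps b) = real b - real a" if "a \<in> {1..n + 1}" "b \<in> {1..n + 1}" for a b
    using that by (simp add: height_diff height_eps)
  have form: "form ?\<Gamma> (eps a - eps b) v = v a - v b" if "a \<in> {1..n + 1}" "b \<in> {1..n + 1}" for a b v
    using form_eps[OF chain] that by (simp add: form_left)
  have r: "eps 1 - eps n \<in> roots ?\<Gamma>" "eps 2 - eps (n + 1) \<in> roots ?\<Gamma>"
    using n by (auto intro!: chain_root(1)[OF chain])
  have p: "height ?\<Gamma> (eps 1 - eps n) > 0" "height ?\<Gamma> (eps 2 - eps (n + 1)) > 0"
    using n by (simp_all add: ht del: One_nat_def)
  have o: "form ?\<Gamma> (eps 1 - eps n) (eps 2 - eps (n + 1)) = 0"
    using n by (simp add: form eps_apply del: One_nat_def form.simps)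
  have max: "\<alpha> \<or>\<^sub>2 \<beta> = (eps 1 - eps n) \<or>\<^sub>2 (eps 2 - eps (n + 1))"
    if \<alpha>\<beta>: "\<alpha> \<in> roots ?\<Gamma>" "\<beta> \<in> roots ?\<Gamma>" and ab: "form ?\<Gamma> \<alpha> \<beta> = 0" "height ?\<Gamma> \<alpha> > 0" "height ?\<Gamma> \<beta> > 0"
      and max: "\<And>i. i \<in> vertices ?\<Gamma> \<Longrightarrow> height ?\<Gamma> (reflection ?\<Gamma> i \<alpha>) * height ?\<Gamma> (reflection ?\<Gamma> i \<beta>)
        \<le> height ?\<Gamma> \<alpha> * height ?\<Gamma> \<beta>" for \<alpha> \<beta>
  proof -
    obtain a b where a: "a \<in> {1..n + 1}" "b \<in> {1..n + 1}" "a \<noteq> b" and \<alpha>: "\<alpha> = eps a - eps b"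
      using roots_A_cases[OF n1 \<alpha>\<beta>(1)] .
    obtain c d where c: "c \<in> {1..n + 1}" "d \<in> {1..n + 1}" "c \<noteq> d" and \<beta>: "\<beta> = eps c - eps d"
      using roots_A_cases[OF n1 \<alpha>\<beta>(2)] .
    have lt: "a < b" "c < d" using ab(2,3) a c by (simp_all add: \<alpha> \<beta> ht)
    have ne: "a \<noteq> c" "a \<noteq> d" "b \<noteq> c" "b \<noteq> d"
      using ab(1) a c lt by (auto simp: \<alpha> \<beta> form eps_apply simp del: form.simps split: if_splits)
    have m: "(real b - real a - ((eps a - eps b) i - (eps a - eps b) (i + 1))) *
      (real d - real c - ((eps c - eps d) i - (eps c - eps d) (i + 1))) \<le>
      (real b - real a) * (real d - real c)" if "1 \<le> i" "i \<le> n" for i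
    proof -
      have v: "i \<in> vertices ?\<Gamma>" using that by simp
      show ?thesis
        using max[OF v] unfolding h_reflection[OF v] chain_form_simple[OF chain that]
          \<alpha> \<beta> ht[OF a(1,2)] ht[OF c(1,2)] .
    qed
    have m': "(real d - real c - ((eps c - eps d) i - (eps c - eps d) (i + 1))) *
      (real b - real a - ((eps a - eps b) i - (eps a - eps b) (i + 1))) \<le>
      (real d - real c) * (real b - real a)" if "1 \<le> i" "i \<le> n" for i
      using m[OF that] by (simp only: mult.commute)
    have r: "1 \<le> a" "b \<le> n + 1" "1 \<le> c" "d \<le> n + 1" using a c by auto
    have "a = 1 \<and> c = 2 \<and> b = n \<and> d = n + 1 \<or> c = 1 \<and> a = 2 \<and> d = n \<and> b = n + 1"
    proof (cases "a < c")
      case True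
      show ?thesis
        using local_max_A_aux[OF r(1) lt(1) r(2) lt(2) r(4) True ne(3,4) m] by blast
    next
      case False
      then have "c < a" using ne(1) by simp
      then show ?thesis
        using local_max_A_aux[OF r(3) lt(2) r(4) lt(1) r(2) _ ne(2)[symmetric] ne(4)[symmetric] m']
        by blast
    qed
    then show ?thesis by (auto simp only: \<alpha> \<beta> vee_commute)
  qed
  note H = highest_in_orbit[where Q = "\<lambda>_. True", OF r p o TrueI TrueI max]
  show "is_highest ?\<Gamma> (orbit ?\<Gamma> q) q"
    unfolding q_def by (rule H(1))
  show "two_root_orbits ?\<Gamma> = {orbit ?\<Gamma> q}"
    unfolding two_root_orbits_def q_def using H(3,4) by blast
qed


section \<open>Type D: roots and the canonical basis\<close>

lemma chain_D: "4 \<le> n \<Longrightarrow> eps_chain (DynkinD n) (n - 1)"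
  by (simp add: eps_chain_def)

locale type_D =
  fixes n :: nat
  assumes n: "4 \<le> n"
begin

abbreviation (input) D where "D \<equiv> DynkinD n"

lemma fin_D: "simply_laced_finite D"
  using n by simp

lemmas chain_D_facts = chain_D[OF n]

lemma form_eps_D: "1 \<le> a \<Longrightarrow> a \<le> n \<Longrightarrow> form D (eps a) v = v a"
  using form_eps[OF chain_D_facts] by simp

lemma form_simple_D:
  "1 \<le> i \<Longrightarrow> i < n \<Longrightarrow> form D (simple_root D i) v = v i - v (i + 1)"
  "form D (simple_root D n) v = v (n - 1) + v n"
proof -
  show "form D (simple_root D i) v = v i - v (i + 1)" if "1 \<le> i" "i < n"
    using chain_form_simple[OF chain_D_facts, of i] that by simp
  have "simple_root D n = eps (n - 1) + eps n" by simp
  then show "form D (simple_root D n) v = v (n - 1) + v n"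
    using n by (simp only: form_left) (simp add: form_eps_D del: form.simps)
qed

lemma reflection_D:
  "1 \<le> i \<Longrightarrow> i < n \<Longrightarrow> reflection D i v k = v (swap i k)"
  "reflection D n v k = (if k = n - 1 then - v n else if k = n then - v (n - 1) else v k)"
proof -
  show "reflection D i v k = v (swap i k)" if i: "1 \<le> i" "i < n"
    unfolding reflection_def form_simple_D(1)[OF i]
    using i by (auto simp: eps_apply swap_def)
  show "reflection D n v k = (if k = n - 1 then - v n else if k = n then - v (n - 1) else v k)"
    unfolding reflection_def form_simple_D(2) using n by (auto simp: eps_apply)
qed

lemma minus_root_D:
  assumes "1 \<le> a" "a < b" "b \<le> n"
  shows "eps a - eps b \<in> roots D" "nonneg_comb_simple D (eps a - eps b)"
  using chain_root[OF chain_D_facts assms(1,2)] assms by auto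

lemma minus_nonneg_D:
  assumes "1 \<le> a" "a \<le> b" "b \<le> n"
  shows "nonneg_comb_simple D (eps a - eps b)"
  using minus_root_D(2)[of a b] assms nonneg_comb_zero by (cases "a = b") auto

text \<open>The case \<open>a = b\<close> is needed for the highest root: \<open>\<theta> - (\<epsilon>\<^sub>1 - \<epsilon>\<^sub>2) = 2 \<epsilon>\<^sub>2\<close>.\<close>

lemma plus_nonneg_D:
  assumes "1 \<le> a" "a \<le> n - 1" "1 \<le> b" "b \<le> n"
  shows "nonneg_comb_simple D (eps a + eps b)"
proof -
  have "nonneg_comb_simple D ((eps a - eps (n - 1)) + (eps b - eps n) + simple_root D n)"
    using assms n by (intro nonneg_comb_add minus_nonneg_D nonneg_comb_simple_root) auto
  moreover have "(eps a - eps (n - 1)) + (eps b - eps n) + simple_root D n = eps a + eps b"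
    by (simp add: fun_eq_iff)
  ultimately show ?thesis by (simp only:)
qed

lemma plus_root_D:
  assumes ab: "1 \<le> a" "a < b" "b \<le> n"
  shows "eps a + eps b \<in> roots D"
proof -
  have last: "eps (n - 1) + eps n \<in> roots D"
    using simple_in_roots[of n D] n by simp
  have an: "eps a + eps n \<in> roots D"
  proof (cases "a = n - 1")
    case False
    then have "form D (eps a - eps (n - 1)) (eps (n - 1) + eps n) = - 1"
      using ab n by (simp add: form_left form_eps_D eps_apply del: form.simps)
    then have "(eps a - eps (n - 1)) + (eps (n - 1) + eps n) \<in> roots D"
      using ab n False by (intro root_add[OF fin_D _ last] minus_root_D) auto
    moreover have "(eps a - eps (n - 1)) + (eps (n - 1) + eps n) = eps a + eps n"
      by (simp add: fun_eq_iff)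
    ultimately show ?thesis by (simp only:)
  qed (use last in \<open>simp only:\<close>)
  show ?thesis
  proof (cases "b = n")
    case False
    then have "form D (eps a + eps n) (eps b - eps n) = - 1"
      using ab n by (simp add: form_left form_eps_D eps_apply del: form.simps)
    then have "(eps a + eps n) + (eps b - eps n) \<in> roots D"
      using ab n False by (intro root_add[OF fin_D an] minus_root_D) auto
    moreover have "(eps a + eps n) + (eps b - eps n) = eps a + eps b"
      by (simp add: fun_eq_iff)
    ultimately show ?thesis by (simp only:)
  qed (use an in \<open>simp only:\<close>)
qed

text \<open>Simple reflections permute the vectors \<open>\<plusminus> \<epsilon>\<^sub>k\<close>: they swap two neighbouring indices, and the last one
changes both signs as well.\<close>

lemma roots_D_cases:
  assumes "\<alpha> \<in> roots D"
  obtains a b s t where "1 \<le> a" "a < b" "b \<le> n" "s \<in> {1, - 1}" "t \<in> {1, - 1}"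
    "\<alpha> = smul s (eps a) + smul t (eps b)"
proof -
  have "\<exists>a b s t. a \<in> {1..n} \<and> b \<in> {1..n} \<and> a \<noteq> b \<and> s \<in> {1, - 1} \<and> t \<in> {1, - 1} \<and>
      \<alpha> = smul s (eps a) + smul t (eps b)"
    using assms
  proof (induction rule: roots_induct)
    case (simple i)
    show ?case
    proof (cases "i < n")
      case True
      then show ?thesis
        using simple
        by (intro exI[of _ i] exI[of _ "i + 1"] exI[of _ 1] exI[of _ "- 1"]) (auto simp: fun_eq_iff)
    next
      case False
      then show ?thesis
        using simple n
        by (intro exI[of _ "n - 1"] exI[of _ n] exI[of _ 1] exI[of _ 1]) (auto simp: fun_eq_iff)
    qed
  next
    case (reflect i \<alpha>)
    then obtain a b s t where ab: "a \<in> {1..n}" "b \<in> {1..n}" "a \<noteq> b" "s \<in> {1, - 1}" "t \<in> {1, - 1}"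
      "\<alpha> = smul s (eps a) + smul t (eps b)"
      by blast
    \<comment> \<open>The last simple reflection swaps the indices \<open>n - 1\<close> and \<open>n\<close>, as the one before does.\<close>
    define j where "j = min i (n - 1)"
    have "\<exists>\<sigma>\<in>{1, - 1}. reflection D i (eps k) = smul \<sigma> (eps (swap j k))" for k
    proof (cases "i < n")
      case True
      then show ?thesis
        using reflect(1) by (intro bexI[of _ 1]) (auto simp: fun_eq_iff reflection_D swap_def eps_apply j_def)
    next
      case False
      then have "i = n" using reflect(1) by auto
      then show ?thesis
        using n by (intro bexI[of _ "if k \<in> {n - 1, n} then - 1 else 1"])
          (auto simp: fun_eq_iff reflection_D swap_def eps_apply j_def)
    qed
    then obtain \<sigma> where \<sigma>: "\<sigma> k \<in> {1, - 1}" "reflection D i (eps k) = smul (\<sigma> k) (eps (swap j k))" for k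
      by metis
    have "reflection D i \<alpha> = smul (s * \<sigma> a) (eps (swap j a)) + smul (t * \<sigma> b) (eps (swap j b))"
      unfolding ab(6) reflection_eq root_refl_linear
      by (simp only: reflection_eq[symmetric] \<sigma>(2) smul_smul)
    moreover have "swap j a \<in> {1..n}" "swap j b \<in> {1..n}" "swap j a \<noteq> swap j b"
      using ab reflect(1) n by (auto simp: swap_def j_def)
    moreover have "s * \<sigma> a \<in> {1, - 1}" "t * \<sigma> b \<in> {1, - 1}"
      using ab(4,5) \<sigma>(1)[of a] \<sigma>(1)[of b] by auto
    ultimately show ?case by blast
  qed
  then obtain a b s t where ab: "a \<in> {1..n}" "b \<in> {1..n}" "a \<noteq> b" "s \<in> {1, - 1}" "t \<in> {1, - 1}"
      "\<alpha> = smul s (eps a) + smul t (eps b)"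
    by blast
  show thesis
  proof (cases "a < b")
    case True
    then show ?thesis using that[of a b s t] ab by auto
  next
    case False
    then show ?thesis
      using that[of b a t s] ab by (auto simp: add.commute)
  qed
qed

lemma height_eps_D: "1 \<le> a \<Longrightarrow> a \<le> n \<Longrightarrow> height D (eps a) = real n - real a"
  by (simp add: height_eps)

lemma pos_roots_D_cases:
  assumes "\<alpha> \<in> roots D" "height D \<alpha> > 0"
  obtains a b t where "1 \<le> a" "a < b" "b \<le> n" "t \<in> {1, - 1}" "\<alpha> = eps a + smul t (eps b)"
proof -
  obtain a b s t where ab: "1 \<le> a" "a < b" "b \<le> n" "s \<in> {1, - 1}" "t \<in> {1, - 1}"
    "\<alpha> = smul s (eps a) + smul t (eps b)"
    using roots_D_cases[OF assms(1)] .
  have "s * (real n - real a) + t * (real n - real b) > 0"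
    using assms(2) ab(1-3) by (simp add: ab(6) height_add height_smul height_eps_D)
  then have "s = 1" using ab(2-5) by auto
  then show thesis using that ab by simp
qed

lemma branch_D: "is_branch D (n - 2)"
proof -
  have "neighbours D (n - 2) = {n - 3, n - 1, n}"
    using n by (auto simp: neighbours_def adj_def)
  moreover have "n - 3 \<noteq> n - 1" "n - 3 \<noteq> n" "n - 1 \<noteq> n" using n by auto
  ultimately show ?thesis using n by (simp add: is_branch_def)
qed

lemma n_Suc:
  obtains m where "n = Suc (Suc (Suc (Suc m)))"
  using n by (intro that[of "n - 4"]) simp

lemma adj_D_cases:
  assumes "adj D u v"
  shows "(v = Suc u \<and> v < n) \<or> (u = Suc v \<and> u < n) \<or> (u = n - 2 \<and> v = n) \<or> (v = n - 2 \<and> u = n)"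
  using assms n by (auto simp: adj_def)

lemma rooted_tree_D:
  assumes "1 \<le> c" "c \<le> n - 2"
  shows "rooted_tree D c (\<lambda>v. if v < c then Suc v else if v = n then n - 2 else v - 1)
    (\<lambda>v. if v = n then n - 1 - c else if v < c then c - v else v - c)"
    (is "rooted_tree D c ?p ?d")
proof -
  obtain m where m: "n = Suc (Suc (Suc (Suc m)))" by (rule n_Suc)
  have c: "c \<le> Suc (Suc m)" using assms m by simp
  show ?thesis
    unfolding rooted_tree_def
  proof (intro conjI ballI impI)
    fix u assume u: "u \<in> vertices D" "u \<noteq> c"
    show "?p u \<in> vertices D" using u assms(1) c by (auto simp: m)
    show "adj D u (?p u)" using u assms(1) c by (auto simp: m adj_def)
    show "?d (?p u) < ?d u"
      using u assms(1) c by (cases "u < c"; cases "u = n"; simp add: m; linarith)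
  next
    fix u v assume "u \<in> vertices D" "v \<in> vertices D" "adj D u v"
    from adj_D_cases[OF this(3)]
    show "u \<noteq> c \<and> v = ?p u \<or> v \<noteq> c \<and> u = ?p v"
      using assms(1) c by (elim disjE conjE) (simp_all add: m not_less)
  qed (use assms in simp)
qed

lemma rooted_tree_D_leaf:
  "rooted_tree D (n - 1) (\<lambda>v. if v = n then n - 2 else Suc v) (\<lambda>v. if v = n then 2 else n - 1 - v)"
  "rooted_tree D n (\<lambda>v. if v = n - 1 then n - 2 else if v = n - 2 then n else Suc v)
     (\<lambda>v. if v = n - 1 then 2 else if v = n then 0 else n - 1 - v)"
proof -
  obtain m where m: "n = Suc (Suc (Suc (Suc m)))" by (rule n_Suc)
  show "rooted_tree D (n - 1) (\<lambda>v. if v = n then n - 2 else Suc v)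
      (\<lambda>v. if v = n then 2 else n - 1 - v)"
    unfolding rooted_tree_def
    by (intro conjI ballI impI; simp add: m adj_def; presburger)
  show "rooted_tree D n (\<lambda>v. if v = n - 1 then n - 2 else if v = n - 2 then n else Suc v)
     (\<lambda>v. if v = n - 1 then 2 else if v = n then 0 else n - 1 - v)"
    unfolding rooted_tree_def
    by (intro conjI ballI impI; simp add: m adj_def; presburger)
qed

lemma path_D_ascending:
  assumes "1 \<le> b" "b \<le> c" "c \<le> n - 1"
  shows "path_vertices D b c = {b..c}"
proof -
  have "path_vertices D b c = {b..<c} \<union> path_vertices D c c \<and> path_vertices D c c = {c}"
  proof (cases "c = n - 1")
    case True
    have "path_vertices D b (n - 1) = {b..<n - 1} \<union> path_vertices D (n - 1) (n - 1)"
      by (rule path_vertices_ascending[OF rooted_tree_D_leaf(1)]) (use assms True in auto)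
    then show ?thesis
      using path_vertices_rec(1)[OF rooted_tree_D_leaf(1)] by (simp only: True)
  next
    case False
    then have c: "1 \<le> c" "c \<le> n - 2" using assms by auto
    have "path_vertices D b c = {b..<c} \<union> path_vertices D c c"
      by (rule path_vertices_ascending[OF rooted_tree_D[OF c]]) (use assms in auto)
    then show ?thesis
      using path_vertices_rec(1)[OF rooted_tree_D[OF c]] by (simp only: simp_thms)
  qed
  moreover have "{b..<c} \<union> {c} = {b..c}" using assms(2) by auto
  ultimately show ?thesis by (simp only:)
qed

lemma path_D_last:
  assumes "1 \<le> b" "b \<le> n - 2"
  shows "path_vertices D b n = insert n {b..n - 2}"
proof -
  have parent: "(if n - 2 = n - 1 then n - 2 else if n - 2 = n - 2 then n else Suc (n - 2)) = n"
    using n by simp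
  have v: "n - 2 \<in> vertices D" "n - 2 \<noteq> n" using n by auto
  have "path_vertices D (n - 2) n = {n - 2, n}"
    using path_vertices_rec(2)[OF rooted_tree_D_leaf(2) v]
    by (simp only: parent path_vertices_rec(1)[OF rooted_tree_D_leaf(2)])
  moreover have "path_vertices D b n = {b..<n - 2} \<union> path_vertices D (n - 2) n"
    by (rule path_vertices_ascending[OF rooted_tree_D_leaf(2)]) (use assms n in auto)
  moreover have "{b..<n - 2} \<union> {n - 2, n} = insert n {b..n - 2}" using assms by auto
  ultimately show ?thesis by (simp only:)
qed

lemma path_root_D:
  "1 \<le> b \<Longrightarrow> b \<le> c \<Longrightarrow> c \<le> n - 1 \<Longrightarrow> path_root D b c = eps b - eps (c + 1)"
  "1 \<le> b \<Longrightarrow> b \<le> n - 2 \<Longrightarrow> path_root D b n = eps b + eps n"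
proof -
  show *: "path_root D b c = eps b - eps (c + 1)" if "1 \<le> b" "b \<le> c" "c \<le> n - 1" for b c
    unfolding path_root_def path_D_ascending[OF that]
    by (rule chain_path_sum[OF chain_D_facts that])
  assume b: "1 \<le> b" "b \<le> n - 2"
  have "path_root D b n = simple_root D n + (\<Sum>i=b..n - 2. simple_root D i)"
    unfolding path_root_def path_D_last[OF b] using n by (subst sum.insert) auto
  also have "\<dots> = (eps (n - 1) + eps n) + (eps b - eps (n - 2 + 1))"
    using chain_path_sum[OF chain_D_facts, of b "n - 2"] b n by simp
  also have "\<dots> = eps b + eps n"
    using n by (simp add: fun_eq_iff Suc_diff_Suc numeral_2_eq_2)
  finally show "path_root D b n = eps b + eps n" .
qed

end


context type_D
begin

text \<open>The subdiagram on the vertices \<open>k, \<dots>, n\<close> is of type D, with endpoints \<open>k\<close>, \<open>n - 1\<close> and \<open>n\<close>.\<close>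

lemma neighbours_D_above:
  assumes k: "1 \<le> k" "k \<le> n - 3" "k \<le> j" "j \<le> n"
  shows "card (neighbours D j \<inter> {k..n}) = 1 \<longleftrightarrow> j = k \<or> j = n - 1 \<or> j = n"
proof -
  have mem: "x \<in> neighbours D j \<inter> {k..n} \<longleftrightarrow> k \<le> x \<and> x \<le> n \<and> ((x = Suc j \<and> x < n) \<or>
      (j = Suc x \<and> j < n) \<or> (j = n - 2 \<and> x = n) \<or> (x = n - 2 \<and> j = n))" for x
    using k n by (auto simp: neighbours_def adj_def)
  consider "j = k" | "j = n - 1 \<or> j = n" | "k < j" "j \<le> n - 2" using k by linarith
  then show ?thesis
  proof cases
    case 1
    then have "neighbours D j \<inter> {k..n} = {Suc k}"
      using k by (intro set_eqI) (subst mem, auto)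
    then show ?thesis using 1 by simp
  next
    case 2
    then have "neighbours D j \<inter> {k..n} = {n - 2}"
      using k by (intro set_eqI) (subst mem, auto)
    then show ?thesis using 2 by simp
  next
    case 3
    \<comment> \<open>A vertex in the interior has two neighbours in the subdiagram.\<close>
    define x where "x = (if j = n - 2 then n else Suc j)"
    have x: "x \<noteq> j - 1" "{j - 1, x} \<subseteq> neighbours D j \<inter> {k..n}"
      using 3 k unfolding subset_iff mem x_def by auto
    have "card {j - 1, x} \<le> card (neighbours D j \<inter> {k..n})"
      by (intro card_mono x(2)) simp
    then show ?thesis using x(1) 3 k by auto
  qed
qed

text \<open>Twice the sum of all simple roots from \<open>k\<close> to \<open>n\<close> is \<open>2 \<epsilon>\<^sub>k + 2 \<epsilon>\<^bsub>n-1\<^esub>\<close>; subtracting the three endpoints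
leaves \<open>\<epsilon>\<^sub>k + \<epsilon>\<^bsub>k+1\<^esub>\<close>.\<close>

lemma theta_sub_D:
  assumes "1 \<le> k" "k \<le> n - 3" "theta_support D i (n - 2) = {k..n}"
  shows "theta_sub D i (n - 2) = eps k + eps (k + 1)"
proof -
  have coef: "(if card (neighbours D j \<inter> {k..n}) = 1 then 1 else 2) =
      (2::real) - (if j = k then 1 else 0) - (if j = n - 1 then 1 else 0) - (if j = n then 1 else 0)"
    if "j \<in> {k..n}" for j
    using neighbours_D_above[OF assms(1,2), of j] that assms(1,2) n by auto
  have split: "{k..n} = insert n {k..n - 1}" using assms(1,2) n by auto
  show ?thesis
  proof
    fix l
    have sum: "(\<Sum>j\<in>{k..n}. simple_root D j l) = eps k l + eps (n - 1) l"
    proof -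
      have "(\<Sum>j\<in>{k..n}. simple_root D j) = simple_root D n + (\<Sum>j\<in>{k..n - 1}. simple_root D j)"
        unfolding split using n by (subst sum.insert) auto
      also have "\<dots> = (eps (n - 1) + eps n) + (eps k - eps (n - 1 + 1))"
        using chain_path_sum[OF chain_D_facts, of k "n - 1"] assms(1,2) n by simp
      finally have "(\<Sum>j\<in>{k..n}. simple_root D j) l = ((eps (n - 1) + eps n) + (eps k - eps (n - 1 + 1))) l"
        by (rule fun_cong)
      moreover have "(\<Sum>j\<in>S. f j) l = (\<Sum>j\<in>S. f j l)" for S and f :: "nat \<Rightarrow> vec"
        by (induction S rule: infinite_finite_induct) auto
      ultimately show ?thesis using n by simp
    qed
    have delta: "(\<Sum>j\<in>{k..n}. (if j = m then 1 else 0) * simple_root D j l) = simple_root D m l"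
      if "m \<in> {k..n}" for m
    proof -
      have "(\<Sum>j\<in>{k..n}. (if j = m then 1 else 0) * simple_root D j l) =
          (\<Sum>j\<in>{k..n}. if j = m then simple_root D j l else 0)"
        by (intro sum.cong) auto
      then show ?thesis using that by simp
    qed
    have "theta_sub D i (n - 2) l = (\<Sum>j\<in>{k..n}.
        (2 - (if j = k then 1 else 0) - (if j = n - 1 then 1 else 0) - (if j = n then 1 else 0)) *
        simple_root D j l)"
      unfolding theta_sub_def assms(3) by (intro sum.cong) (simp_all only: coef)
    also have "\<dots> = 2 * (eps k l + eps (n - 1) l) - simple_root D k l - simple_root D (n - 1) l -
        simple_root D n l"
      unfolding left_diff_distrib sum_subtractf using assms(1,2) n
      by (simp only: delta sum_distrib_left[symmetric] sum atLeastAtMost_iff) (simp add: delta del: simple_root.simps)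
    also have "\<dots> = (eps k + eps (k + 1)) l"
    proof -
      have "k < n" "n - 1 < n" "n - 1 + 1 = n" using assms(1,2) n by auto
      then show ?thesis by simp
    qed
    finally show "theta_sub D i (n - 2) l = (eps k + eps (k + 1)) l" .
  qed
qed

lemma vee_ncone_add:
  assumes "v \<or>\<^sub>2 x \<in> ncone \<Gamma>" "v \<or>\<^sub>2 y \<in> ncone \<Gamma>" "x + y = z"
  shows "v \<or>\<^sub>2 z \<in> ncone \<Gamma>"
  using ncone_add[OF assms(1,2)] assms(3) by (simp only: vee_linear(4)[symmetric])

lemma simple_D_last: "simple_root D n = eps (n - 1) + eps n"
  by simp

text \<open>For \<open>i = n - 1\<close> and \<open>i = n\<close> the subdiagram is the \<open>D\<^sub>4\<close> at the end, which starts at \<open>n - 3\<close>.\<close>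

lemma vee_theta_D:
  assumes i: "i \<in> vertices D" "i \<noteq> n - 2"
  shows "simple_root D i \<or>\<^sub>2 (eps (min i (n - 3)) + eps (min i (n - 3) + 1)) \<in> ncone D"
proof -
  let ?k = "min i (n - 3)"
  have "neighbours D (n - 2) = {n - 3, n - 1, n}"
    using n by (auto simp: neighbours_def adj_def)
  moreover have "path_vertices D i (n - 2) = (if i < n - 2 then {i..n - 2} else {i, n - 2})"
  proof (cases "i < n - 2")
    case True
    then show ?thesis using path_D_ascending[of i "n - 2"] i by simp
  next
    case False
    have c: "1 \<le> n - 2" "n - 2 \<le> n - 2" using n by auto
    have "(if i < n - 2 then Suc i else if i = n then n - 2 else i - 1) = n - 2"
      using False i by auto
    then show ?thesis
      using False path_vertices_rec[OF rooted_tree_D[OF c]] i by simp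
  qed
  ultimately have "theta_support D i (n - 2) = {?k..n}"
    unfolding theta_support_def using i n by auto
  then have \<theta>: "theta_sub D i (n - 2) = eps ?k + eps (?k + 1)"
    using i n by (intro theta_sub_D) auto
  have "simple_root D i \<or>\<^sub>2 theta_sub D i (n - 2) \<in> ncone D"
  proof (rule vee_theta_sub[OF i(1) branch_D i(2)])
    show "theta_sub D i (n - 2) \<in> roots D"
      unfolding \<theta> using i n by (intro plus_root_D) auto
    show "nonneg_comb_simple D (theta_sub D i (n - 2))"
      unfolding \<theta> using i n by (intro plus_nonneg_D) auto
  qed
  then show ?thesis by (simp only: \<theta>)
qed

text \<open>The root \<open>\<epsilon>\<^sub>i + \<epsilon>\<^bsub>i+1\<^esub>\<close> is elementary for \<open>\<alpha>\<^sub>i\<close>, and each of the three kinds of elementary roots occurs: it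
is \<open>\<theta>\<^sub>i\<close> before the branch vertex, a sum along a path at the branch vertex, and \<open>\<alpha>\<^sub>n\<close> for \<open>i = n - 1\<close>.\<close>

lemma vee_plus_D_same:
  assumes i: "1 \<le> i" "i < n"
  shows "simple_root D i \<or>\<^sub>2 (eps i + eps (i + 1)) \<in> ncone D"
proof -
  consider "i < n - 2" | "i = n - 2" | "i = n - 1" using i by linarith
  then show ?thesis
  proof cases
    case 1
    then have "min i (n - 3) = i" by auto
    then show ?thesis using vee_theta_D[of i] 1 i by simp
  next
    case 2
    have sum: "simple_root D (n - 1) + simple_root D i + simple_root D n = eps i + eps (i + 1)"
    proof -
      have "n = i + 2" using 2 n by simp
      then show ?thesis by (simp add: fun_eq_iff)
    qed
    have "simple_root D i \<or>\<^sub>2 (simple_root D (n - 1) + simple_root D i + simple_root D n) \<in> ncone D"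
    proof (rule vee_path_sum)
      show "simple_root D (n - 1) + simple_root D i + simple_root D n \<in> roots D"
        unfolding sum using i by (intro plus_root_D) auto
    qed (use 2 n in \<open>auto simp: adj_def\<close>)
    then show ?thesis by (simp only: sum)
  next
    case 3
    have "simple_root D i \<or>\<^sub>2 simple_root D n \<in> ncone D"
      by (rule vee_simple_orthogonal) (use 3 n in \<open>auto simp: adj_def\<close>)
    then show ?thesis using 3 i by (simp del: simple_root.simps add: simple_D_last)
  qed
qed

text \<open>The roots \<open>\<plusminus> \<epsilon>\<^sub>a \<plusminus> \<epsilon>\<^sub>b\<close> with \<open>a\<close>, \<open>b\<close> different from \<open>i\<close> and \<open>i + 1\<close> form a system of type \<open>D\<^bsub>n-2\<^esub>\<close>; its
last simple root is \<open>\<epsilon>\<^sub>p + \<epsilon>\<^sub>r\<close> for the two largest remaining indices \<open>p < r\<close>, and it is elementary.\<close>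

lemma vee_plus_D_extreme:
  assumes i: "1 \<le> i" "i < n"
  obtains p r where "1 \<le> p" "p < r" "r \<le> n" "p \<notin> {i, i + 1}" "r \<notin> {i, i + 1}"
    "\<And>a b. a < b \<Longrightarrow> b \<le> n \<Longrightarrow> a \<notin> {i, i + 1} \<Longrightarrow> b \<notin> {i, i + 1} \<Longrightarrow> a \<le> p \<and> b \<le> r"
    "simple_root D i \<or>\<^sub>2 (eps p + eps r) \<in> ncone D"
proof -
  consider "i < n - 2" | "i = n - 2" | "i = n - 1" using i by linarith
  then show thesis
  proof cases
    case 1
    have "simple_root D i \<or>\<^sub>2 simple_root D n \<in> ncone D"
      by (rule vee_simple_orthogonal) (use 1 i n in \<open>auto simp: adj_def\<close>)
    then have e: "simple_root D i \<or>\<^sub>2 (eps (n - 1) + eps n) \<in> ncone D"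
      by (simp only: simple_D_last)
    show thesis by (rule that[OF _ _ _ _ _ _ e]) (use 1 n in auto)
  next
    case 2
    have sum: "simple_root D (n - 3) + simple_root D i + simple_root D n = eps (n - 3) + eps n"
    proof -
      obtain k where "n = k + 3" by (intro that[of "n - 3"]) (use n in simp)
      then show ?thesis using 2 by (simp add: fun_eq_iff)
    qed
    have "simple_root D i \<or>\<^sub>2 (simple_root D (n - 3) + simple_root D i + simple_root D n) \<in> ncone D"
    proof (rule vee_path_sum)
      show "simple_root D (n - 3) + simple_root D i + simple_root D n \<in> roots D"
        unfolding sum using n by (intro plus_root_D) auto
    qed (use 2 n in \<open>auto simp: adj_def\<close>)
    then have e: "simple_root D i \<or>\<^sub>2 (eps (n - 3) + eps n) \<in> ncone D" by (simp only: sum)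
    show thesis by (rule that[OF _ _ _ _ _ _ e]) (use 2 n in auto)
  next
    case 3
    have "min i (n - 3) = n - 3" "n - 3 + 1 = n - 2" using 3 n by auto
    then have e: "simple_root D i \<or>\<^sub>2 (eps (n - 3) + eps (n - 2)) \<in> ncone D"
      using vee_theta_D[of i] 3 n by simp
    show thesis by (rule that[OF _ _ _ _ _ _ e]) (use 3 n in auto)
  qed
qed

text \<open>For \<open>i < n\<close> a positive root orthogonal to \<open>\<alpha>\<^sub>i\<close> is \<open>\<epsilon>\<^sub>i + \<epsilon>\<^bsub>i+1\<^esub>\<close>, or it avoids the indices \<open>i\<close> and
\<open>i + 1\<close>.  In the latter case it is a telescoping difference, or
\<open>\<epsilon>\<^sub>a + \<epsilon>\<^sub>b = (\<epsilon>\<^sub>a - \<epsilon>\<^sub>p) + (\<epsilon>\<^sub>b - \<epsilon>\<^sub>r) + (\<epsilon>\<^sub>p + \<epsilon>\<^sub>r)\<close> with the extreme indices \<open>p < r\<close>.  The case \<open>i = n\<close> is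
analogous, with the indices \<open>n - 1\<close> and \<open>n\<close> left out and \<open>\<epsilon>\<^bsub>n-1\<^esub> - \<epsilon>\<^sub>n\<close> as the exceptional root.\<close>

lemma simple_vee_ncone_D:
  assumes \<alpha>: "\<alpha> \<in> roots D" "height D \<alpha> > 0" and i: "i \<in> vertices D"
    and o: "form D (simple_root D i) \<alpha> = 0"
  shows "simple_root D i \<or>\<^sub>2 \<alpha> \<in> ncone D"
proof -
  obtain a b t where ab: "1 \<le> a" "a < b" "b \<le> n" "t \<in> {1, - 1}" "\<alpha> = eps a + smul t (eps b)"
    using pos_roots_D_cases[OF \<alpha>] .
  have \<alpha>_cases: "\<alpha> = eps a + eps b \<and> t = 1 \<or> \<alpha> = eps a - eps b \<and> t = - 1"
    using ab(4,5) by (auto simp: fun_eq_iff)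
  show ?thesis
  proof (cases "i < n")
    case True
    then have i: "1 \<le> i" "i < n" using i by auto
    have minus: "simple_root D i \<or>\<^sub>2 (eps c - eps d) \<in> ncone D"
      if "1 \<le> c" "c \<le> d" "d \<le> n" "c \<notin> {i, i + 1}" "d \<notin> {i, i + 1}" for c d
    proof (cases "c = d")
      case True
      then have "simple_root D i \<or>\<^sub>2 (eps c - eps d) = 0" by (simp add: vee_def fun_eq_iff)
      then show ?thesis using ncone_zero by (simp only:)
    next
      case False
      show ?thesis
        by (rule chain_vee_ncone[OF chain_D_facts]) (use that False i in auto)
    qed
    have c: "a = i \<and> b = i + 1 \<and> t = 1 \<or> a \<notin> {i, i + 1} \<and> b \<notin> {i, i + 1}"
      using o ab(1-4) unfolding form_simple_D(1)[OF i] ab(5)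
      by (auto simp: eps_apply split: if_splits)
    show ?thesis
    proof (cases "a = i")
      case True
      then have "\<alpha> = eps i + eps (i + 1)" using c \<alpha>_cases by auto
      then show ?thesis using vee_plus_D_same[OF i] by (simp only:)
    next
      case False
      then have out: "a \<notin> {i, i + 1}" "b \<notin> {i, i + 1}" using c by auto
      show ?thesis
      proof (cases "t = 1")
        case True
        obtain p r where pr: "1 \<le> p" "p < r" "r \<le> n" "p \<notin> {i, i + 1}" "r \<notin> {i, i + 1}"
          "a \<le> p \<and> b \<le> r" and e: "simple_root D i \<or>\<^sub>2 (eps p + eps r) \<in> ncone D"
          using vee_plus_D_extreme[OF i] ab(2,3) out by metis
        have "simple_root D i \<or>\<^sub>2 (eps a - eps p) \<in> ncone D"
          "simple_root D i \<or>\<^sub>2 (eps b - eps r) \<in> ncone D"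
          by (rule minus; use ab pr out in auto)+
        then have "simple_root D i \<or>\<^sub>2 ((eps a - eps p) + (eps b - eps r)) \<in> ncone D"
          by (rule vee_ncone_add) (rule refl)
        moreover have "((eps a - eps p) + (eps b - eps r)) + (eps p + eps r) = \<alpha>"
          using \<alpha>_cases True by (auto simp: fun_eq_iff)
        ultimately show ?thesis by (rule vee_ncone_add[OF _ e])
      next
        case False
        then have "\<alpha> = eps a - eps b" using \<alpha>_cases by blast
        then show ?thesis using minus[of a b] ab out by simp
      qed
    qed
  next
    case False
    then have i: "i = n" using i by auto
    have minus: "simple_root D n \<or>\<^sub>2 (eps c - eps d) \<in> ncone D"
      if "1 \<le> c" "c \<le> d" "d \<le> n - 2" for c d
      using that(2,1,3)
    proof (induction c rule: inc_induct)
      case base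
      then have "simple_root D n \<or>\<^sub>2 (eps d - eps d) = 0" by (simp add: vee_def fun_eq_iff)
      then show ?case using ncone_zero by (simp only:)
    next
      case (step c)
      have "simple_root D n \<or>\<^sub>2 simple_root D c \<in> ncone D"
        by (rule vee_simple_orthogonal) (use step n in \<open>auto simp: adj_def\<close>)
      moreover have "simple_root D n \<or>\<^sub>2 (eps (Suc c) - eps d) \<in> ncone D"
        by (rule step.IH) (use step in auto)
      moreover have "simple_root D c + (eps (Suc c) - eps d) = eps c - eps d"
      proof -
        have "c < n" using step.hyps(2) step.prems by linarith
        then show ?thesis by (simp add: fun_eq_iff)
      qed
      ultimately show ?case by (rule vee_ncone_add)
    qed
    have c: "a = n - 1 \<and> b = n \<and> t = - 1 \<or> b \<le> n - 2"
      using o ab(1-4) unfolding i form_simple_D(2) ab(5)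
      by (auto simp: eps_apply split: if_splits)
    show ?thesis
    proof (cases "b \<le> n - 2")
      case False
      have "simple_root D n \<or>\<^sub>2 simple_root D (n - 1) \<in> ncone D"
        by (rule vee_simple_orthogonal) (use n in \<open>auto simp: adj_def\<close>)
      moreover have "simple_root D (n - 1) = \<alpha>" using c False \<alpha>_cases n by auto
      ultimately show ?thesis by (simp only: i)
    next
      case True
      show ?thesis
      proof (cases "t = 1")
        case t: True
        have "min n (n - 3) = n - 3" "n - 3 + 1 = n - 2" using n by auto
        then have e: "simple_root D n \<or>\<^sub>2 (eps (n - 3) + eps (n - 2)) \<in> ncone D"
          using vee_theta_D[of n] n by simp
        have "simple_root D n \<or>\<^sub>2 (eps a - eps (n - 3)) \<in> ncone D"
          "simple_root D n \<or>\<^sub>2 (eps b - eps (n - 2)) \<in> ncone D"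
          by (rule minus; use ab True in auto)+
        then have "simple_root D n \<or>\<^sub>2 ((eps a - eps (n - 3)) + (eps b - eps (n - 2))) \<in> ncone D"
          by (rule vee_ncone_add) (rule refl)
        moreover have "((eps a - eps (n - 3)) + (eps b - eps (n - 2))) + (eps (n - 3) + eps (n - 2)) = \<alpha>"
          using \<alpha>_cases t by (auto simp: fun_eq_iff)
        ultimately show ?thesis unfolding i by (rule vee_ncone_add[OF _ e])
      next
        case False
        then have "\<alpha> = eps a - eps b" using \<alpha>_cases by blast
        then show ?thesis using minus[of a b] ab True i by simp
      qed
    qed
  qed
qed

lemma two_root_system_D: "two_root_system D"
proof
  show "simply_laced_finite D" by (rule fin_D)
  show "\<exists>M. \<forall>\<alpha>\<in>roots D. height D \<alpha> \<le> M"
  proof (intro exI ballI)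
    fix \<alpha> assume "\<alpha> \<in> roots D"
    then obtain a b s t where "1 \<le> a" "a < b" "b \<le> n" "s \<in> {1, - 1}" "t \<in> {1, - 1}"
      "\<alpha> = smul s (eps a) + smul t (eps b)"
      by (rule roots_D_cases)
    then show "height D \<alpha> \<le> 2 * real n"
      by (auto simp: height_add height_smul height_minus height_eps_D)
  qed
  show "nonneg_comb_simple D \<alpha> \<or> nonneg_comb_simple D (- \<alpha>)" if "\<alpha> \<in> roots D" for \<alpha>
    using that
  proof (rule roots_D_cases)
    fix a b s t
    assume ab: "1 \<le> a" "a < b" "b \<le> n" "s \<in> {1, - 1}" "t \<in> {1, - 1 :: real}"
      "\<alpha> = smul s (eps a) + smul t (eps b)"
    have "nonneg_comb_simple D (eps a - eps b)" "nonneg_comb_simple D (eps a + eps b)"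
      using ab by (auto intro: minus_nonneg_D plus_nonneg_D)
    moreover have "\<alpha> \<in> {eps a - eps b, eps a + eps b} \<or> - \<alpha> \<in> {eps a - eps b, eps a + eps b}"
      using ab(4,5) unfolding ab(6) by (auto simp: fun_eq_iff)
    ultimately show ?thesis by (elim disjE insertE emptyE) (simp_all only: simp_thms)
  qed
  show "form D (simple_root D i) \<alpha> \<in> {- 1, 0, 1} \<or> \<alpha> = simple_root D i \<or> \<alpha> = - simple_root D i"
    if r: "\<alpha> \<in> roots D" "i \<in> vertices D" for \<alpha> i
    using r(1)
  proof (rule roots_D_cases)
    fix a b s t
    assume ab: "1 \<le> a" "a < b" "b \<le> n" "s \<in> {1, - 1}" "t \<in> {1, - 1 :: real}"
      "\<alpha> = smul s (eps a) + smul t (eps b)"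
    show ?thesis
    proof (cases "i < n")
      case True
      then have i: "1 \<le> i" "i < n" using r(2) by auto
      show ?thesis
      proof (cases "a = i \<and> b = i + 1")
        case True
        then show ?thesis
          using ab(4,5) i unfolding form_simple_D(1)[OF i] ab(6)
          by (auto simp: fun_eq_iff eps_apply)
      next
        case False
        then show ?thesis
          using ab(2,4,5) unfolding form_simple_D(1)[OF i] ab(6) by (auto simp: eps_apply)
      qed
    next
      case False
      then have i: "i = n" using r(2) by auto
      show ?thesis
      proof (cases "a = n - 1 \<and> b = n")
        case True
        then show ?thesis
          using ab(4,5) n unfolding i form_simple_D(2) ab(6)
          by (auto simp: fun_eq_iff eps_apply)
      next
        case False
        then show ?thesis
          using ab(2-5) unfolding i form_simple_D(2) ab(6) by (auto simp: eps_apply)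
      qed
    qed
  qed
  show "simple_root D i \<or>\<^sub>2 \<alpha> \<in> ncone D"
    if "\<alpha> \<in> roots D" "0 < height D \<alpha>" "i \<in> vertices D" "form D (simple_root D i) \<alpha> = 0" for \<alpha> i
    using simple_vee_ncone_D that by blast
qed

end

sublocale type_D \<subseteq> two_root_system "DynkinD n"
  by (rule two_root_system_D)

context type_D
begin

lemma highest_root_D: "highest_root D = eps 1 + eps 2"
proof (rule highest_rootI)
  show "eps 1 + eps 2 \<in> roots D" using n by (intro plus_root_D) auto
  fix \<beta> assume "\<beta> \<in> roots D"
  then obtain a b s t where ab: "1 \<le> a" "a < b" "b \<le> n" "s \<in> {1, - 1}" "t \<in> {1, - 1 :: real}"
    and \<beta>: "\<beta> = smul s (eps a) + smul t (eps b)"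
    by (rule roots_D_cases)
  have 1: "nonneg_comb_simple D (eps 1 + smul r (eps a))" if "r \<in> {1, - 1}" for r
  proof -
    have "nonneg_comb_simple D (eps a + eps 1)" "nonneg_comb_simple D (eps 1 - eps a)"
      using ab n by (auto intro: plus_nonneg_D minus_nonneg_D)
    moreover have "eps 1 + smul r (eps a) \<in> {eps a + eps 1, eps 1 - eps a}"
      using that by (auto simp: fun_eq_iff)
    ultimately show ?thesis by (elim insertE emptyE) (simp_all only:)
  qed
  have 2: "nonneg_comb_simple D (eps 2 + smul r (eps b))" if "r \<in> {1, - 1}" for r
  proof -
    have "nonneg_comb_simple D (eps 2 + eps b)" "nonneg_comb_simple D (eps 2 - eps b)"
      using ab n by (auto intro!: plus_nonneg_D minus_nonneg_D)
    moreover have "eps 2 + smul r (eps b) \<in> {eps 2 + eps b, eps 2 - eps b}"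
      using that by (auto simp: fun_eq_iff)
    ultimately show ?thesis by (elim insertE emptyE) (simp_all only:)
  qed
  have "nonneg_comb_simple D ((eps 1 + smul (- s) (eps a)) + (eps 2 + smul (- t) (eps b)))"
    by (intro nonneg_comb_add 1 2) (use ab in auto)
  moreover have "(eps 1 + smul (- s) (eps a)) + (eps 2 + smul (- t) (eps b)) = eps 1 + eps 2 - \<beta>"
    by (simp add: \<beta> fun_eq_iff)
  ultimately show "nonneg_comb_simple D (eps 1 + eps 2 - \<beta>)" by (simp only:)
qed

end


section \<open>Type D: the highest 2-roots\<close>

context type_D
begin

text \<open>Orthogonal roots have the same two indices and opposite relative sign, or no common index.\<close>

lemma orthogonal_pos_pair_D:
  assumes \<alpha>: "\<alpha> \<in> roots D" "height D \<alpha> > 0" and \<beta>: "\<beta> \<in> roots D" "height D \<beta> > 0"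
    and o: "form D \<alpha> \<beta> = 0"
  obtains (small) a b t where "1 \<le> a" "a < b" "b \<le> n" "t \<in> {1, - 1}"
      "\<alpha> = eps a + smul t (eps b)" "\<beta> = eps a + smul (- t) (eps b)"
    | (large) a b c d s t where "1 \<le> a" "a < b" "b \<le> n" "1 \<le> c" "c < d" "d \<le> n"
      "a \<noteq> c" "a \<noteq> d" "b \<noteq> c" "b \<noteq> d" "s \<in> {1, - 1}" "t \<in> {1, - 1}"
      "\<alpha> = eps a + smul s (eps b)" "\<beta> = eps c + smul t (eps d)"
proof -
  obtain a b s where ab: "1 \<le> a" "a < b" "b \<le> n" "s \<in> {1, - 1}" "\<alpha> = eps a + smul s (eps b)"
    using pos_roots_D_cases[OF \<alpha>] .
  obtain c d t where cd: "1 \<le> c" "c < d" "d \<le> n" "t \<in> {1, - 1}" "\<beta> = eps c + smul t (eps d)"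
    using pos_roots_D_cases[OF \<beta>] .
  have "form D \<alpha> \<beta> = \<beta> a + s * \<beta> b"
    using ab by (simp add: form_left form_eps_D del: form.simps)
  then have eq: "\<beta> a + s * \<beta> b = 0" using o by simp
  show thesis
  proof (cases "a = c \<and> b = d")
    case True
    then have "t = - s" using eq ab cd by (auto simp: eps_apply)
    then show thesis using small[of a b s] ab cd True by simp
  next
    case False
    have "a \<noteq> c" "a \<noteq> d" "b \<noteq> c" "b \<noteq> d"
      using eq ab(2,4) cd(2,4) False unfolding cd(5) by (auto simp: eps_apply split: if_splits)
    then show thesis using large[of a b c d s t] ab cd by simp
  qed
qed

lemma vee_diagonal: "(u \<or>\<^sub>2 v) k k = 2 * (u k * v k)"
  by (simp add: vee_def)

text \<open>The sum is \<open>2 \<epsilon>\<^sub>a\<close>, which is dominant only for \<open>a = 1\<close>.  The product of the heights of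
\<open>\<epsilon>\<^sub>1 - \<epsilon>\<^sub>b\<close> and \<open>\<epsilon>\<^sub>1 + \<epsilon>\<^sub>b\<close> is \<open>(b - 1) (2 n - 1 - b)\<close>, which increases with \<open>b\<close> up to \<open>b = n\<close>.\<close>

lemma local_max_small_D:
  assumes ab: "1 \<le> a" "a < b" "b \<le> n"
    and \<alpha>\<beta>: "\<alpha> = eps a - eps b" "\<beta> = eps a + eps b"
    and dom: "\<And>i. 1 \<le> i \<Longrightarrow> i < n \<Longrightarrow> (\<alpha> + \<beta>) (i + 1) \<le> (\<alpha> + \<beta>) i"
    and max: "\<And>i. 1 \<le> i \<Longrightarrow> i < n \<Longrightarrow>
      (real b - real a - (\<alpha> i - \<alpha> (i + 1))) * (2 * real n - real a - real b - (\<beta> i - \<beta> (i + 1)))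
      \<le> (real b - real a) * (2 * real n - real a - real b)"
  shows "a = 1 \<and> b = n"
proof -
  have a: "a = 1"
  proof (rule ccontr)
    assume "a \<noteq> 1"
    then have "1 < a" using ab(1) by linarith
    then obtain i where i: "a = i + 1" "1 \<le> i" by (intro that[of "a - 1"]) auto
    then show False using dom[of i] ab by (simp add: \<alpha>\<beta> eps_apply)
  qed
  have "b = n"
  proof (rule ccontr)
    assume "b \<noteq> n"
    then have b: "b < n" "b \<noteq> a" "b + 1 \<noteq> a" "1 \<le> b" using ab by auto
    have "(real b - real a + 1) * (2 * real n - real a - real b - 1) \<le>
        (real b - real a) * (2 * real n - real a - real b)"
      using max[OF b(4,1)] b by (simp add: \<alpha>\<beta> eps_apply)
    then show False using b(1) by (simp add: algebra_simps)
  qed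
  then show ?thesis using a by blast
qed

text \<open>\<open>\<delta>\<close> has four nonzero entries \<open>\<plusminus> 1\<close> and is decreasing.  Without a negative entry the four indices are
therefore the first ones.  A negative entry forces \<open>\<delta> n = - 1\<close>, hence \<open>\<delta> (n - 1) \<ge> 1\<close>, so all entries are nonzero and
\<open>n = 4\<close>.\<close>

lemma dominant_support_D:
  fixes s t :: real
  assumes ab: "1 \<le> a" "a < b" "b \<le> n" "1 \<le> c" "c < d" "d \<le> n" "a \<noteq> c" "a \<noteq> d" "b \<noteq> c" "b \<noteq> d"
    and st: "s \<in> {1, - 1}" "t \<in> {1, - 1}"
    and \<delta>: "\<delta> = eps a + smul s (eps b) + (eps c + smul t (eps d))"
    and dom: "\<And>i. 1 \<le> i \<Longrightarrow> i < n \<Longrightarrow> \<delta> (i + 1) \<le> \<delta> i"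
    and last: "0 \<le> \<delta> (n - 1) + \<delta> n"
  shows "{a, b, c, d} = {1, 2, 3, 4} \<and> (s = 1 \<and> t = 1 \<or>
    n = 4 \<and> (s = 1 \<and> t = - 1 \<and> d = 4 \<or> s = - 1 \<and> t = 1 \<and> b = 4))"
proof -
  let ?S = "{a, b, c, d}"
  have card: "card ?S = 4" using ab by simp
  have anti: "\<delta> j \<le> \<delta> i" if "1 \<le> i" "i \<le> j" "j \<le> n" for i j
    using that(2,3)
  proof (induction j rule: dec_induct)
    case (step j)
    then show ?case using dom[of j] that(1) by simp
  qed simp
  have \<delta>1: "x \<in> ?S" if "\<delta> x \<ge> 1" for x
    using that by (auto simp: \<delta> eps_apply split: if_splits)
  have \<delta>b: "\<delta> b = s" "\<delta> d = t" "\<delta> a = 1" "\<delta> c = 1" using ab by (auto simp: \<delta> eps_apply)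
  have four: "?S = {1, 2, 3, 4}" if "?S \<subseteq> {1..4}"
  proof -
    have "?S = {1..4}" using card_subset_eq[of "{1..4}" ?S] that card by simp
    also have "\<dots> = {1, 2, 3, 4}" by auto
    finally show ?thesis .
  qed
  show ?thesis
  proof (cases "s = 1 \<and> t = 1")
    case True
    have "x \<le> 4" if "x \<in> ?S" for x
    proof -
      have "\<delta> x = 1" "x \<le> n" using that True \<delta>b ab by auto
      then have "{1..x} \<subseteq> ?S" using anti[of _ x] by (intro subsetI \<delta>1) simp
      then have "card {1..x} \<le> card ?S" by (intro card_mono) auto
      then show ?thesis using card by simp
    qed
    then have "?S \<subseteq> {1..4}" using ab by auto
    then show ?thesis using four True by blast
  next
    case False
    then have "\<delta> n \<le> - 1"
      using anti[of b n] anti[of d n] ab st \<delta>b by auto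
    then have pos: "\<delta> k \<ge> 1" if "1 \<le> k" "k \<le> n - 1" for k
      using anti[of k "n - 1"] that last by simp
    have "{1..n - 1} \<subseteq> ?S - {n}"
    proof
      fix x assume x: "x \<in> {1..n - 1}"
      then have "x \<in> ?S" using pos by (intro \<delta>1) simp
      moreover have "x \<noteq> n" using x n by auto
      ultimately show "x \<in> ?S - {n}" by blast
    qed
    moreover have "n \<in> ?S"
    proof -
      have "\<delta> n \<noteq> 0" using \<open>\<delta> n \<le> - 1\<close> by simp
      then show ?thesis by (auto simp: \<delta> eps_apply split: if_splits)
    qed
    ultimately have "card {1..n - 1} \<le> 3"
      using card card_mono[of "?S - {n}" "{1..n - 1}"] by (simp add: card_Diff_singleton)
    then have n4: "n = 4" using n by simp
    then have "?S \<subseteq> {1..4}" using ab by auto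
    then have S: "?S = {1, 2, 3, 4}" by (rule four)
    have b: "b = 4" if "s = - 1"
      using pos[of b] that \<delta>b(1) ab(1-3) n4 by force
    have d: "d = 4" if "t = - 1"
      using pos[of d] that \<delta>b(2) ab(4-6) n4 by force
    show ?thesis using S b d ab(10) st False n4 by auto
  qed
qed

lemma four_indices:
  fixes a b c d :: nat
  assumes ab: "a < b" "c < d" "a < c" "{a, b, c, d} = {1, 2, 3, 4}"
  obtains "a = 1" "b = 2" "c = 3" "d = 4" | "a = 1" "b = 3" "c = 2" "d = 4"
    | "a = 1" "b = 4" "c = 2" "d = 3"
proof -
  have "0 \<notin> {a, b, c, d}" and mem: "1 \<in> {a, b, c, d}" "2 \<in> {a, b, c, d}" "3 \<in> {a, b, c, d}" "4 \<in> {a, b, c, d}"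
    unfolding ab(4) by simp_all
  then have a: "a = 1" using ab(1-3) by auto
  have "b = 2 \<and> c = 3 \<and> d = 4 \<or> b = 3 \<and> c = 2 \<and> d = 4 \<or> b = 4 \<and> c = 2 \<and> d = 3"
    using mem(2-4) ab(2) unfolding a by auto
  then show thesis using that a by blast
qed

text \<open>Of the three ways to split \<open>{1, 2, 3, 4}\<close> into two pairs, the splittings \<open>{1, 2}, {3, 4}\<close> and
\<open>{1, 3}, {2, 4}\<close> are improved by a swap that balances the two heights.\<close>

lemma local_max_large_D:
  fixes s t :: real
  assumes ab: "a < b" "c < d" "a < c" "{a, b, c, d} = {1, 2, 3, 4}"
    and st: "s = 1 \<and> t = 1 \<or> n = 4 \<and> (s = 1 \<and> t = - 1 \<and> d = 4 \<or> s = - 1 \<and> t = 1 \<and> b = 4)"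
    and \<alpha>\<beta>: "\<alpha> = eps a + smul s (eps b)" "\<beta> = eps c + smul t (eps d)"
    and max: "\<And>i. 1 \<le> i \<Longrightarrow> i < n \<Longrightarrow>
      (height D \<alpha> - (\<alpha> i - \<alpha> (i + 1))) * (height D \<beta> - (\<beta> i - \<beta> (i + 1)))
      \<le> height D \<alpha> * height D \<beta>"
  shows "a = 1 \<and> b = 4 \<and> c = 2 \<and> d = 3 \<and> t = 1"
  using ab
proof (cases rule: four_indices)
    case 1
    then show ?thesis
      using max[of 2] st n by (auto simp: \<alpha>\<beta> height_add height_smul height_minus height_eps_D eps_apply algebra_simps)
  next
    case 2
    then show ?thesis
      using max[of 3] max[of 1] st n by (auto simp: \<alpha>\<beta> height_add height_smul height_minus height_eps_D eps_apply algebra_simps)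
  next
    case 3
    then show ?thesis using st by auto
qed

text \<open>A simple reflection acts on coordinates by a permutation with signs, and a diagonal entry
contains each sign twice.\<close>

lemma diagonal_reflection:
  assumes "i \<in> vertices D"
  shows "(reflection D i u \<or>\<^sub>2 reflection D i v) k k =
    (u \<or>\<^sub>2 v) (swap (min i (n - 1)) k) (swap (min i (n - 1)) k)"
proof (cases "i < n")
  case True
  then have "1 \<le> i" "min i (n - 1) = i" using assms by auto
  then show ?thesis using True by (simp only: vee_diagonal reflection_D(1))
next
  case False
  then have "i = n" "min i (n - 1) = n - 1" using assms by auto
  then show ?thesis
    using n by (simp only: vee_diagonal reflection_D(2)) (auto simp: swap_def)
qed

lemma swap_swap: "swap i (swap i k) = k"
  by (simp add: swap_def)

lemma diagonal_zero_reflection: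
  assumes "i \<in> vertices D"
  shows "(\<forall>k. (reflection D i u \<or>\<^sub>2 reflection D i v) k k = 0) \<longleftrightarrow> (\<forall>k. (u \<or>\<^sub>2 v) k k = 0)"
  unfolding diagonal_reflection[OF assms] using swap_swap by metis

text \<open>For a 2-root of type \<open>D\<^sub>4\<close> with zero diagonal this is twice the product of the signs of the four
coordinates, so it is invariant under permutations and even sign changes, and it separates the
two orbits with zero diagonal.\<close>

definition hafnian :: "tensor \<Rightarrow> real" where
  "hafnian t = t 1 2 * t 3 4 + t 1 3 * t 2 4 + t 1 4 * t 2 3"

lemma hafnian_minus: "hafnian (- t) = hafnian t"
  by (simp add: hafnian_def)

lemma hafnian_reflection:
  assumes "n = 4" "i \<in> vertices D"
  shows "hafnian (reflection D i u \<or>\<^sub>2 reflection D i v) = hafnian (u \<or>\<^sub>2 v)"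
proof -
  have "i = 1 \<or> i = 2 \<or> i = 3 \<or> i = n" using assms by auto
  then show ?thesis
    using assms(1) reflection_D(1)[of i] reflection_D(2)
    by (elim disjE) (simp_all add: hafnian_def vee_def swap_def eval_nat_numeral algebra_simps)
qed

lemma hafnian_pair:
  fixes s t :: real
  assumes "a < b" "c < d" "a \<noteq> c" "{a, b, c, d} = {1, 2, 3, 4}"
  shows "hafnian ((eps a + smul s (eps b)) \<or>\<^sub>2 (eps c + smul t (eps d))) = 2 * (s * t)"
proof -
  have *: "hafnian ((eps a + smul s (eps b)) \<or>\<^sub>2 (eps c + smul t (eps d))) = 2 * (s * t)"
    if "a < b" "c < d" "a < c" "{a, b, c, d} = {1, 2, 3, 4}" for a b c d and s t :: real
    using that by (cases rule: four_indices) (simp_all add: hafnian_def vee_def eps_apply)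
  show ?thesis
  proof (cases "a < c")
    case True
    then show ?thesis using * assms by blast
  next
    case False
    have "{c, d, a, b} = {1, 2, 3, 4}" using assms(4) by (simp add: insert_commute)
    then show ?thesis
      using *[of c d a b t s] assms False by (simp add: vee_commute mult.commute)
  qed
qed

text \<open>The class is given by a nonzero diagonal entry, which among orthogonal pairs means equal
indices.\<close>

lemma highest_small_D:
  defines "q \<equiv> (eps 1 - eps n) \<or>\<^sub>2 (eps 1 + eps n)"
  shows "is_highest D (orbit D q) q"
    and "\<And>p. p \<in> two_roots D \<Longrightarrow> p \<in> orbit D q \<longleftrightarrow> (\<exists>k. p k k \<noteq> 0)"
    and "\<And>p. p \<in> two_roots D \<Longrightarrow> \<exists>k. p k k \<noteq> 0 \<Longrightarrow> orbit D p = orbit D q"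
    and "q \<in> two_roots D"
proof -
  have r: "eps 1 - eps n \<in> roots D" "eps 1 + eps n \<in> roots D"
    using n by (auto intro!: minus_root_D plus_root_D)
  have p: "height D (eps 1 - eps n) > 0" "height D (eps 1 + eps n) > 0"
    using n by (simp_all add: height_diff height_add height_eps_D)
  have o: "form D (eps 1 - eps n) (eps 1 + eps n) = 0"
    using n by (simp add: form_left form_eps_D eps_apply del: form.simps One_nat_def)
  have Q: "\<exists>k. ((eps 1 - eps n) \<or>\<^sub>2 (eps 1 + eps n)) k k \<noteq> 0"
    using n by (intro exI[of _ 1]) (simp add: vee_diagonal eps_apply)
  have Qr: "\<exists>k. (reflection D i \<alpha> \<or>\<^sub>2 reflection D i \<beta>) k k \<noteq> 0"
    if "i \<in> vertices D" "\<exists>k. (\<alpha> \<or>\<^sub>2 \<beta>) k k \<noteq> 0" for i \<alpha> \<beta>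
    using diagonal_zero_reflection[OF that(1)] that(2) by blast
  have max: "\<alpha> \<or>\<^sub>2 \<beta> = (eps 1 - eps n) \<or>\<^sub>2 (eps 1 + eps n)"
    if \<alpha>\<beta>: "\<alpha> \<in> roots D" "\<beta> \<in> roots D" and o: "form D \<alpha> \<beta> = 0"
      and pos: "height D \<alpha> > 0" "height D \<beta> > 0" and Q: "\<exists>k. (\<alpha> \<or>\<^sub>2 \<beta>) k k \<noteq> 0"
      and max: "\<And>i. i \<in> vertices D \<Longrightarrow> height D (reflection D i \<alpha>) * height D (reflection D i \<beta>)
        \<le> height D \<alpha> * height D \<beta>" for \<alpha> \<beta>
    using \<alpha>\<beta>(1) pos(1) \<alpha>\<beta>(2) pos(2) o
  proof (cases rule: orthogonal_pos_pair_D)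
    case (small a b t)
    \<comment> \<open>The pair is put in a fixed order, the difference first.\<close>
    obtain \<gamma> \<delta> where \<gamma>\<delta>: "\<gamma> = eps a - eps b" "\<delta> = eps a + eps b"
      "\<gamma> = \<alpha> \<and> \<delta> = \<beta> \<or> \<gamma> = \<beta> \<and> \<delta> = \<alpha>"
      using small(4-6) by (auto simp: fun_eq_iff)
    have sum: "\<gamma> + \<delta> = \<alpha> + \<beta>" using \<gamma>\<delta>(3) by (auto simp: add.commute)
    have ht: "height D \<gamma> = real b - real a" "height D \<delta> = 2 * real n - real a - real b"
      using small(1-3) by (simp_all add: \<gamma>\<delta>(1,2) height_diff height_add height_eps_D)
    have max': "height D (reflection D i \<gamma>) * height D (reflection D i \<delta>) \<le> height D \<gamma> * height D \<delta>"
      if "i \<in> vertices D" for i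
      using max[OF that] \<gamma>\<delta>(3) by (auto simp: mult.commute)
    have "a = 1 \<and> b = n"
    proof (rule local_max_small_D[OF small(1-3) \<gamma>\<delta>(1,2)])
      fix i assume i: "1 \<le> i" "i < n"
      then have v: "i \<in> vertices D" by simp
      show "(\<gamma> + \<delta>) (i + 1) \<le> (\<gamma> + \<delta>) i"
        using sum_dominant[OF \<alpha>\<beta> o pos v max[OF v]] unfolding form_simple_D(1)[OF i] sum by simp
      show "(real b - real a - (\<gamma> i - \<gamma> (i + 1))) * (2 * real n - real a - real b - (\<delta> i - \<delta> (i + 1)))
        \<le> (real b - real a) * (2 * real n - real a - real b)"
        using max'[OF v] unfolding h_reflection[OF v] form_simple_D(1)[OF i] ht .
    qed
    then have "\<gamma> \<or>\<^sub>2 \<delta> = (eps 1 - eps n) \<or>\<^sub>2 (eps 1 + eps n)" by (simp only: \<gamma>\<delta>(1,2))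
    then show ?thesis using \<gamma>\<delta>(3) vee_commute by metis
  next
    case (large a b c d s t)
    then have "\<alpha> k * \<beta> k = 0" for k
      by (simp add: eps_apply)
    then show ?thesis using Q by (simp add: vee_diagonal)
  qed
  note H = highest_in_orbit[where Q = "\<lambda>p. \<exists>k. p k k \<noteq> 0", OF r p o Q Qr max]
  show "is_highest D (orbit D q) q" unfolding q_def by (rule H(1))
  show "p \<in> orbit D q \<longleftrightarrow> (\<exists>k. p k k \<noteq> 0)" if "p \<in> two_roots D" for p
    unfolding q_def using H(2) that by blast
  show "orbit D p = orbit D q" if "p \<in> two_roots D" "\<exists>k. p k k \<noteq> 0" for p
    unfolding q_def using H(3) that by blast
  show "q \<in> two_roots D" unfolding q_def by (rule H(4))
qed

text \<open>For \<open>n \<ge> 5\<close> the 2-roots with zero diagonal form a single orbit.  For \<open>n = 4\<close> they form two, which the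
sign \<open>\<sigma>\<close> tells apart.\<close>

definition large_class :: "real \<Rightarrow> tensor \<Rightarrow> bool" where
  "large_class \<sigma> p \<longleftrightarrow> (\<forall>k. p k k = 0) \<and> (n = 4 \<longrightarrow> hafnian p = 2 * \<sigma>)"

lemma highest_large_D:
  fixes \<sigma> :: real
  assumes \<sigma>: "\<sigma> = 1 \<or> n = 4 \<and> \<sigma> = - 1"
  defines "q \<equiv> (eps 1 + smul \<sigma> (eps 4)) \<or>\<^sub>2 (eps 2 + eps 3)"
  shows "is_highest D (orbit D q) q"
    and "\<And>p. p \<in> two_roots D \<Longrightarrow> p \<in> orbit D q \<longleftrightarrow> large_class \<sigma> p"
    and "\<And>p. p \<in> two_roots D \<Longrightarrow> large_class \<sigma> p \<Longrightarrow> orbit D p = orbit D q"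
    and "q \<in> two_roots D"
proof -
  let ?\<mu> = "eps 1 + smul \<sigma> (eps 4)" and ?\<nu> = "eps 2 + eps 3 :: vec"
  have "?\<mu> \<in> {eps 1 + eps 4, eps 1 - eps 4}" using \<sigma> by (auto simp: fun_eq_iff)
  moreover have "eps 1 + eps 4 \<in> roots D" "eps 1 - eps 4 \<in> roots D"
    using n by (auto intro!: minus_root_D plus_root_D)
  ultimately have r: "?\<mu> \<in> roots D" "?\<nu> \<in> roots D"
    using n by (auto intro!: plus_root_D)
  have p: "height D ?\<mu> > 0" "height D ?\<nu> > 0"
    using n \<sigma> by (auto simp: height_smul height_add height_minus height_eps_D)
  have o: "form D ?\<mu> ?\<nu> = 0"
    using n by (simp add: form_left form_eps_D eps_apply del: form.simps One_nat_def)
  have "\<forall>k. (?\<mu> \<or>\<^sub>2 ?\<nu>) k k = 0"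
    by (simp add: vee_diagonal eps_apply)
  moreover have "hafnian (?\<mu> \<or>\<^sub>2 ?\<nu>) = 2 * \<sigma>"
    using hafnian_pair[of 1 4 2 3 \<sigma> 1] by (simp add: insert_commute)
  ultimately have Q: "large_class \<sigma> (?\<mu> \<or>\<^sub>2 ?\<nu>)" by (simp add: large_class_def)
  have Qr: "large_class \<sigma> (reflection D i \<alpha> \<or>\<^sub>2 reflection D i \<beta>)"
    if "i \<in> vertices D" "large_class \<sigma> (\<alpha> \<or>\<^sub>2 \<beta>)" for i \<alpha> \<beta>
    using that(2) hafnian_reflection[OF _ that(1)]
    unfolding large_class_def diagonal_zero_reflection[OF that(1)] by simp
  have max: "\<alpha> \<or>\<^sub>2 \<beta> = ?\<mu> \<or>\<^sub>2 ?\<nu>"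
    if \<alpha>\<beta>: "\<alpha> \<in> roots D" "\<beta> \<in> roots D" and o: "form D \<alpha> \<beta> = 0"
      and pos: "height D \<alpha> > 0" "height D \<beta> > 0" and Q: "large_class \<sigma> (\<alpha> \<or>\<^sub>2 \<beta>)"
      and max: "\<And>i. i \<in> vertices D \<Longrightarrow> height D (reflection D i \<alpha>) * height D (reflection D i \<beta>)
        \<le> height D \<alpha> * height D \<beta>" for \<alpha> \<beta>
    using \<alpha>\<beta>(1) pos(1) \<alpha>\<beta>(2) pos(2) o
  proof (cases rule: orthogonal_pos_pair_D)
    case (small a b t)
    have "\<alpha> a * \<beta> a = 1" using small by (simp add: eps_apply)
    then have "(\<alpha> \<or>\<^sub>2 \<beta>) a a \<noteq> 0" by (simp add: vee_diagonal)
    then show ?thesis using Q by (simp add: large_class_def)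
  next
    case (large a b c d s t)
    have dom: "(\<alpha> + \<beta>) (i + 1) \<le> (\<alpha> + \<beta>) i" if i: "1 \<le> i" "i < n" for i
    proof -
      have v: "i \<in> vertices D" using i by simp
      show ?thesis
        using sum_dominant[OF \<alpha>\<beta> o pos v max[OF v]] unfolding form_simple_D(1)[OF i] by simp
    qed
    have v: "n \<in> vertices D" using n by simp
    have last: "0 \<le> (\<alpha> + \<beta>) (n - 1) + (\<alpha> + \<beta>) n"
      using sum_dominant[OF \<alpha>\<beta> o pos v max[OF v]] unfolding form_simple_D(2) .
    have *: "{a, b, c, d} = {1, 2, 3, 4} \<and> (s = 1 \<and> t = 1 \<or>
        n = 4 \<and> (s = 1 \<and> t = - 1 \<and> d = 4 \<or> s = - 1 \<and> t = 1 \<and> b = 4))"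
      by (rule dominant_support_D[OF large(1-12) _ dom last]) (simp only: large)
    have max': "(height D \<alpha> - (\<alpha> i - \<alpha> (i + 1))) * (height D \<beta> - (\<beta> i - \<beta> (i + 1)))
      \<le> height D \<alpha> * height D \<beta>" if i: "1 \<le> i" "i < n" for i
    proof -
      have v: "i \<in> vertices D" using i by simp
      show ?thesis using max[OF v] unfolding h_reflection[OF v] form_simple_D(1)[OF i] .
    qed
    \<comment> \<open>For \<open>n = 4\<close> the hafnian determines the product of the signs; for larger \<open>n\<close> both signs are positive.\<close>
    have st: "s * t = \<sigma>"
    proof (cases "n = 4")
      case True
      then show ?thesis
        using Q hafnian_pair[OF large(2,5,7), of s t] * unfolding large_class_def large(13,14) by simp
    next
      case False
      then show ?thesis using * \<sigma> by auto
    qed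
    show ?thesis
    proof (cases "a < c")
      case True
      have "a = 1 \<and> b = 4 \<and> c = 2 \<and> d = 3 \<and> t = 1"
        using local_max_large_D[OF large(2,5) True _ _ large(13,14) max'] * by blast
      then show ?thesis using st by (simp add: large(13,14))
    next
      case False
      then have "c < a" using large(7) by simp
      moreover have "{c, d, a, b} = {1, 2, 3, 4}" using * by (simp add: insert_commute)
      moreover have "t = 1 \<and> s = 1 \<or> n = 4 \<and> (t = 1 \<and> s = - 1 \<and> b = 4 \<or> t = - 1 \<and> s = 1 \<and> d = 4)"
        using * by blast
      moreover have "(height D \<beta> - (\<beta> i - \<beta> (i + 1))) * (height D \<alpha> - (\<alpha> i - \<alpha> (i + 1)))
        \<le> height D \<beta> * height D \<alpha>" if i: "1 \<le> i" "i < n" for i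
        using max'[OF i] by (simp only: mult.commute)
      ultimately have "c = 1 \<and> d = 4 \<and> a = 2 \<and> b = 3 \<and> s = 1"
        using local_max_large_D[OF large(5,2) _ _ _ large(14,13)] by blast
      then have "\<beta> \<or>\<^sub>2 \<alpha> = ?\<mu> \<or>\<^sub>2 ?\<nu>" using st by (simp add: large(13,14))
      then show ?thesis by (simp only: vee_commute[of \<alpha>])
    qed
  qed
  note H = highest_in_orbit[where Q = "large_class \<sigma>", OF r p o Q Qr max]
  show "is_highest D (orbit D q) q" unfolding q_def by (rule H(1))
  show "p \<in> orbit D q \<longleftrightarrow> large_class \<sigma> p" if "p \<in> two_roots D" for p
    unfolding q_def using H(2) that by blast
  show "orbit D p = orbit D q" if "p \<in> two_roots D" "large_class \<sigma> p" for p
    unfolding q_def using H(3) that by blast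
  show "q \<in> two_roots D" unfolding q_def by (rule H(4))
qed

lemma pos_two_roots_D_small:
  "small_pos_two_roots n = {p \<in> pos_two_roots D. \<exists>k. p k k \<noteq> 0}"
proof (intro set_eqI iffI)
  fix p assume "p \<in> small_pos_two_roots n"
  then obtain a b where ab: "1 \<le> a" "a < b" "b \<le> n" and p: "p = (eps a - eps b) \<or>\<^sub>2 (eps a + eps b)"
    unfolding small_pos_two_roots_def by blast
  have "eps a - eps b \<in> pos_roots D" "eps a + eps b \<in> pos_roots D"
    using minus_root_D[OF ab] plus_root_D[OF ab] plus_nonneg_D[of a b] ab
    by (auto simp: pos_roots_def)
  moreover have "form D (eps a - eps b) (eps a + eps b) = 0"
    using ab by (simp add: form_left form_eps_D eps_apply del: form.simps)
  ultimately have "p \<in> pos_two_roots D" unfolding pos_two_roots_def p by blast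
  moreover have "p a a \<noteq> 0" using ab by (simp add: p vee_diagonal eps_apply)
  ultimately show "p \<in> {p \<in> pos_two_roots D. \<exists>k. p k k \<noteq> 0}" by blast
next
  fix p assume p: "p \<in> {p \<in> pos_two_roots D. \<exists>k. p k k \<noteq> 0}"
  then obtain \<alpha> \<beta> where \<alpha>\<beta>: "\<alpha> \<in> roots D" "height D \<alpha> > 0" "\<beta> \<in> roots D" "height D \<beta> > 0"
    "form D \<alpha> \<beta> = 0" "p = \<alpha> \<or>\<^sub>2 \<beta>"
    unfolding pos_two_roots_def pos_roots_iff by blast
  from \<alpha>\<beta>(1-5) show "p \<in> small_pos_two_roots n"
  proof (cases rule: orthogonal_pos_pair_D)
    case (small a b t)
    then have "p = (eps a - eps b) \<or>\<^sub>2 (eps a + eps b)"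
      unfolding \<alpha>\<beta>(6) by (auto simp: vee_def fun_eq_iff)
    then show ?thesis using small(1-3) unfolding small_pos_two_roots_def by blast
  next
    case (large a b c d s t)
    then have "\<alpha> k * \<beta> k = 0" for k by (simp add: eps_apply)
    then show ?thesis using p by (simp add: \<alpha>\<beta>(6) vee_diagonal)
  qed
qed

lemma large_class_cases:
  assumes n4: "n = 4" and p: "p \<in> two_roots D" "\<forall>k. p k k = 0"
  shows "large_class 1 p \<or> large_class (- 1) p"
proof -
  obtain \<alpha> \<beta> where \<alpha>\<beta>: "\<alpha> \<in> roots D" "\<beta> \<in> roots D" "form D \<alpha> \<beta> = 0" "p = \<alpha> \<or>\<^sub>2 \<beta>"
    using p(1) unfolding two_roots_def by blast
  obtain \<gamma> \<delta> where *: "\<gamma> \<in> roots D" "\<delta> \<in> roots D" "height D \<gamma> > 0" "height D \<delta> > 0" "form D \<gamma> \<delta> = 0"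
    and "\<alpha> \<or>\<^sub>2 \<beta> = \<gamma> \<or>\<^sub>2 \<delta> \<or> \<alpha> \<or>\<^sub>2 \<beta> = \<gamma> \<or>\<^sub>2 (- \<delta>)"
    by (rule two_root_sign_cases[OF \<alpha>\<beta>(1-3)])
  from this(6) have p': "p = \<gamma> \<or>\<^sub>2 \<delta> \<or> p = - (\<gamma> \<or>\<^sub>2 \<delta>)" by (simp only: \<alpha>\<beta>(4) vee_linear)
  then have hp: "hafnian p = hafnian (\<gamma> \<or>\<^sub>2 \<delta>)" using hafnian_minus by metis
  have diag: "(\<gamma> \<or>\<^sub>2 \<delta>) k k = 0" for k using p(2) p' by (auto simp: fun_eq_iff)
  from *(1,3,2,4,5) show ?thesis
  proof (cases rule: orthogonal_pos_pair_D)
    case (small a b t)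
    have "\<gamma> a * \<delta> a = 1" using small by (simp add: eps_apply)
    then show ?thesis using diag[of a] by (simp add: vee_diagonal)
  next
    case (large a b c d s t)
    have "card {a, b, c, d} = card {1..4::nat}" "{a, b, c, d} \<subseteq> {1..4}" using large n4 by auto
    then have "{a, b, c, d} = {1..4}" using card_subset_eq[of "{1..4}" "{a, b, c, d}"] by simp
    also have "\<dots> = {1, 2, 3, 4}" by auto
    finally have "hafnian p = 2 * (s * t)"
      unfolding hp large(13,14) using hafnian_pair large by blast
    then show ?thesis using large(11,12) p(2) by (auto simp: large_class_def)
  qed
qed

end


section \<open>Type E: a certified enumeration of the roots\<close>

text \<open>Lists of integers stand for vectors in the basis of simple roots, with the vertex \<open>i + 1\<close> at
position \<open>i\<close>.  The functions below are evaluated by rewriting.  They use \<open>if\<close> in place of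
conjunction and disjunction, and recursion in place of higher-order list functions, because then
rewriting stops at the first decisive test and does not revisit arguments that are
already evaluated.\<close>

fun dot :: "int list \<Rightarrow> int list \<Rightarrow> int" where
  "dot (x # xs) (y # ys) = x * y + dot xs ys"
| "dot _ _ = 0"

definition e_cartan :: "nat \<Rightarrow> nat \<Rightarrow> nat \<Rightarrow> int" where
  "e_cartan n i j = (if i = j then 2 else if adj (DynkinE n) (Suc i) (Suc j) then - 1 else 0)"

definition e_matrix :: "nat \<Rightarrow> int list list" where
  "e_matrix n = map (\<lambda>i. map (e_cartan n i) [0..<n]) [0..<n]"

fun pairing :: "int list list \<Rightarrow> int list \<Rightarrow> int list" where
  "pairing [] xs = []"
| "pairing (r # C) xs = dot r xs # pairing C xs"

definition unit_list :: "nat \<Rightarrow> nat \<Rightarrow> int list" where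
  "unit_list n i = (replicate n 0)[i := 1]"

fun same :: "int list \<Rightarrow> int list \<Rightarrow> bool" where
  "same (x # xs) (y # ys) \<longleftrightarrow> (if x = y then same xs ys else False)"
| "same [] [] \<longleftrightarrow> True"
| "same [] (y # ys) \<longleftrightarrow> False"
| "same (x # xs) [] \<longleftrightarrow> False"

fun mem :: "int list \<Rightarrow> int list list \<Rightarrow> bool" where
  "mem x [] \<longleftrightarrow> False"
| "mem x (y # ys) \<longleftrightarrow> (if same x y then True else mem x ys)"

text \<open>For each simple root with pairing \<open>- 1\<close> the simple reflection adds that simple root.\<close>

fun ups :: "int list \<Rightarrow> nat \<Rightarrow> int list \<Rightarrow> int list list" where
  "ups xs i [] = []"
| "ups xs i (c # cs) = (if c = - 1 then xs[i := xs ! i + 1] # ups xs (Suc i) cs else ups xs (Suc i) cs)"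

fun merge :: "int list list \<Rightarrow> int list list \<Rightarrow> int list list" where
  "merge [] L = L"
| "merge (x # xs) L = (if mem x L then merge xs L else merge xs (x # L))"

fun next_level :: "int list list \<Rightarrow> int list list \<Rightarrow> int list list \<Rightarrow> int list list" where
  "next_level C [] M = M"
| "next_level C (xs # L) M = next_level C L (merge (ups xs 0 (pairing C xs)) M)"

fun levels :: "int list list \<Rightarrow> nat \<Rightarrow> int list list \<Rightarrow> int list list list" where
  "levels C 0 L = [L]"
| "levels C (Suc k) L = L # levels C k (next_level C L [])"

text \<open>The list of height \<open>k + 1\<close> is at position \<open>k\<close>.  The highest roots have height 11, 17 and 29, so the last of
these lists is empty; the check \<open>levels_ok\<close> confirms this.\<close>

definition e_levels :: "nat \<Rightarrow> int list list list" where
  "e_levels n = levels (e_matrix n) (if n = 6 then 11 else if n = 7 then 17 else 29)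
     (map (unit_list n) [0..<n])"

text \<open>Closure under simple reflections.  Pairing \<open>- 1\<close> leads to the next level by construction, pairing
\<open>1\<close> must lead to the preceding level \<open>M\<close>, and any other nonzero pairing is only allowed for the
simple root itself.\<close>

fun downs_ok :: "int list list \<Rightarrow> int list \<Rightarrow> nat \<Rightarrow> int list \<Rightarrow> bool" where
  "downs_ok M xs i [] \<longleftrightarrow> True"
| "downs_ok M xs i (c # cs) \<longleftrightarrow>
    (if c = 0 then downs_ok M xs (Suc i) cs else
     if c = - 1 then downs_ok M xs (Suc i) cs else
     if c = 1 then (if mem (xs[i := xs ! i - 1]) M then downs_ok M xs (Suc i) cs else False) else
     if same xs (unit_list (length xs) i) then downs_ok M xs (Suc i) cs else False)"

fun level_ok :: "int list list \<Rightarrow> int list list \<Rightarrow> int list list \<Rightarrow> bool" where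
  "level_ok C M [] \<longleftrightarrow> True"
| "level_ok C M (xs # L) \<longleftrightarrow> (if downs_ok M xs 0 (pairing C xs) then level_ok C M L else False)"

fun levels_ok :: "int list list \<Rightarrow> int list list \<Rightarrow> int list list list \<Rightarrow> bool" where
  "levels_ok C M [] \<longleftrightarrow> M = []"
| "levels_ok C M (L # Ls) \<longleftrightarrow> (if level_ok C M L then levels_ok C L Ls else False)"

fun annotate :: "int list list \<Rightarrow> int list list \<Rightarrow> (int list \<times> int list \<times> int) list" where
  "annotate C [] = []"
| "annotate C (xs # L) = (xs, pairing C xs, sum_list xs) # annotate C L"

fun neg_sum :: "int list \<Rightarrow> int list \<Rightarrow> bool" where
  "neg_sum (x # xs) (y # ys) \<longleftrightarrow> (if x + y < 0 then True else neg_sum xs ys)"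
| "neg_sum [] ys \<longleftrightarrow> False"
| "neg_sum (x # xs) [] \<longleftrightarrow> False"

text \<open>\<open>climbs a b\<close> says that some simple reflection raises the product of the heights \<open>a\<close> and \<open>b\<close>:
\<open>(a - x) (b - y) > a b\<close> for pairings \<open>x\<close> and \<open>y\<close>.\<close>

fun climbs :: "int \<Rightarrow> int \<Rightarrow> int list \<Rightarrow> int list \<Rightarrow> bool" where
  "climbs a b (x # xs) (y # ys) \<longleftrightarrow> (if x * b + y * a < x * y then True else climbs a b xs ys)"
| "climbs a b [] ys \<longleftrightarrow> False"
| "climbs a b (x # xs) [] \<longleftrightarrow> False"

text \<open>Most pairs fail to be local maxima because their sum is not dominant, so this cheap test comes
first.\<close>

fun max_row :: "int list \<Rightarrow> int list \<Rightarrow> int list \<Rightarrow> int list \<Rightarrow> int \<Rightarrow> (int list \<times> int list \<times> int) list \<Rightarrow> bool" where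
  "max_row q1 q2 xs cs a [] \<longleftrightarrow> True"
| "max_row q1 q2 xs cs a ((ys, ds, b) # R) \<longleftrightarrow>
     (if neg_sum cs ds then max_row q1 q2 xs cs a R
      else if dot xs ds \<noteq> 0 then max_row q1 q2 xs cs a R
      else if climbs a b cs ds then max_row q1 q2 xs cs a R
      else if same xs q1 then (if same ys q2 then max_row q1 q2 xs cs a R else False)
      else if same xs q2 then (if same ys q1 then max_row q1 q2 xs cs a R else False) else False)"

fun max_rows :: "int list \<Rightarrow> int list \<Rightarrow> (int list \<times> int list \<times> int) list \<Rightarrow> bool" where
  "max_rows q1 q2 [] \<longleftrightarrow> True"
| "max_rows q1 q2 ((xs, cs, a) # R) \<longleftrightarrow> (if max_row q1 q2 xs cs a R then max_rows q1 q2 R else False)"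

definition sum3 :: "nat \<Rightarrow> nat \<Rightarrow> nat \<Rightarrow> nat \<Rightarrow> int list" where
  "sum3 n h i j = (replicate n 0)[h := 1, i := 1, j := 1]"

text \<open>The parabolic subsystem for \<open>i\<close> consists of the vertex \<open>x\<close>, which has the last position, and of an
interval of the long path.  Positions are counted from 0, so the branch vertex has position 2, and
the interval always contains the positions 1 to 3.\<close>

definition theta_list :: "nat \<Rightarrow> nat \<Rightarrow> int list" where
  "theta_list n i = map (\<lambda>k. let lo = min i 1; hi = (if Suc i = n then 3 else max i 3) in
     if Suc k = n \<or> k = lo \<or> k = hi then 1 else if lo < k \<and> k < hi then 2 else 0) [0..<n]"

definition elem_list :: "nat \<Rightarrow> int list \<Rightarrow> nat \<Rightarrow> int list list" where
  "elem_list n r i =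
     map (unit_list n) (filter (\<lambda>j. r ! j = 0) [0..<n]) @
     concat (map (\<lambda>h. map (\<lambda>j. sum3 n h i j) (filter (\<lambda>j. h < j \<and> r ! j = - 1) [0..<n]))
       (filter (\<lambda>h. r ! h = - 1) [0..<n])) @
     (if i = 2 then [] else [theta_list n i])"

text \<open>A root \<open>\<gamma>\<close> orthogonal to \<open>\<alpha>\<^sub>i\<close> that is not elementary must have pairing 1 with a lower elementary root
\<open>\<eta>\<close>; then \<open>\<gamma> - \<eta>\<close> is a smaller positive root orthogonal to \<open>\<alpha>\<^sub>i\<close>.\<close>

fun reducible :: "int list \<Rightarrow> int \<Rightarrow> (int list \<times> int list \<times> int) list \<Rightarrow> bool" where
  "reducible xs a [] \<longleftrightarrow> False"
| "reducible xs a ((ys, ds, b) # E) \<longleftrightarrow> (if same xs ys then True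
     else if dot xs ds = 1 then (if b < a then True else reducible xs a E) else reducible xs a E)"

fun reducible_rows :: "nat \<Rightarrow> (int list \<times> int list \<times> int) list \<Rightarrow> (int list \<times> int list \<times> int) list \<Rightarrow> bool" where
  "reducible_rows i E [] \<longleftrightarrow> True"
| "reducible_rows i E ((xs, cs, a) # R) \<longleftrightarrow>
    (if cs ! i = 0 then (if reducible xs a E then reducible_rows i E R else False) else reducible_rows i E R)"

fun elems_ok :: "int list list \<Rightarrow> int list \<Rightarrow> int list list \<Rightarrow> bool" where
  "elems_ok L r [] \<longleftrightarrow> True"
| "elems_ok L r (x # xs) \<longleftrightarrow> (if mem x L then if dot r x = 0 then elems_ok L r xs else False else False)"

fun basis_rows :: "nat \<Rightarrow> int list list \<Rightarrow> int list list \<Rightarrow> (int list \<times> int list \<times> int) list \<Rightarrow> nat list \<Rightarrow> bool" where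
  "basis_rows n C L R [] \<longleftrightarrow> True"
| "basis_rows n C L R (i # is) \<longleftrightarrow>
     (if elems_ok L (C ! i) (elem_list n (C ! i) i) then
       if reducible_rows i (annotate C (elem_list n (C ! i) i)) R then basis_rows n C L R is else False
      else False)"


fun dominated :: "int list \<Rightarrow> int list \<Rightarrow> bool" where
  "dominated (x # xs) (y # ys) \<longleftrightarrow> (if x \<le> y then dominated xs ys else False)"
| "dominated [] ys \<longleftrightarrow> True"
| "dominated (x # xs) [] \<longleftrightarrow> False"

fun all_dominated :: "int list \<Rightarrow> int list list \<Rightarrow> bool" where
  "all_dominated t [] \<longleftrightarrow> True"
| "all_dominated t (xs # L) \<longleftrightarrow> (if dominated xs t then all_dominated t L else False)"

definition vl :: "int list \<Rightarrow> vec" where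
  "vl xs = (\<lambda>k. if 1 \<le> k \<and> k \<le> length xs then of_int (xs ! (k - 1)) else 0)"

lemma same_iff: "same xs ys \<longleftrightarrow> xs = ys"
  by (induction xs ys rule: same.induct) auto

lemma mem_iff: "mem x L \<longleftrightarrow> x \<in> set L"
  by (induction L) (auto simp: same_iff)

lemma elems_ok_iff: "elems_ok L r xs \<longleftrightarrow> set xs \<subseteq> set L \<and> (\<forall>x\<in>set xs. dot r x = 0)"
  by (induction xs) (auto simp: mem_iff)

lemma set_merge: "set (merge xs L) = set xs \<union> set L"
  by (induction xs arbitrary: L) (auto simp: mem_iff)

lemma set_next_level: "set (next_level C L M) = set M \<union> (\<Union>xs\<in>set L. set (ups xs 0 (pairing C xs)))"
  by (induction L arbitrary: M) (auto simp: set_merge)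

lemma length_pairing: "length (pairing C xs) = length C"
  by (induction C) auto

lemma nth_pairing: "i < length C \<Longrightarrow> pairing C xs ! i = dot (C ! i) xs"
  by (induction C arbitrary: i) (auto simp: nth_Cons split: nat.splits)

lemma annotate_map: "annotate C L = map (\<lambda>xs. (xs, pairing C xs, sum_list xs)) L"
  by (induction L) auto

lemma set_ups: "set (ups xs i cs) = {xs[i + j := xs ! (i + j) + 1] | j. j < length cs \<and> cs ! j = - 1}"
proof (induction cs arbitrary: i)
  case (Cons c cs)
  have "{xs[i + j := xs ! (i + j) + 1] | j. j < length (c # cs) \<and> (c # cs) ! j = - 1} =
    (if c = - 1 then {xs[i := xs ! i + 1]} else {}) \<union>
    {xs[Suc i + j := xs ! (Suc i + j) + 1] | j. j < length cs \<and> cs ! j = - 1}"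
  proof (intro set_eqI iffI)
    fix ys assume "ys \<in> {xs[i + j := xs ! (i + j) + 1] | j. j < length (c # cs) \<and> (c # cs) ! j = - 1}"
    then obtain j where j: "ys = xs[i + j := xs ! (i + j) + 1]" "j < length (c # cs)" "(c # cs) ! j = - 1"
      by blast
    then show "ys \<in> (if c = - 1 then {xs[i := xs ! i + 1]} else {}) \<union>
      {xs[Suc i + j := xs ! (Suc i + j) + 1] | j. j < length cs \<and> cs ! j = - 1}"
      by (cases j) auto
  next
    fix ys assume "ys \<in> (if c = - 1 then {xs[i := xs ! i + 1]} else {}) \<union>
      {xs[Suc i + j := xs ! (Suc i + j) + 1] | j. j < length cs \<and> cs ! j = - 1}"
    then consider "c = - 1" "ys = xs[i := xs ! i + 1]"
      | j where "ys = xs[Suc i + j := xs ! (Suc i + j) + 1]" "j < length cs" "cs ! j = - 1"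
      by (auto split: if_splits)
    then show "ys \<in> {xs[i + j := xs ! (i + j) + 1] | j. j < length (c # cs) \<and> (c # cs) ! j = - 1}"
    proof cases
      case 1
      then show ?thesis by (intro CollectI exI[of _ 0]) simp
    next
      case (2 j)
      then show ?thesis by (intro CollectI exI[of _ "Suc j"]) simp
    qed
  qed
  then show ?case using Cons.IH[of "Suc i"] by simp
qed simp

lemma downs_okD:
  "downs_ok M xs i cs \<Longrightarrow> j < length cs \<Longrightarrow> cs ! j = 0 \<or> cs ! j = - 1 \<or>
    cs ! j = 1 \<and> xs[i + j := xs ! (i + j) - 1] \<in> set M \<or> xs = unit_list (length xs) (i + j)"
proof (induction cs arbitrary: i j)
  case (Cons c cs)
  show ?case
  proof (cases j)
    case 0
    then show ?thesis using Cons.prems by (auto simp: mem_iff same_iff split: if_splits)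
  next
    case (Suc k)
    then show ?thesis
      using Cons.IH[of "Suc i" k] Cons.prems by (auto split: if_splits)
  qed
qed simp

lemma level_okD: "level_ok C M L \<Longrightarrow> xs \<in> set L \<Longrightarrow> downs_ok M xs 0 (pairing C xs)"
  by (induction L) (auto split: if_splits)

lemma set_levels_start: "set L \<subseteq> set (concat (levels C k L))"
  by (cases k) auto

text \<open>The preceding level \<open>M\<close> is generalized in the induction over the levels.\<close>

lemma levels_closed:
  assumes "levels_ok C M (levels C k L)" "xs \<in> set (concat (levels C k L))" "i < length C"
  shows "pairing C xs ! i = 0 \<or>
    pairing C xs ! i = - 1 \<and> xs[i := xs ! i + 1] \<in> set (concat (levels C k L)) \<or>
    pairing C xs ! i = 1 \<and> xs[i := xs ! i - 1] \<in> set M \<union> set (concat (levels C k L)) \<or>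
    xs = unit_list (length xs) i"
  using assms
proof (induction k arbitrary: M L)
  case 0
  then show ?case by (auto split: if_splits)
next
  case (Suc k)
  let ?N = "next_level C L []"
  have ok: "level_ok C M L" "levels_ok C L (levels C k ?N)"
    using Suc.prems(1) by (auto split: if_splits)
  show ?case
  proof (cases "xs \<in> set L")
    case True
    have "xs[i := xs ! i + 1] \<in> set ?N" if "pairing C xs ! i = - 1"
      using that Suc.prems(3) True by (auto simp: set_next_level set_ups length_pairing)
    then have "xs[i := xs ! i + 1] \<in> set (concat (levels C k ?N))" if "pairing C xs ! i = - 1"
      using that set_levels_start by blast
    then show ?thesis
      using downs_okD[OF level_okD[OF ok(1) True], of i] Suc.prems(3)
      by (auto simp: length_pairing)
  next
    case False
    then have "xs \<in> set (concat (levels C k ?N))" using Suc.prems(2) by simp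
    from Suc.IH[OF ok(2) this Suc.prems(3)] show ?thesis by auto
  qed
qed

lemma neg_sumD: "neg_sum xs ys \<Longrightarrow> \<exists>i < length xs. xs ! i + ys ! i < 0"
proof (induction xs ys rule: neg_sum.induct)
  case (1 x xs y ys)
  show ?case
  proof (cases "x + y < 0")
    case True
    then show ?thesis by (intro exI[of _ 0]) simp
  next
    case False
    then obtain i where "i < length xs" "xs ! i + ys ! i < 0" using 1 by auto
    then show ?thesis by (intro exI[of _ "Suc i"]) simp
  qed
qed auto

lemma climbsD: "climbs a b xs ys \<Longrightarrow> \<exists>i < length xs. xs ! i * b + ys ! i * a < xs ! i * ys ! i"
proof (induction a b xs ys rule: climbs.induct)
  case (1 a b x xs y ys)
  show ?case
  proof (cases "x * b + y * a < x * y")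
    case True
    then show ?thesis by (intro exI[of _ 0]) simp
  next
    case False
    then obtain i where "i < length xs" "xs ! i * b + ys ! i * a < xs ! i * ys ! i" using 1 by auto
    then show ?thesis by (intro exI[of _ "Suc i"]) simp
  qed
qed auto

definition max_pair :: "int list \<Rightarrow> int list \<Rightarrow> int list list \<Rightarrow> int list \<Rightarrow> int list \<Rightarrow> bool" where
  "max_pair q1 q2 C xs ys \<longleftrightarrow> neg_sum (pairing C xs) (pairing C ys) \<or> dot xs (pairing C ys) \<noteq> 0 \<or>
     climbs (sum_list xs) (sum_list ys) (pairing C xs) (pairing C ys) \<or>
     xs = q1 \<and> ys = q2 \<or> xs = q2 \<and> ys = q1"

lemma max_rowD:
  "max_row q1 q2 xs (pairing C xs) (sum_list xs) (annotate C L) \<Longrightarrow> ys \<in> set L \<Longrightarrow>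
    max_pair q1 q2 C xs ys"
  by (induction L) (auto simp: max_pair_def same_iff split: if_splits)

lemma max_rowsD:
  "max_rows q1 q2 (annotate C L) \<Longrightarrow> xs \<in> set L \<Longrightarrow> ys \<in> set L \<Longrightarrow> xs \<noteq> ys \<Longrightarrow>
    max_pair q1 q2 C xs ys \<or> max_pair q1 q2 C ys xs"
  by (induction L) (auto dest: max_rowD split: if_splits)

lemma reducibleD:
  "reducible xs (sum_list xs) (annotate C L) \<Longrightarrow>
    xs \<in> set L \<or> (\<exists>ys\<in>set L. dot xs (pairing C ys) = 1 \<and> sum_list ys < sum_list xs)"
  by (induction L) (auto simp: same_iff split: if_splits)

lemma reducible_rowsD:
  "reducible_rows i E (annotate C L) \<Longrightarrow> xs \<in> set L \<Longrightarrow> pairing C xs ! i = 0 \<Longrightarrow>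
    reducible xs (sum_list xs) E"
  by (induction L) (auto split: if_splits)

lemma basis_rowsD:
  "basis_rows n C L R is \<Longrightarrow> i \<in> set is \<Longrightarrow>
    set (elem_list n (C ! i) i) \<subseteq> set L \<and> (\<forall>x\<in>set (elem_list n (C ! i) i). dot (C ! i) x = 0) \<and>
    reducible_rows i (annotate C (elem_list n (C ! i) i)) R"
  by (induction "is") (auto simp: elems_ok_iff split: if_splits)

lemma dominatedD: "dominated xs ys \<Longrightarrow> length xs = length ys \<Longrightarrow> i < length xs \<Longrightarrow> xs ! i \<le> ys ! i"
  by (induction xs ys arbitrary: i rule: dominated.induct)
    (auto simp: nth_Cons split: if_splits nat.splits)

lemma all_dominatedD: "all_dominated t L \<Longrightarrow> xs \<in> set L \<Longrightarrow> dominated xs t"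
  by (induction L) (auto split: if_splits)

lemma dot_sum: "length xs = length ys \<Longrightarrow> dot xs ys = (\<Sum>i<length xs. xs ! i * ys ! i)"
  by (induction xs ys rule: list_induct2) (simp_all add: sum.lessThan_Suc_shift del: sum.lessThan_Suc)

section \<open>Type E: from the enumeration to the root system\<close>

text \<open>The two checks that hold in all three types are assumptions here, so that their meaning is
worked out once.\<close>

locale type_E =
  fixes n :: nat
  assumes n: "n \<in> {6, 7, 8}"
    and levels_ok: "levels_ok (e_matrix n) [] (e_levels n)"
    and basis_ok: "basis_rows n (e_matrix n) (concat (e_levels n))
      (annotate (e_matrix n) (concat (e_levels n))) [0..<n]"
begin

abbreviation (input) E where "E \<equiv> DynkinE n"
abbreviation (input) C where "C \<equiv> e_matrix n"
abbreviation (input) P where "P \<equiv> set (concat (e_levels n))"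

lemma fin_E: "simply_laced_finite E"
  using n by simp

lemma length_C: "length C = n"
  by (simp add: e_matrix_def)

lemma sum_shift: "(\<Sum>j\<in>{1..n}. f j) = (\<Sum>j<n. f (Suc j))"
  using sum.atLeast1_atMost_eq[of f n] by (simp only: One_nat_def)

lemma form_E_simple:
  assumes "i \<in> {1..n}"
  shows "form E (eps i) v = (\<Sum>j\<in>{1..n}. cartan E i j * v j)"
proof -
  have "form E (eps i) v = (\<Sum>k\<in>{1..n}. eps i k * (\<Sum>j\<in>{1..n}. cartan E k j * v j))"
    by (simp add: sum_distrib_left mult_ac)
  then show ?thesis using assms by (simp add: sum_eps_mult)
qed

lemma form_E_left: "form E u v = (\<Sum>i\<in>{1..n}. u i * form E (eps i) v)"
proof -
  have "form E u v = (\<Sum>i\<in>{1..n}. u i * (\<Sum>j\<in>{1..n}. cartan E i j * v j))"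
    by (simp add: sum_distrib_left mult_ac)
  then show ?thesis by (simp add: form_E_simple del: form.simps)
qed

lemma pairing_E:
  assumes "length xs = n" "i < n"
  shows "form E (eps (Suc i)) (vl xs) = of_int (pairing C xs ! i)"
proof -
  have "form E (eps (Suc i)) (vl xs) = (\<Sum>j<n. cartan E (Suc i) (Suc j) * vl xs (Suc j))"
    using form_E_simple[of "Suc i"] assms(2) by (simp only: sum_shift) simp
  also have "\<dots> = (\<Sum>j<n. of_int (e_cartan n i j * xs ! j))"
    using assms(1) by (intro sum.cong) (auto simp: cartan_def e_cartan_def vl_def)
  also have "\<dots> = of_int (dot (C ! i) xs)"
    using assms by (subst dot_sum) (auto simp: e_matrix_def)
  finally show ?thesis using assms(2) by (simp add: nth_pairing length_C)
qed

lemma dot_E: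
  assumes "length xs = n" "length ys = n"
  shows "form E (vl xs) (vl ys) = of_int (dot xs (pairing C ys))"
proof -
  have "form E (vl xs) (vl ys) = (\<Sum>i<n. of_int (xs ! i * pairing C ys ! i))"
    unfolding form_E_left[of "vl xs"] sum_shift
    using assms by (intro sum.cong) (auto simp: pairing_E vl_def[of xs] simp del: form.simps)
  also have "\<dots> = of_int (dot xs (pairing C ys))"
    using assms by (subst dot_sum) (auto simp: length_pairing length_C)
  finally show ?thesis .
qed

lemma reflection_E:
  assumes "length xs = n" "i < n"
  shows "reflection E (Suc i) (vl xs) = vl (xs[i := xs ! i - pairing C xs ! i])"
proof
  fix k
  show "reflection E (Suc i) (vl xs) k = vl (xs[i := xs ! i - pairing C xs ! i]) k"
    using assms unfolding reflection_def simple_root.simps pairing_E[OF assms]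
    by (auto simp: vl_def eps_apply nth_list_update)
qed

lemma height_E:
  assumes "length xs = n"
  shows "height E (vl xs) = of_int (sum_list xs)"
proof -
  have "height E (vl xs) = (\<Sum>k\<in>{1..n}. vl xs k)" by (simp add: height_def)
  also have "\<dots> = (\<Sum>k<n. of_int (xs ! k))"
    unfolding sum_shift using assms by (intro sum.cong) (auto simp: vl_def)
  also have "\<dots> = of_int (sum_list xs)"
    using assms by (simp add: sum_list_sum_nth atLeast0LessThan)
  finally show ?thesis .
qed

lemma length_unit_list [simp]: "length (unit_list m i) = m"
  by (simp add: unit_list_def)

lemma vl_unit: "i < n \<Longrightarrow> vl (unit_list n i) = simple_root E (Suc i)"
  by (auto simp: fun_eq_iff vl_def unit_list_def eps_apply nth_list_update)

lemma nonneg_E: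
  assumes "length xs = n" "\<And>i. i < n \<Longrightarrow> xs ! i \<ge> 0"
  shows "nonneg_comb_simple E (vl xs)"
  unfolding nonneg_comb_simple_def
proof (intro exI conjI ballI ext)
  show "0 \<le> vl xs i" if "i \<in> vertices E" for i
  proof -
    have "i - 1 < n" using that by auto
    then show ?thesis using assms(2)[of "i - 1"] by (simp add: vl_def)
  qed
  fix k
  have "(\<Sum>i\<in>vertices E. vl xs i * simple_root E i k) = (\<Sum>i\<in>{1..n}. vl xs i * eps k i)"
    by (intro sum.cong) (auto simp: eps_apply)
  then show "vl xs k = (\<Sum>i\<in>vertices E. vl xs i * simple_root E i k)"
    using assms(1) by (auto simp: sum_eps_mult vl_def)
qed

definition nonneg_root_list :: "int list \<Rightarrow> bool" where
  "nonneg_root_list xs \<longleftrightarrow> length xs = n \<and> (\<forall>x\<in>set xs. 0 \<le> x) \<and> vl xs \<in> roots E"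

lemma nonneg_root_list_ups:
  assumes "nonneg_root_list xs" "ys \<in> set (ups xs 0 (pairing C xs))"
  shows "nonneg_root_list ys"
proof -
  obtain i where i: "i < n" "pairing C xs ! i = - 1" and ys: "ys = xs[i := xs ! i + 1]"
    using assms(2) by (auto simp: set_ups length_pairing length_C)
  have len: "length xs = n" using assms(1) by (simp add: nonneg_root_list_def)
  have "vl ys = reflection E (Suc i) (vl xs)"
    using reflection_E[OF len i(1)] i(2) ys by simp
  then have "vl ys \<in> roots E"
    using reflection_roots[of "Suc i" E "vl xs"] assms(1) i(1) by (simp add: nonneg_root_list_def)
  moreover have "0 \<le> xs ! i" using assms(1) len i(1) by (simp add: nonneg_root_list_def)
  then have "\<forall>x\<in>set ys. 0 \<le> x"
    using assms(1) set_update_subset_insert[of xs i "xs ! i + 1"] unfolding ys nonneg_root_list_def by fastforce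
  ultimately show ?thesis using len by (simp add: nonneg_root_list_def ys)
qed

lemma nonneg_root_list_levels: "\<forall>xs\<in>set L. nonneg_root_list xs \<Longrightarrow> \<forall>xs\<in>set (concat (levels C k L)). nonneg_root_list xs"
proof (induction k arbitrary: L)
  case (Suc k)
  have "\<forall>xs\<in>set (next_level C L []). nonneg_root_list xs"
    using Suc.prems nonneg_root_list_ups by (auto simp: set_next_level)
  then show ?case using Suc.IH Suc.prems by auto
qed simp

lemma unit_in_P: "i < n \<Longrightarrow> unit_list n i \<in> P"
  unfolding e_levels_def by (rule subsetD[OF set_levels_start]) simp

lemma nonneg_root_list_P:
  assumes "xs \<in> P"
  shows "nonneg_root_list xs"
proof -
  have "nonneg_root_list (unit_list n i)" if "i < n" for i
  proof -
    have "set (unit_list n i) \<subseteq> {0, 1}"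
      using set_update_subset_insert[of "replicate n 0" i 1] by (auto simp: unit_list_def)
    then show ?thesis
      using vl_unit[OF that] simple_in_roots[of "Suc i" E] that by (auto simp: nonneg_root_list_def)
  qed
  then have "\<forall>xs\<in>set (map (unit_list n) [0..<n]). nonneg_root_list xs" by auto
  from nonneg_root_list_levels[OF this] show ?thesis using assms unfolding e_levels_def by blast
qed

lemma P_facts:
  assumes "xs \<in> P"
  shows "length xs = n" "vl xs \<in> roots E" "nonneg_comb_simple E (vl xs)"
proof -
  note xs = nonneg_root_list_P[OF assms, unfolded nonneg_root_list_def]
  show "length xs = n" "vl xs \<in> roots E" using xs by blast+
  show "nonneg_comb_simple E (vl xs)" by (rule nonneg_E) (use xs nth_mem in auto)
qed

lemma P_reflection:
  assumes xs: "xs \<in> P" and i: "i < n"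
  shows "(\<exists>ys\<in>P. reflection E (Suc i) (vl xs) = vl ys) \<or> xs = unit_list n i"
    and "pairing C xs ! i \<in> {- 1, 0, 1} \<or> xs = unit_list n i"
proof -
  have len: "length xs = n" using P_facts[OF xs] by blast
  have "pairing C xs ! i = 0 \<or> pairing C xs ! i = - 1 \<and> xs[i := xs ! i + 1] \<in> P \<or>
    pairing C xs ! i = 1 \<and> xs[i := xs ! i - 1] \<in> P \<or> xs = unit_list n i"
    using levels_closed[of C "[]" _ _ xs i] levels_ok xs i unfolding e_levels_def
    by (simp add: length_C len)
  then show "(\<exists>ys\<in>P. reflection E (Suc i) (vl xs) = vl ys) \<or> xs = unit_list n i"
    and "pairing C xs ! i \<in> {- 1, 0, 1} \<or> xs = unit_list n i"
    unfolding reflection_E[OF len i] using xs by (auto simp del: set_concat)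
qed

text \<open>The listed roots and their negatives contain the simple roots and are closed under simple
reflections.\<close>

lemma roots_E_cases:
  assumes "\<alpha> \<in> roots E"
  obtains xs where "xs \<in> P" "\<alpha> = vl xs \<or> \<alpha> = - vl xs"
proof -
  have "\<exists>xs\<in>P. \<alpha> = vl xs \<or> \<alpha> = - vl xs"
    using assms
  proof (induction rule: roots_induct)
    case (simple i)
    then have "unit_list n (i - 1) \<in> P" "simple_root E i = vl (unit_list n (i - 1))"
      using unit_in_P[of "i - 1"] vl_unit[of "i - 1"] by auto
    then show ?case by blast
  next
    case (reflect i \<alpha>)
    then obtain xs where xs: "xs \<in> P" "\<alpha> = vl xs \<or> \<alpha> = - vl xs" by blast
    have i: "i - 1 < n" "Suc (i - 1) = i" using reflect(1) by auto
    have "\<exists>ys\<in>P. reflection E i (vl xs) = vl ys \<or> reflection E i (vl xs) = - vl ys"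
      using P_reflection(1)[OF xs(1) i(1)] unfolding i(2)
    proof
      assume "xs = unit_list n (i - 1)"
      then have eq: "vl xs = simple_root E i" using vl_unit[OF i(1)] by (simp only: i(2))
      have "reflection E i (vl xs) = - vl xs"
        unfolding eq reflection_def simple_root_norm[OF fin_E reflect(1)] by (simp add: fun_eq_iff)
      then show ?thesis using xs(1) by blast
    qed blast
    moreover have "reflection E i \<alpha> = reflection E i (vl xs) \<or> reflection E i \<alpha> = - reflection E i (vl xs)"
      using xs(2) by (auto simp only: reflection_eq root_refl_linear)
    ultimately show ?case by (metis minus_minus)
  qed
  then show thesis using that by blast
qed

lemma pos_roots_E_cases:
  assumes "\<alpha> \<in> roots E" "height E \<alpha> > 0"
  obtains xs where "xs \<in> P" "\<alpha> = vl xs"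
proof -
  obtain xs where xs: "xs \<in> P" "\<alpha> = vl xs \<or> \<alpha> = - vl xs" using roots_E_cases[OF assms(1)] .
  have "height E (vl xs) \<ge> 0"
    using nonneg_comb_height(1)[OF fin_E] P_facts[OF xs(1)] by blast
  then have "\<alpha> \<noteq> - vl xs" using assms(2) by (auto simp only: height_minus)
  then show thesis using that xs by blast
qed

lemma adj_E_cases:
  assumes "adj E u v"
  shows "(v = Suc u \<and> v < n) \<or> (u = Suc v \<and> u < n) \<or> (u = 3 \<and> v = n) \<or> (v = 3 \<and> u = n)"
  using assms n by (auto simp: adj_def)

lemma rooted_tree_E:
  "rooted_tree E 3 (\<lambda>v. if v < 3 then Suc v else if v = n then 3 else v - 1)
    (\<lambda>v. if v = n then 1 else if v < 3 then 3 - v else v - 3)" (is "rooted_tree E 3 ?p ?d")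
proof -
  have n5: "5 < n" using n by auto
  show ?thesis
    unfolding rooted_tree_def
  proof (intro conjI ballI impI)
    fix u assume u: "u \<in> vertices E" "u \<noteq> 3"
    show "?p u \<in> vertices E" using u n5 by auto
    show "adj E u (?p u)" using u n5 by (auto simp: adj_def)
    show "?d (?p u) < ?d u"
      using u n5 by (cases "u < 3"; cases "u = n"; simp; linarith)
  next
    fix u v assume "u \<in> vertices E" "v \<in> vertices E" "adj E u v"
    from adj_E_cases[OF this(3)]
    show "u \<noteq> 3 \<and> v = ?p u \<or> v \<noteq> 3 \<and> u = ?p v"
      using n5 by (elim disjE conjE) (simp_all add: not_less)
  qed (use n5 in simp)
qed

lemma neighbours_E_branch: "neighbours E 3 = {2, 4, n}"
  using n by (auto simp: neighbours_def adj_def)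

lemma branch_E: "is_branch E 3"
  using n by (auto simp: is_branch_def neighbours_E_branch)

lemma theta_support_E:
  assumes "i \<in> {1..n}" "i \<noteq> 3"
  shows "theta_support E i 3 = insert n {min i 2..(if i = n then 4 else max i 4)}"
proof -
  have n5: "5 < n" using n by auto
  have path: "path_vertices E i 3 = (if i = n then {n, 3} else if i < 3 then {i..3} else {3..i})"
  proof -
    consider "i = n" | "i < 3" | "3 < i" "i < n" using assms by fastforce
    then show ?thesis
    proof cases
      case 1
      have "path_vertices E n 3 = insert n (path_vertices E 3 3)"
        using path_vertices_rec(2)[OF rooted_tree_E, of n] n5 by simp
      then show ?thesis using 1 path_vertices_rec(1)[OF rooted_tree_E] by simp
    next
      case 2
      have "path_vertices E i 3 = {i..<3} \<union> path_vertices E 3 3"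
        by (rule path_vertices_ascending[OF rooted_tree_E]) (use assms 2 n5 in auto)
      moreover have "{i..<3} \<union> {3} = {i..3}" using 2 by auto
      ultimately show ?thesis
        using 2 n5 path_vertices_rec(1)[OF rooted_tree_E] by simp
    next
      case 3
      have "path_vertices E i 3 = {3..i}"
        by (rule path_vertices_descending[OF rooted_tree_E]) (use 3 in auto)
      then show ?thesis using 3 by simp
    qed
  qed
  consider "i = n" | "i < 3" | "3 < i" "i < n" using assms by fastforce
  then show ?thesis
    unfolding theta_support_def neighbours_E_branch path
  proof cases
    case 1
    then show "(if i = n then {n, 3} else if i < 3 then {i..3} else {3..i}) \<union> {2, 4, n} =
        insert n {min i 2..if i = n then 4 else max i 4}"
      using n5 by auto
  next
    case 2
    then show "(if i = n then {n, 3} else if i < 3 then {i..3} else {3..i}) \<union> {2, 4, n} =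
        insert n {min i 2..if i = n then 4 else max i 4}"
      using n5 by auto
  next
    case 3
    then show "(if i = n then {n, 3} else if i < 3 then {i..3} else {3..i}) \<union> {2, 4, n} =
        insert n {min i 2..if i = n then 4 else max i 4}"
      using n5 by auto
  qed
qed

text \<open>The endpoints of the subdiagram are the two ends of the interval and the vertex \<open>n\<close>.\<close>

lemma theta_sub_E:
  assumes i: "i < n" "i \<noteq> 2"
  shows "theta_sub E (Suc i) 3 = vl (theta_list n i)"
proof -
  have n5: "5 < n" using n by auto
  define lo where "lo = min (Suc i) 2"
  define hi where "hi = (if Suc i = n then 4 else max (Suc i) 4)"
  have lohi: "1 \<le> lo" "lo \<le> 2" "4 \<le> hi" "hi < n" using n5 i by (auto simp: lo_def hi_def)
  have S: "theta_support E (Suc i) 3 = insert n {lo..hi}"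
    unfolding lo_def hi_def using theta_support_E[of "Suc i"] i by simp
  have card: "card (neighbours E j \<inter> insert n {lo..hi}) = 1 \<longleftrightarrow> j = lo \<or> j = hi \<or> j = n"
    if j: "j \<in> insert n {lo..hi}" for j
  proof -
    have mem: "x \<in> neighbours E j \<inter> insert n {lo..hi} \<longleftrightarrow> x \<in> insert n {lo..hi} \<and>
        ((x = Suc j \<and> x < n) \<or> (j = Suc x \<and> j < n) \<or> (j = 3 \<and> x = n) \<or> (x = 3 \<and> j = n))" for x
      using lohi n5 j by (auto simp: neighbours_def adj_def)
    consider "j = lo" | "j = hi" | "j = n" | "lo < j" "j < hi" using j by fastforce
    then show ?thesis
    proof cases
      case 1
      then have "neighbours E j \<inter> insert n {lo..hi} = {Suc lo}"
        using lohi by (intro set_eqI) (subst mem, auto)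
      then show ?thesis using 1 by simp
    next
      case 2
      then have "neighbours E j \<inter> insert n {lo..hi} = {hi - 1}"
        using lohi by (intro set_eqI) (subst mem, auto)
      then show ?thesis using 2 by simp
    next
      case 3
      then have "neighbours E j \<inter> insert n {lo..hi} = {3}"
        using lohi by (intro set_eqI) (subst mem, auto)
      then show ?thesis using 3 by simp
    next
      case 4
      have sub: "{j - 1, Suc j} \<subseteq> neighbours E j \<inter> insert n {lo..hi}"
        using 4 lohi unfolding subset_iff mem by auto
      have "card {j - 1, Suc j} \<le> card (neighbours E j \<inter> insert n {lo..hi})"
        by (intro card_mono sub) simp
      then show ?thesis using 4 lohi by auto
    qed
  qed
  show ?thesis
  proof
    fix k
    have "theta_sub E (Suc i) 3 k = (\<Sum>j\<in>insert n {lo..hi}.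
        (if j = lo \<or> j = hi \<or> j = n then 1 else 2) * eps k j)"
      unfolding theta_sub_def S by (intro sum.cong refl) (simp only: card, simp add: eps_apply)
    also have "\<dots> = (if k \<in> insert n {lo..hi} then if k = lo \<or> k = hi \<or> k = n then 1 else 2 else 0)"
      by (subst sum_eps_mult(2)) auto
    also have "\<dots> = vl (theta_list n i) k"
    proof (cases "1 \<le> k \<and> k \<le> n")
      case True
      have "k - 1 < length [0..<n]" "[0..<n] ! (k - 1) = k - 1" "Suc (k - 1) = k"
        using True by (auto simp: nth_upt)
      then have "theta_list n i ! (k - 1) =
          (if k = n \<or> k - 1 = min i 1 \<or> k - 1 = (if Suc i = n then 3 else max i 3) then 1
           else if min i 1 < k - 1 \<and> k - 1 < (if Suc i = n then 3 else max i 3) then 2 else 0)"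
        unfolding theta_list_def Let_def by (simp only: nth_map)
      moreover have "(k - 1 = min i 1) = (k = lo)" "(k - 1 = (if Suc i = n then 3 else max i 3)) = (k = hi)"
        "(min i 1 < k - 1) = (lo < k)" "(k - 1 < (if Suc i = n then 3 else max i 3)) = (k < hi)"
        using True unfolding lo_def hi_def by auto
      ultimately have "theta_list n i ! (k - 1) =
          (if k = n \<or> k = lo \<or> k = hi then 1 else if lo < k \<and> k < hi then 2 else 0)"
        by (simp only:)
      moreover have "length (theta_list n i) = n" by (simp add: theta_list_def)
      ultimately show ?thesis
        using True lohi unfolding vl_def by auto
    next
      case False
      then show ?thesis using lohi by (auto simp: vl_def theta_list_def)
    qed
    finally show "theta_sub E (Suc i) 3 k = vl (theta_list n i) k" .
  qed
qed

lemma matrix_E: "i < n \<Longrightarrow> j < n \<Longrightarrow> C ! i ! j = e_cartan n i j"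
  by (simp add: e_matrix_def)

lemma elem_list_facts:
  assumes "i < n" "e \<in> set (elem_list n (C ! i) i)"
  shows "e \<in> P" "form E (simple_root E (Suc i)) (vl e) = 0"
    "simple_root E (Suc i) \<or>\<^sub>2 vl e \<in> ncone E"
proof -
  have e: "e \<in> P" "dot (C ! i) e = 0"
    using basis_rowsD[OF basis_ok, of i] assms by auto
  then show "e \<in> P" by blast
  show "form E (simple_root E (Suc i)) (vl e) = 0"
    using pairing_E[OF P_facts(1)[OF e(1)] assms(1)] e(2) assms(1)
    by (simp add: nth_pairing length_C del: form.simps)
  consider j where "j < n" "C ! i ! j = 0" "e = unit_list n j"
    | h j where "h < n" "j < n" "h < j" "C ! i ! h = - 1" "C ! i ! j = - 1" "e = sum3 n h i j"
    | "i \<noteq> 2" "e = theta_list n i"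
    using assms(2) by (auto simp: elem_list_def split: if_splits)
  then show "simple_root E (Suc i) \<or>\<^sub>2 vl e \<in> ncone E"
  proof cases
    case 1
    then have "i \<noteq> j" "\<not> adj E (Suc i) (Suc j)"
      using assms(1) by (auto simp: matrix_E e_cartan_def split: if_splits)
    then have "simple_root E (Suc i) \<or>\<^sub>2 simple_root E (Suc j) \<in> ncone E"
      using 1 assms(1) by (intro vee_simple_orthogonal) auto
    then show ?thesis using vl_unit[OF 1(1)] 1(3) by (simp only:)
  next
    case 2
    then have adj: "h \<noteq> i" "j \<noteq> i" "adj E (Suc h) (Suc i)" "adj E (Suc i) (Suc j)"
      using assms(1) by (auto simp: matrix_E e_cartan_def adj_commute[of _ "Suc h"] split: if_splits)
    have vl: "vl e = simple_root E (Suc h) + simple_root E (Suc i) + simple_root E (Suc j)"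
      using 2 adj assms(1) by (auto simp: fun_eq_iff vl_def sum3_def eps_apply nth_list_update)
    have "simple_root E (Suc h) + simple_root E (Suc i) + simple_root E (Suc j) \<in> roots E"
      using P_facts(2)[OF e(1)] by (simp only: vl)
    then have "simple_root E (Suc i) \<or>\<^sub>2
        (simple_root E (Suc h) + simple_root E (Suc i) + simple_root E (Suc j)) \<in> ncone E"
      using 2 adj assms(1) by (intro vee_path_sum) auto
    then show ?thesis by (simp only: vl)
  next
    case 3
    have "simple_root E (Suc i) \<or>\<^sub>2 theta_sub E (Suc i) 3 \<in> ncone E"
      using P_facts[OF e(1)] assms(1) 3 branch_E
      by (intro vee_theta_sub) (auto simp: theta_sub_E)
    then show ?thesis using theta_sub_E[OF assms(1) 3(1)] 3(2) by (simp only:)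
  qed
qed

text \<open>Induction on the height: subtract the elementary root that the check \<open>reducible\<close> provides.\<close>

lemma simple_vee_ncone_E:
  assumes "i < n" "xs \<in> P" "pairing C xs ! i = 0"
  shows "simple_root E (Suc i) \<or>\<^sub>2 vl xs \<in> ncone E"
  using assms(2,3)
proof (induction "nat (sum_list xs)" arbitrary: xs rule: less_induct)
  case less
  have "reducible_rows i (annotate C (elem_list n (C ! i) i)) (annotate C (concat (e_levels n)))"
    using basis_rowsD[OF basis_ok, of i] assms(1) by simp
  from reducibleD[OF reducible_rowsD[OF this less(2,3)]]
  show ?case
  proof
    assume "xs \<in> set (elem_list n (C ! i) i)"
    then show ?thesis using elem_list_facts(3)[OF assms(1)] by blast
  next
    assume "\<exists>ys\<in>set (elem_list n (C ! i) i). dot xs (pairing C ys) = 1 \<and> sum_list ys < sum_list xs"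
    then obtain ys where ys: "ys \<in> set (elem_list n (C ! i) i)" "dot xs (pairing C ys) = 1"
      "sum_list ys < sum_list xs" by blast
    note y = elem_list_facts[OF assms(1) ys(1)]
    note lx = P_facts(1)[OF less(2)] and ly = P_facts(1)[OF y(1)]
    have "form E (vl xs) (vl ys) = 1" using dot_E[OF lx ly] ys(2) by simp
    then have "vl xs - vl ys \<in> roots E"
      by (rule root_diff[OF fin_E P_facts(2)[OF less(2)] P_facts(2)[OF y(1)]])
    moreover have h: "height E (vl xs - vl ys) = of_int (sum_list xs - sum_list ys)"
      by (simp add: height_diff height_E lx ly)
    moreover have "height E (vl xs - vl ys) > 0" using ys(3) by (simp add: h)
    ultimately obtain zs where zs: "zs \<in> P" "vl xs - vl ys = vl zs"
      using pos_roots_E_cases by blast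
    have lz: "length zs = n" using P_facts(1)[OF zs(1)] .
    have "of_int (sum_list zs) = (of_int (sum_list xs - sum_list ys) :: real)"
      using h height_E[OF lz] by (simp only: zs(2))
    then have sz: "sum_list zs = sum_list xs - sum_list ys" by (simp only: of_int_eq_iff)
    have "sum_list ys > 0"
    proof -
      have "height E (vl ys) \<ge> 0" using nonneg_comb_height(1)[OF fin_E] P_facts[OF y(1)] by blast
      moreover have "height E (vl ys) \<noteq> 0"
      proof
        assume "height E (vl ys) = 0"
        then have "vl ys = 0" using nonneg_comb_height(2)[OF fin_E] P_facts[OF y(1)] by blast
        then show False
          using root_norm[OF fin_E P_facts(2)[OF y(1)]] form_smul[of E 0 0 0] by (simp del: form.simps)
      qed
      ultimately show ?thesis by (simp add: height_E[OF ly])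
    qed
    then have "nat (sum_list zs) < nat (sum_list xs)" using sz ys(3) by simp
    moreover have "pairing C zs ! i = 0"
    proof -
      have "form E (simple_root E (Suc i)) (vl zs) = 0"
        using y(2) pairing_E[OF lx assms(1)] less(3) unfolding zs(2)[symmetric] form_diff
        by (simp del: form.simps)
      then show ?thesis using pairing_E[OF lz assms(1)] by (simp del: form.simps)
    qed
    ultimately have "simple_root E (Suc i) \<or>\<^sub>2 vl zs \<in> ncone E" using less(1) zs(1) by blast
    moreover have "vl ys + vl zs = vl xs" by (simp only: zs(2)[symmetric]) (simp add: fun_eq_iff)
    ultimately show ?thesis
      using ncone_add[OF y(3)] by (metis vee_linear(4))
  qed
qed

lemma two_root_system_E: "two_root_system E"
proof
  show "simply_laced_finite E" by (rule fin_E)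
  show "\<exists>M. \<forall>\<alpha>\<in>roots E. height E \<alpha> \<le> M"
  proof (intro exI ballI)
    fix \<alpha> assume "\<alpha> \<in> roots E"
    then obtain xs where "xs \<in> P" "\<alpha> = vl xs \<or> \<alpha> = - vl xs" by (rule roots_E_cases)
    then have "\<alpha> \<in> vl ` P \<union> uminus ` vl ` P" by blast
    then show "height E \<alpha> \<le> Max (height E ` (vl ` P \<union> uminus ` vl ` P))"
      by (intro Max_ge) auto
  qed
  show "nonneg_comb_simple E \<alpha> \<or> nonneg_comb_simple E (- \<alpha>)" if "\<alpha> \<in> roots E" for \<alpha>
    using roots_E_cases[OF that] P_facts(3) by (metis minus_minus)
  show "form E (simple_root E i) \<alpha> \<in> {- 1, 0, 1} \<or> \<alpha> = simple_root E i \<or> \<alpha> = - simple_root E i"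
    if \<alpha>: "\<alpha> \<in> roots E" and i: "i \<in> vertices E" for \<alpha> i
  proof -
    obtain xs where xs: "xs \<in> P" "\<alpha> = vl xs \<or> \<alpha> = - vl xs" using roots_E_cases[OF \<alpha>] .
    have i': "i - 1 < n" "Suc (i - 1) = i" using i by auto
    have "form E (simple_root E i) (vl xs) \<in> {- 1, 0, 1} \<or> vl xs = simple_root E i"
      using P_reflection(2)[OF xs(1) i'(1)]
    proof
      assume "pairing C xs ! (i - 1) \<in> {- 1, 0, 1}"
      then show ?thesis
        using pairing_E[OF P_facts(1)[OF xs(1)] i'(1)] i'(2) by (auto simp del: form.simps)
    next
      assume "xs = unit_list n (i - 1)"
      then show ?thesis using vl_unit[OF i'(1)] by (simp only: i'(2) simp_thms)
    qed
    then show ?thesis using xs(2) by (auto simp: form_minus simp del: form.simps simple_root.simps)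
  qed
  show "simple_root E i \<or>\<^sub>2 \<alpha> \<in> ncone E"
    if \<alpha>: "\<alpha> \<in> roots E" "0 < height E \<alpha>" and i: "i \<in> vertices E" and o: "form E (simple_root E i) \<alpha> = 0" for \<alpha> i
  proof -
    obtain xs where xs: "xs \<in> P" "\<alpha> = vl xs" using pos_roots_E_cases[OF \<alpha>] .
    have i': "i - 1 < n" "Suc (i - 1) = i" using i by auto
    have "pairing C xs ! (i - 1) = 0"
      using pairing_E[OF P_facts(1)[OF xs(1)] i'(1)] o i'(2) by (simp add: xs(2) del: form.simps)
    then show ?thesis
      using simple_vee_ncone_E[OF i'(1) xs(1)] unfolding xs(2) i'(2) by blast
  qed
qed

end

sublocale type_E \<subseteq> two_root_system "DynkinE n"
  by (rule two_root_system_E)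

context type_E
begin

lemma highest_root_E:
  assumes "t \<in> P" "all_dominated t (concat (e_levels n))"
  shows "highest_root E = vl t"
proof (rule highest_rootI)
  show "vl t \<in> roots E" using P_facts(2)[OF assms(1)] .
  have t: "length t = n" using P_facts(1)[OF assms(1)] .
  have diff: "nonneg_comb_simple E (vl t - vl xs)" if "xs \<in> P" for xs
  proof -
    have xs: "length xs = n" using P_facts(1)[OF that] .
    have "vl t - vl xs = vl (map2 (-) t xs)"
      using t xs by (auto simp: fun_eq_iff vl_def)
    moreover have "nonneg_comb_simple E (vl (map2 (-) t xs))"
    proof (rule nonneg_E)
      show "0 \<le> map2 (-) t xs ! i" if "i < n" for i
        using dominatedD[OF all_dominatedD[OF assms(2) \<open>xs \<in> P\<close>], of i] t xs that by simp
    qed (use t xs in simp)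
    ultimately show ?thesis by (simp only:)
  qed
  fix \<beta> assume "\<beta> \<in> roots E"
  then obtain xs where xs: "xs \<in> P" "\<beta> = vl xs \<or> \<beta> = - vl xs" by (rule roots_E_cases)
  from xs(2) show "nonneg_comb_simple E (vl t - \<beta>)"
  proof
    assume "\<beta> = - vl xs"
    then show ?thesis
      using nonneg_comb_add[OF P_facts(3)[OF assms(1)] P_facts(3)[OF xs(1)]]
      by (simp only: diff_minus_eq_add)
  qed (use diff[OF xs(1)] in \<open>simp only:\<close>)
qed

lemma y_index_E:
  assumes "highest_root E = vl t" "t \<in> P" "y \<in> {1..n}" "pairing C t = unit_list n (y - 1)"
  shows "y_index E = y"
  unfolding y_index_def
proof (rule the_equality)
  have form: "form E (simple_root E i) (highest_root E) = (if i = y then 1 else 0)"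
    if "i \<in> vertices E" for i
  proof -
    have i: "i - 1 < n" "Suc (i - 1) = i" using that by auto
    have "form E (simple_root E i) (highest_root E) = of_int (unit_list n (y - 1) ! (i - 1))"
      using pairing_E[OF P_facts(1)[OF assms(2)] i(1)] i(2) by (simp add: assms(1,4) del: form.simps)
    also have "\<dots> = (if i = y then 1 else 0)"
      using i assms(3) by (auto simp: unit_list_def nth_list_update)
    finally show ?thesis .
  qed
  show "y \<in> vertices E \<and> form E (simple_root E y) (highest_root E) \<noteq> 0"
    using form[of y] assms(3) by (simp del: form.simps simple_root.simps)
  show "i = y" if "i \<in> vertices E \<and> form E (simple_root E i) (highest_root E) \<noteq> 0" for i
    using form[of i] that by (simp del: form.simps simple_root.simps split: if_splits)
qed

text \<open>By the check \<open>max_rows\<close>, every orthogonal pair of different listed roots other than the stated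
one has a sum that is not dominant or is improved by a simple reflection.\<close>

lemma highest_two_root_E:
  assumes max: "max_rows q1 q2 (annotate C (concat (e_levels n)))"
    and q: "q1 \<in> P" "q2 \<in> P" "dot q1 (pairing C q2) = 0"
  shows "two_root_orbits E = {orbit E (vl q1 \<or>\<^sub>2 vl q2)}"
    and "is_highest E (orbit E (vl q1 \<or>\<^sub>2 vl q2)) (vl q1 \<or>\<^sub>2 vl q2)"
proof -
  note r = P_facts(2)[OF q(1)] P_facts(2)[OF q(2)]
  have p: "height E (vl q1) > 0" "height E (vl q2) > 0"
    using P_facts[OF q(1)] P_facts[OF q(2)] root_pos_iff by blast+
  have o: "form E (vl q1) (vl q2) = 0"
    using dot_E P_facts(1)[OF q(1)] P_facts(1)[OF q(2)] q(3) by (simp del: form.simps)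
  have top: "vl xs \<or>\<^sub>2 vl ys = vl q1 \<or>\<^sub>2 vl q2"
    if xs: "xs \<in> P" and ys: "ys \<in> P" and o: "form E (vl xs) (vl ys) = 0"
      and max: "\<And>i. i \<in> vertices E \<Longrightarrow> height E (reflection E i (vl xs)) * height E (reflection E i (vl ys))
        \<le> height E (vl xs) * height E (vl ys)"
      and pair: "max_pair q1 q2 C xs ys" for xs ys
  proof -
    note lx = P_facts(1)[OF xs] and ly = P_facts(1)[OF ys]
    note rx = P_facts(2)[OF xs] and ry = P_facts(2)[OF ys]
    have pos: "height E (vl xs) > 0" "height E (vl ys) > 0"
      using P_facts[OF xs] P_facts[OF ys] root_pos_iff by blast+
    have "\<not> neg_sum (pairing C xs) (pairing C ys)"
    proof
      assume "neg_sum (pairing C xs) (pairing C ys)"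
      then obtain i where i: "i < n" "pairing C xs ! i + pairing C ys ! i < 0"
        using neg_sumD by (fastforce simp: length_pairing length_C)
      have v: "Suc i \<in> vertices E" using i by simp
      have "0 \<le> form E (eps (Suc i)) (vl xs + vl ys)"
        using sum_dominant[OF rx ry o pos v max[OF v]] by (simp del: form.simps)
      then show False
        using i by (simp add: form_add pairing_E lx ly del: form.simps)
    qed
    moreover have "\<not> climbs (sum_list xs) (sum_list ys) (pairing C xs) (pairing C ys)"
    proof
      assume "climbs (sum_list xs) (sum_list ys) (pairing C xs) (pairing C ys)"
      then obtain i where i: "i < n" and lt: "pairing C xs ! i * sum_list ys + pairing C ys ! i * sum_list xs
          < pairing C xs ! i * pairing C ys ! i"
        using climbsD by (fastforce simp: length_pairing length_C)
      have v: "Suc i \<in> vertices E" using i by simp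
      have "height E (reflection E (Suc i) (vl xs)) = of_int (sum_list xs - pairing C xs ! i)"
        "height E (reflection E (Suc i) (vl ys)) = of_int (sum_list ys - pairing C ys ! i)"
        unfolding h_reflection[OF v] using pairing_E[OF lx i] pairing_E[OF ly i]
        by (simp_all add: height_E lx ly del: form.simps)
      then have "real_of_int ((sum_list xs - pairing C xs ! i) * (sum_list ys - pairing C ys ! i)) \<le>
          of_int (sum_list xs * sum_list ys)"
        using max[OF v] by (simp only: height_E lx ly of_int_mult)
      then have "(sum_list xs - pairing C xs ! i) * (sum_list ys - pairing C ys ! i) \<le> sum_list xs * sum_list ys"
        by (simp only: of_int_le_iff)
      then show False using lt by (simp add: algebra_simps)
    qed
    moreover have "dot xs (pairing C ys) = 0" using dot_E[OF lx ly] o by (simp del: form.simps)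
    ultimately have "xs = q1 \<and> ys = q2 \<or> xs = q2 \<and> ys = q1"
      using pair unfolding max_pair_def by blast
    then show ?thesis using vee_commute by blast
  qed
  have max: "\<alpha> \<or>\<^sub>2 \<beta> = vl q1 \<or>\<^sub>2 vl q2"
    if \<alpha>\<beta>: "\<alpha> \<in> roots E" "\<beta> \<in> roots E" and o: "form E \<alpha> \<beta> = 0"
      and pos: "height E \<alpha> > 0" "height E \<beta> > 0"
      and m: "\<And>i. i \<in> vertices E \<Longrightarrow> height E (reflection E i \<alpha>) * height E (reflection E i \<beta>)
        \<le> height E \<alpha> * height E \<beta>" for \<alpha> \<beta>
  proof -
    obtain xs where xs: "xs \<in> P" "\<alpha> = vl xs" using pos_roots_E_cases[OF \<alpha>\<beta>(1) pos(1)] .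
    obtain ys where ys: "ys \<in> P" "\<beta> = vl ys" using pos_roots_E_cases[OF \<alpha>\<beta>(2) pos(2)] .
    have "xs \<noteq> ys"
    proof
      assume "xs = ys"
      then show False using o root_norm[OF fin_E \<alpha>\<beta>(1)] by (simp add: xs(2) ys(2) del: form.simps)
    qed
    then have "max_pair q1 q2 C xs ys \<or> max_pair q1 q2 C ys xs"
      using max_rowsD[OF max xs(1) ys(1)] by blast
    then show ?thesis
    proof
      assume "max_pair q1 q2 C xs ys"
      then show ?thesis using top[OF xs(1) ys(1)] o m unfolding xs(2) ys(2) by blast
    next
      assume pair: "max_pair q1 q2 C ys xs"
      have "vl ys \<or>\<^sub>2 vl xs = vl q1 \<or>\<^sub>2 vl q2"
        by (rule top[OF ys(1) xs(1) _ _ pair])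
          (use o m in \<open>simp_all only: xs(2) ys(2) form_commute[of _ "vl ys"] mult.commute\<close>)
      then show ?thesis unfolding xs(2) ys(2) by (simp only: vee_commute[of "vl xs"])
    qed
  qed
  note H = highest_in_orbit[where Q = "\<lambda>_. True", OF r p o TrueI TrueI max]
  show "is_highest E (orbit E (vl q1 \<or>\<^sub>2 vl q2)) (vl q1 \<or>\<^sub>2 vl q2)" by (rule H(1))
  show "two_root_orbits E = {orbit E (vl q1 \<or>\<^sub>2 vl q2)}"
    unfolding two_root_orbits_def using H(3,4) by blast
qed

end


section \<open>The highest 2-roots, type by type\<close>

lemma highest_two_roots_A:
  "\<forall>n > 2.
        let \<Gamma> = DynkinA n;
            q = path_root \<Gamma> 1 (n - 1) \<or>\<^sub>2 path_root \<Gamma> 2 n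
        in two_root_orbits \<Gamma> = {orbit \<Gamma> q} \<and>
           is_highest \<Gamma> (orbit \<Gamma> q) q \<and>
           q = (eps 1 - eps n) \<or>\<^sub>2 (eps 2 - eps (n + 1))"
  (is "\<forall>n > 2. ?P n")
proof (intro allI impI)
  fix n :: nat assume n: "n > 2"
  have "path_root (DynkinA n) 1 (n - 1) = eps 1 - eps (n - 1 + 1)"
    using n by (intro path_root_A) auto
  moreover have "n - 1 + 1 = n" using n by simp
  moreover have "path_root (DynkinA n) 2 n = eps 2 - eps (n + 1)"
    using n by (intro path_root_A) auto
  ultimately have q: "path_root (DynkinA n) 1 (n - 1) \<or>\<^sub>2 path_root (DynkinA n) 2 n =
      (eps 1 - eps n) \<or>\<^sub>2 (eps 2 - eps (n + 1))"
    by (simp only:)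
  show "?P n"
    unfolding Let_def q using highest_two_root_A[OF n] by blast
qed

lemma vee_difference_of_squares: "(u - v) \<or>\<^sub>2 (u + v) = u \<or>\<^sub>2 u - v \<or>\<^sub>2 v"
  by (simp add: vee_def fun_eq_iff algebra_simps)

lemma highest_two_roots_D4:
  "let \<Gamma> = DynkinD 4;
          \<theta> = highest_root \<Gamma>;
          q1 = (\<theta> - path_root \<Gamma> 2 4) \<or>\<^sub>2 (\<theta> - path_root \<Gamma> 2 3);
          q2 = (\<theta> - path_root \<Gamma> 2 4) \<or>\<^sub>2 (\<theta> - path_root \<Gamma> 1 2);
          q3 = (\<theta> - path_root \<Gamma> 2 3) \<or>\<^sub>2 (\<theta> - path_root \<Gamma> 1 2)
      in two_root_orbits \<Gamma> = {orbit \<Gamma> q1, orbit \<Gamma> q2, orbit \<Gamma> q3} \<and>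
         card (two_root_orbits \<Gamma>) = 3 \<and>
         is_highest \<Gamma> (orbit \<Gamma> q1) q1 \<and>
         q1 = path_root \<Gamma> 1 3 \<or>\<^sub>2 path_root \<Gamma> 1 4 \<and>
         q1 = (eps 1 - eps 4) \<or>\<^sub>2 (eps 1 + eps 4) \<and>
         q1 = eps 1 \<or>\<^sub>2 eps 1 - eps 4 \<or>\<^sub>2 eps 4 \<and>
         is_highest \<Gamma> (orbit \<Gamma> q2) q2 \<and>
         q2 = path_root \<Gamma> 1 3 \<or>\<^sub>2 path_root \<Gamma> 3 4 \<and>
         q2 = (eps 1 - eps 4) \<or>\<^sub>2 (eps 2 + eps 3) \<and>
         is_highest \<Gamma> (orbit \<Gamma> q3) q3 \<and>
         q3 = path_root \<Gamma> 1 4 \<or>\<^sub>2 path_root \<Gamma> 3 4 \<and>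
         q3 = (eps 1 + eps 4) \<or>\<^sub>2 (eps 2 + eps 3)"
proof -
  interpret type_D 4 by unfold_locales simp
  let ?G = "DynkinD 4"
  have p: "path_root ?G 2 4 = eps 2 + eps 4" "path_root ?G 2 3 = eps 2 - eps 4"
    "path_root ?G 1 2 = eps 1 - eps 3" "path_root ?G 1 3 = eps 1 - eps 4"
    "path_root ?G 1 4 = eps 1 + eps 4"
    using path_root_D(2)[of 2] path_root_D(1)[of 2 3] path_root_D(1)[of 1 2] path_root_D(1)[of 1 3]
      path_root_D(2)[of 1] by simp_all
  have p34: "path_root ?G 3 4 = eps 2 + eps 3"
  proof -
    have "path_vertices ?G 3 4 = insert 3 (path_vertices ?G 2 4)"
      using path_vertices_rec(2)[OF rooted_tree_D_leaf(2), of 3] by simp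
    also have "path_vertices ?G 2 4 = {2, 4}" using path_D_last[of 2] by auto
    finally show ?thesis by (simp add: path_root_def fun_eq_iff)
  qed
  have \<theta>: "highest_root ?G - path_root ?G 2 4 = eps 1 - eps 4"
    "highest_root ?G - path_root ?G 2 3 = eps 1 + eps 4"
    "highest_root ?G - path_root ?G 1 2 = eps 2 + eps 3"
    unfolding highest_root_D p by (simp_all add: fun_eq_iff)
  define q1 where "q1 = (eps 1 - eps 4) \<or>\<^sub>2 (eps 1 + eps 4)"
  define q2 where "q2 = (eps 1 - eps 4) \<or>\<^sub>2 (eps 2 + eps 3)"
  define q3 where "q3 = (eps 1 + eps 4) \<or>\<^sub>2 (eps 2 + eps 3)"
  note H1 = highest_small_D[folded q1_def]
  have s: "eps 1 + smul (- 1) (eps 4) = eps 1 - eps 4" "eps 1 + smul 1 (eps 4) = eps 1 + eps 4"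
    by (simp_all add: fun_eq_iff)
  have \<sigma>: "(- 1 :: real) = 1 \<or> (4 :: nat) = 4 \<and> (- 1 :: real) = - 1" "(1 :: real) = 1 \<or> (4 :: nat) = 4 \<and> (1 :: real) = - 1"
    by simp_all
  note H2 = highest_large_D[OF \<sigma>(1), unfolded s, folded q2_def]
  note H3 = highest_large_D[OF \<sigma>(2), unfolded s, folded q3_def]
  have orbits: "two_root_orbits ?G = {orbit ?G q1, orbit ?G q2, orbit ?G q3}"
  proof
    show "two_root_orbits ?G \<subseteq> {orbit ?G q1, orbit ?G q2, orbit ?G q3}"
      unfolding two_root_orbits_def
    proof (intro image_subsetI)
      fix p assume p: "p \<in> two_roots ?G"
      show "orbit ?G p \<in> {orbit ?G q1, orbit ?G q2, orbit ?G q3}"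
      proof (cases "\<exists>k. p k k \<noteq> 0")
        case True
        then show ?thesis using H1(3)[OF p] by blast
      next
        case False
        then have "large_class 1 p \<or> large_class (- 1) p"
          using large_class_cases[OF refl p] by blast
        then show ?thesis using H2(3)[OF p] H3(3)[OF p] by blast
      qed
    qed
    show "{orbit ?G q1, orbit ?G q2, orbit ?G q3} \<subseteq> two_root_orbits ?G"
      unfolding two_root_orbits_def using H1(4) H2(4) H3(4) by blast
  qed
  have self: "q1 \<in> orbit ?G q1" "q2 \<in> orbit ?G q2" "q3 \<in> orbit ?G q3"
    using H1(1) H2(1) H3(1) by (simp_all only: is_highest_def)
  have cls: "\<exists>k. q1 k k \<noteq> 0" "large_class (- 1) q2" "large_class 1 q3"
    using H1(2)[OF H1(4)] H2(2)[OF H2(4)] H3(2)[OF H3(4)] self by blast+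
  then have "\<not> large_class (- 1) q1" "\<not> large_class 1 q1" "\<not> large_class 1 q2"
    by (auto simp: large_class_def)
  then have "orbit ?G q1 \<noteq> orbit ?G q2" "orbit ?G q1 \<noteq> orbit ?G q3" "orbit ?G q2 \<noteq> orbit ?G q3"
    using self H2(2)[OF H1(4)] H3(2)[OF H1(4)] H3(2)[OF H2(4)] by metis+
  then have card: "card (two_root_orbits ?G) = 3" by (simp add: orbits)
  have sq: "q1 = eps 1 \<or>\<^sub>2 eps 1 - eps 4 \<or>\<^sub>2 eps 4"
    unfolding q1_def by (rule vee_difference_of_squares)
  show ?thesis
    unfolding Let_def \<theta>
    unfolding p p34 q1_def[symmetric] q2_def[symmetric] q3_def[symmetric]
    by (intro conjI refl orbits card sq H1(1) H2(1) H3(1))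
qed

lemma highest_two_roots_D:
  "\<forall>n \<ge> 5.
        let \<Gamma> = DynkinD n;
            \<theta> = highest_root \<Gamma>;
            qs = path_root \<Gamma> 1 (n - 1) \<or>\<^sub>2 path_root \<Gamma> 1 n;
            ql = (\<theta> - path_root \<Gamma> 1 2) \<or>\<^sub>2 (\<theta> - path_root \<Gamma> 2 3)
        in two_root_orbits \<Gamma> = {orbit \<Gamma> qs, orbit \<Gamma> ql} \<and>
           orbit \<Gamma> qs \<inter> pos_two_roots \<Gamma> = small_pos_two_roots n \<and>
           is_highest \<Gamma> (orbit \<Gamma> qs) qs \<and>
           qs = (eps 1 - eps n) \<or>\<^sub>2 (eps 1 + eps n) \<and>
           qs = eps 1 \<or>\<^sub>2 eps 1 - eps n \<or>\<^sub>2 eps n \<and>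
           orbit \<Gamma> ql \<inter> pos_two_roots \<Gamma> = large_pos_two_roots n \<and>
           is_highest \<Gamma> (orbit \<Gamma> ql) ql \<and>
           ql = (\<theta> - simple_root \<Gamma> 1 - simple_root \<Gamma> 2) \<or>\<^sub>2
                (\<theta> - simple_root \<Gamma> 2 - simple_root \<Gamma> 3) \<and>
           ql = (eps 2 + eps 3) \<or>\<^sub>2 (eps 1 + eps 4)"
  (is "\<forall>n \<ge> 5. ?P n")
proof (intro allI impI)
  fix n :: nat assume n5: "5 \<le> n"
  interpret type_D n by unfold_locales (use n5 in simp)
  let ?G = "DynkinD n"
  have "n - 1 + 1 = n" using n5 by simp
  then have p: "path_root ?G 1 (n - 1) = eps 1 - eps n" "path_root ?G 1 n = eps 1 + eps n"
    "path_root ?G 1 2 = eps 1 - eps 3" "path_root ?G 2 3 = eps 2 - eps 4"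
    using path_root_D(1)[of 1 "n - 1"] path_root_D(2)[of 1] path_root_D(1)[of 1 2]
      path_root_D(1)[of 2 3] n5 by simp_all
  have \<theta>: "highest_root ?G - path_root ?G 1 2 = eps 2 + eps 3"
    "highest_root ?G - path_root ?G 2 3 = eps 1 + eps 4"
    "highest_root ?G - simple_root ?G 1 - simple_root ?G 2 = eps 2 + eps 3"
    "highest_root ?G - simple_root ?G 2 - simple_root ?G 3 = eps 1 + eps 4"
    unfolding highest_root_D p using n5 by (simp_all add: fun_eq_iff eval_nat_numeral)
  define qs where "qs = (eps 1 - eps n) \<or>\<^sub>2 (eps 1 + eps n)"
  define ql where "ql = (eps 2 + eps 3) \<or>\<^sub>2 (eps 1 + eps 4)"
  note H1 = highest_small_D[folded qs_def]
  have s: "(eps 1 + smul 1 (eps 4)) \<or>\<^sub>2 (eps 2 + eps 3) = ql"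
    unfolding ql_def by (simp add: vee_commute)
  have \<sigma>: "(1 :: real) = 1 \<or> n = 4 \<and> (1 :: real) = - 1" by simp
  note H2 = highest_large_D[OF \<sigma>, unfolded s]
  have cls: "large_class 1 p \<longleftrightarrow> \<not> (\<exists>k. p k k \<noteq> 0)" for p
    using n5 by (simp add: large_class_def)
  have orbits: "two_root_orbits ?G = {orbit ?G qs, orbit ?G ql}"
  proof
    show "two_root_orbits ?G \<subseteq> {orbit ?G qs, orbit ?G ql}"
      unfolding two_root_orbits_def using H1(3) H2(3) cls by blast
    show "{orbit ?G qs, orbit ?G ql} \<subseteq> two_root_orbits ?G"
      unfolding two_root_orbits_def using H1(4) H2(4) by blast
  qed
  have sub: "pos_two_roots ?G \<subseteq> two_roots ?G"
    unfolding pos_two_roots_def two_roots_def pos_roots_def by blast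
  have small: "orbit ?G qs \<inter> pos_two_roots ?G = small_pos_two_roots n"
    unfolding pos_two_roots_D_small using H1(2) sub by blast
  have sq: "qs = eps 1 \<or>\<^sub>2 eps 1 - eps n \<or>\<^sub>2 eps n"
    unfolding qs_def by (rule vee_difference_of_squares)
  have large: "orbit ?G ql \<inter> pos_two_roots ?G = large_pos_two_roots n"
    unfolding large_pos_two_roots_def pos_two_roots_D_small using H2(2) sub cls by blast
  show "?P n"
    unfolding Let_def \<theta>
    unfolding p qs_def[symmetric] ql_def[symmetric]
    by (intro conjI refl orbits small large sq H1(1) H2(1))
qed

interpretation E6: type_E 6
  by unfold_locales (simp, code_simp, code_simp)

interpretation E7: type_E 7
  by unfold_locales (simp, code_simp, code_simp)

interpretation E8: type_E 8
  by unfold_locales (simp, code_simp, code_simp)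

lemma path_root_E:
  assumes "path_vertices (DynkinE n) b c = S" "finite S"
  shows "path_root (DynkinE n) b c = (\<lambda>k. if k \<in> S then 1 else 0)"
proof -
  have "(\<Sum>i\<in>S. eps i) k = (if k \<in> S then 1 else 0)" for k
    using assms(2) by (induction S rule: finite_induct) (auto simp: eps_apply)
  then show ?thesis unfolding path_root_def assms(1) by (auto simp: fun_eq_iff)
qed

lemma highest_two_roots_E6:
  "let \<Gamma> = DynkinE 6; x = 6; y = y_index \<Gamma>;
          \<theta> = highest_root \<Gamma>;
          q = (\<theta> - path_root \<Gamma> 2 x) \<or>\<^sub>2 (\<theta> - path_root \<Gamma> 4 x)
      in two_root_orbits \<Gamma> = {orbit \<Gamma> q} \<and>
         is_highest \<Gamma> (orbit \<Gamma> q) q \<and>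
         q = (\<theta> - path_root \<Gamma> 2 y) \<or>\<^sub>2 (\<theta> - path_root \<Gamma> 4 y)"
proof -
  \<comment> \<open>The coordinates of the highest root and of its differences with the two path roots.\<close>
  let ?G = "DynkinE 6" and ?t = "[1, 2, 3, 2, 1, 2]"
  let ?q1 = "[1, 1, 2, 2, 1, 1]" and ?q2 = "[1, 2, 2, 1, 1, 1]"
  have tree: "rooted_tree ?G 6 (\<lambda>v. if v < 3 then Suc v else if v = 3 then 6 else v - 1)
      (\<lambda>v. if v < 3 then 4 - v else if v = 6 then 0 else v - 2)"
    by code_simp
  have paths: "path_vertices ?G 2 6 = {2, 3, 6}" "path_vertices ?G 4 6 = {3, 4, 6}"
    by (simp_all add: path_vertices_rec[OF tree] insert_commute)
  have fin: "finite {2, 3, 6 :: nat}" "finite {3, 4, 6 :: nat}" by simp_all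
  have mem: "mem ?t (concat (e_levels 6)) \<and> mem ?q1 (concat (e_levels 6)) \<and> mem ?q2 (concat (e_levels 6)) \<and>
    all_dominated ?t (concat (e_levels 6)) \<and> pairing (e_matrix 6) ?t = unit_list 6 5 \<and>
    dot ?q1 (pairing (e_matrix 6) ?q2) = 0"
    by code_simp
  have max: "max_rows ?q1 ?q2 (annotate (e_matrix 6) (concat (e_levels 6)))"
    by code_simp
  have t: "highest_root ?G = vl ?t"
    using E6.highest_root_E[of ?t] mem by (simp only: mem_iff)
  have y: "y_index ?G = 6"
    using E6.y_index_E[OF t, of 6] mem by (simp add: mem_iff del: set_concat)
  have q: "highest_root ?G - path_root ?G 2 6 = vl ?q1" "highest_root ?G - path_root ?G 4 6 = vl ?q2"
    unfolding t path_root_E[OF paths(1) fin(1)] path_root_E[OF paths(2) fin(2)]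
    by (auto simp: fun_eq_iff vl_def nth_Cons eval_nat_numeral split: nat.splits)
  show ?thesis
    unfolding Let_def y q using E6.highest_two_root_E[OF max] mem by (simp only: mem_iff simp_thms)
qed

lemma highest_two_roots_E7:
  "let \<Gamma> = DynkinE 7; x = 7; y = y_index \<Gamma>;
          \<theta> = highest_root \<Gamma>;
          q = (\<theta> - path_root \<Gamma> x 1) \<or>\<^sub>2 (\<theta> - path_root \<Gamma> 4 1)
      in two_root_orbits \<Gamma> = {orbit \<Gamma> q} \<and>
         is_highest \<Gamma> (orbit \<Gamma> q) q \<and>
         q = (\<theta> - path_root \<Gamma> x y) \<or>\<^sub>2 (\<theta> - path_root \<Gamma> 4 y)"
proof -
  \<comment> \<open>The coordinates of the highest root and of its differences with the two path roots.\<close>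
  let ?G = "DynkinE 7" and ?t = "[2, 3, 4, 3, 2, 1, 2]"
  let ?q1 = "[1, 2, 3, 3, 2, 1, 1]" and ?q2 = "[1, 2, 3, 2, 2, 1, 2]"
  have tree: "rooted_tree ?G 1 (\<lambda>v. if v = 7 then 3 else v - 1) (\<lambda>v. if v = 7 then 4 else v)"
    by code_simp
  have paths: "path_vertices ?G 7 1 = {1, 2, 3, 7}" "path_vertices ?G 4 1 = {1, 2, 3, 4}"
    by (simp_all add: path_vertices_rec[OF tree[unfolded One_nat_def]] insert_commute)
  have fin: "finite {1, 2, 3, 7 :: nat}" "finite {1, 2, 3, 4 :: nat}" by simp_all
  have mem: "mem ?t (concat (e_levels 7)) \<and> mem ?q1 (concat (e_levels 7)) \<and> mem ?q2 (concat (e_levels 7)) \<and>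
    all_dominated ?t (concat (e_levels 7)) \<and> pairing (e_matrix 7) ?t = unit_list 7 0 \<and>
    dot ?q1 (pairing (e_matrix 7) ?q2) = 0"
    by code_simp
  have max: "max_rows ?q1 ?q2 (annotate (e_matrix 7) (concat (e_levels 7)))"
    by code_simp
  have t: "highest_root ?G = vl ?t"
    using E7.highest_root_E[of ?t] mem by (simp only: mem_iff)
  have y: "y_index ?G = 1"
    using E7.y_index_E[OF t, of 1] mem by (simp add: mem_iff del: set_concat)
  have q: "highest_root ?G - path_root ?G 7 1 = vl ?q1" "highest_root ?G - path_root ?G 4 1 = vl ?q2"
    unfolding t path_root_E[OF paths(1) fin(1)] path_root_E[OF paths(2) fin(2)]
    by (auto simp: fun_eq_iff vl_def nth_Cons eval_nat_numeral split: nat.splits)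
  show ?thesis
    unfolding Let_def y q using E7.highest_two_root_E[OF max] mem by (simp only: mem_iff simp_thms)
qed

lemma highest_two_roots_E8:
  "let \<Gamma> = DynkinE 8; x = 8; y = y_index \<Gamma>;
          \<theta> = highest_root \<Gamma>;
          q = (\<theta> - path_root \<Gamma> 2 7) \<or>\<^sub>2 (\<theta> - path_root \<Gamma> x 7)
      in two_root_orbits \<Gamma> = {orbit \<Gamma> q} \<and>
         is_highest \<Gamma> (orbit \<Gamma> q) q \<and>
         q = (\<theta> - path_root \<Gamma> 2 y) \<or>\<^sub>2 (\<theta> - path_root \<Gamma> x y)"
proof -
  \<comment> \<open>The coordinates of the highest root and of its differences with the two path roots.\<close>
  let ?G = "DynkinE 8" and ?t = "[2, 4, 6, 5, 4, 3, 2, 3]"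
  let ?q1 = "[2, 3, 5, 4, 3, 2, 1, 3]" and ?q2 = "[2, 4, 5, 4, 3, 2, 1, 2]"
  have tree: "rooted_tree ?G 7 (\<lambda>v. if v = 8 then 3 else Suc v) (\<lambda>v. if v = 8 then 5 else 7 - v)"
    by code_simp
  have paths: "path_vertices ?G 2 7 = {2, 3, 4, 5, 6, 7}" "path_vertices ?G 8 7 = {3, 4, 5, 6, 7, 8}"
    by (simp_all add: path_vertices_rec[OF tree] insert_commute)
  have fin: "finite {2, 3, 4, 5, 6, 7 :: nat}" "finite {3, 4, 5, 6, 7, 8 :: nat}" by simp_all
  have mem: "mem ?t (concat (e_levels 8)) \<and> mem ?q1 (concat (e_levels 8)) \<and> mem ?q2 (concat (e_levels 8)) \<and>
    all_dominated ?t (concat (e_levels 8)) \<and> pairing (e_matrix 8) ?t = unit_list 8 6 \<and>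
    dot ?q1 (pairing (e_matrix 8) ?q2) = 0"
    by code_simp
  have max: "max_rows ?q1 ?q2 (annotate (e_matrix 8) (concat (e_levels 8)))"
    by code_simp
  have t: "highest_root ?G = vl ?t"
    using E8.highest_root_E[of ?t] mem by (simp only: mem_iff)
  have y: "y_index ?G = 7"
    using E8.y_index_E[OF t, of 7] mem by (simp add: mem_iff del: set_concat)
  have q: "highest_root ?G - path_root ?G 2 7 = vl ?q1" "highest_root ?G - path_root ?G 8 7 = vl ?q2"
    unfolding t path_root_E[OF paths(1) fin(1)] path_root_E[OF paths(2) fin(2)]
    by (auto simp: fun_eq_iff vl_def nth_Cons eval_nat_numeral split: nat.splits)
  show ?thesis
    unfolding Let_def y q using E8.highest_two_root_E[OF max] mem by (simp only: mem_iff simp_thms)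
qed

theorem theorem6p8:
  shows
    "\<comment> \<open>(i) type A\<close>
     (\<forall>n > 2.
        let \<Gamma> = DynkinA n;
            q = path_root \<Gamma> 1 (n - 1) \<or>\<^sub>2 path_root \<Gamma> 2 n
        in two_root_orbits \<Gamma> = {orbit \<Gamma> q} \<and>
           is_highest \<Gamma> (orbit \<Gamma> q) q \<and>
           q = (eps 1 - eps n) \<or>\<^sub>2 (eps 2 - eps (n + 1))) \<and>

     \<comment> \<open>(ii) type D4\<close>
     (let \<Gamma> = DynkinD 4;
          \<theta> = highest_root \<Gamma>;
          q1 = (\<theta> - path_root \<Gamma> 2 4) \<or>\<^sub>2 (\<theta> - path_root \<Gamma> 2 3);
          q2 = (\<theta> - path_root \<Gamma> 2 4) \<or>\<^sub>2 (\<theta> - path_root \<Gamma> 1 2);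
          q3 = (\<theta> - path_root \<Gamma> 2 3) \<or>\<^sub>2 (\<theta> - path_root \<Gamma> 1 2)
      in two_root_orbits \<Gamma> = {orbit \<Gamma> q1, orbit \<Gamma> q2, orbit \<Gamma> q3} \<and>
         card (two_root_orbits \<Gamma>) = 3 \<and>
         is_highest \<Gamma> (orbit \<Gamma> q1) q1 \<and>
         q1 = path_root \<Gamma> 1 3 \<or>\<^sub>2 path_root \<Gamma> 1 4 \<and>
         q1 = (eps 1 - eps 4) \<or>\<^sub>2 (eps 1 + eps 4) \<and>
         q1 = eps 1 \<or>\<^sub>2 eps 1 - eps 4 \<or>\<^sub>2 eps 4 \<and>
         is_highest \<Gamma> (orbit \<Gamma> q2) q2 \<and>
         q2 = path_root \<Gamma> 1 3 \<or>\<^sub>2 path_root \<Gamma> 3 4 \<and>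
         q2 = (eps 1 - eps 4) \<or>\<^sub>2 (eps 2 + eps 3) \<and>
         is_highest \<Gamma> (orbit \<Gamma> q3) q3 \<and>
         q3 = path_root \<Gamma> 1 4 \<or>\<^sub>2 path_root \<Gamma> 3 4 \<and>
         q3 = (eps 1 + eps 4) \<or>\<^sub>2 (eps 2 + eps 3)) \<and>

     \<comment> \<open>(iii), (iv) type Dn, n at least 5: small and large orbit\<close>
     (\<forall>n \<ge> 5.
        let \<Gamma> = DynkinD n;
            \<theta> = highest_root \<Gamma>;
            qs = path_root \<Gamma> 1 (n - 1) \<or>\<^sub>2 path_root \<Gamma> 1 n;
            ql = (\<theta> - path_root \<Gamma> 1 2) \<or>\<^sub>2 (\<theta> - path_root \<Gamma> 2 3)
        in two_root_orbits \<Gamma> = {orbit \<Gamma> qs, orbit \<Gamma> ql} \<and>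
           orbit \<Gamma> qs \<inter> pos_two_roots \<Gamma> = small_pos_two_roots n \<and>
           is_highest \<Gamma> (orbit \<Gamma> qs) qs \<and>
           qs = (eps 1 - eps n) \<or>\<^sub>2 (eps 1 + eps n) \<and>
           qs = eps 1 \<or>\<^sub>2 eps 1 - eps n \<or>\<^sub>2 eps n \<and>
           orbit \<Gamma> ql \<inter> pos_two_roots \<Gamma> = large_pos_two_roots n \<and>
           is_highest \<Gamma> (orbit \<Gamma> ql) ql \<and>
           ql = (\<theta> - simple_root \<Gamma> 1 - simple_root \<Gamma> 2) \<or>\<^sub>2
                (\<theta> - simple_root \<Gamma> 2 - simple_root \<Gamma> 3) \<and>
           ql = (eps 2 + eps 3) \<or>\<^sub>2 (eps 1 + eps 4)) \<and>

     \<comment> \<open>(v) type E6\<close>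
     (let \<Gamma> = DynkinE 6; x = 6; y = y_index \<Gamma>;
          \<theta> = highest_root \<Gamma>;
          q = (\<theta> - path_root \<Gamma> 2 x) \<or>\<^sub>2 (\<theta> - path_root \<Gamma> 4 x)
      in two_root_orbits \<Gamma> = {orbit \<Gamma> q} \<and>
         is_highest \<Gamma> (orbit \<Gamma> q) q \<and>
         q = (\<theta> - path_root \<Gamma> 2 y) \<or>\<^sub>2 (\<theta> - path_root \<Gamma> 4 y)) \<and>

     \<comment> \<open>(vi) type E7\<close>
     (let \<Gamma> = DynkinE 7; x = 7; y = y_index \<Gamma>;
          \<theta> = highest_root \<Gamma>;
          q = (\<theta> - path_root \<Gamma> x 1) \<or>\<^sub>2 (\<theta> - path_root \<Gamma> 4 1)
      in two_root_orbits \<Gamma> = {orbit \<Gamma> q} \<and>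
         is_highest \<Gamma> (orbit \<Gamma> q) q \<and>
         q = (\<theta> - path_root \<Gamma> x y) \<or>\<^sub>2 (\<theta> - path_root \<Gamma> 4 y)) \<and>

     \<comment> \<open>(vii) type E8\<close>
     (let \<Gamma> = DynkinE 8; x = 8; y = y_index \<Gamma>;
          \<theta> = highest_root \<Gamma>;
          q = (\<theta> - path_root \<Gamma> 2 7) \<or>\<^sub>2 (\<theta> - path_root \<Gamma> x 7)
      in two_root_orbits \<Gamma> = {orbit \<Gamma> q} \<and>
         is_highest \<Gamma> (orbit \<Gamma> q) q \<and>
         q = (\<theta> - path_root \<Gamma> 2 y) \<or>\<^sub>2 (\<theta> - path_root \<Gamma> x y))"
  by (intro conjI highest_two_roots_A highest_two_roots_D4 highest_two_roots_D highest_two_roots_E6 highest_two_roots_E7 highest_two_roots_E8)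

end
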